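(* Let $d\geq1$, let $U$ be a nearest-neighbor potential on $\Omega=\{-,+\}^{\mathbb{Z}^d}$ and let $\mathbb{P}$ be a Gibbs measure with potential $U$. For $y\in\mathbb{Z}^d$ put $$p_y:=2\sup_{\sigma,\sigma'\in\Omega}\left|\mathbb{P}(\sigma_y=+\mid\sigma_{\mathbb{Z}^d\setminus y})-\mathbb{P}(\sigma'_y=+\mid\sigma'_{\mathbb{Z}^d\setminus y})\right|,$$ and assume that $\sup\{p_y:y\in\mathbb{Z}^d\}<p_c$, where $p_c=p_c(d)$ is the critical threshold for site percolation on $\mathbb{Z}^d$. Let $D^\sigma_{x,y}:=\hat{\mathbb{P}}^\sigma_{x,+,-}\{X_1(y)\neq X_2(y)\}$ be the coupling matrix, where $\hat{\mathbb{P}}^\sigma_{x,+,-}$ is the maximal coupling of $\mathbb{P}(\cdot\mid\sigma_{<x},+_x)$ and $\mathbb{P}(\cdot\mid\sigma_{<x},-_x)$. Then we have the uniform estimate $$D^\sigma_{x,y}\leq e^{-C|x-y|}\qquad\text{for all }x,y\in\mathbb{Z}^d,\ \sigma\in\Omega,$$ for some $C>0$. Hence the following exponential concentration inequality holds: for any local function $g:\Omega\to\mathbb{R}$ and all $t>0$, $$\mathbb{P}\left\{|g-\mathbb{E}g|\geq t\right\}\leq2\exp\left(-\frac{2t^2}{\frac{1}{1-e^{-2C}}\,\|\delta g\|^2_{\ell^2(\mathbb{Z}^d)}}\right).$$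
   Context: Gibbs measures: a nearest-neighbor potential is a family of real functions $U(A,\sigma)$, indexed by finite $A\subset\mathbb{Z}^d$, such that $U(A,\sigma)$ depends only on $\sigma_A$ and $U(A,\cdot)=0$ if $\mathrm{diam}(A)>1$. For finite $\Lambda$ and boundary condition $\eta$, $H^\eta_\Lambda(\sigma)=\sum_{A\cap\Lambda\neq\emptyset}U(A,\sigma_\Lambda\eta_{\Lambda^c})$, where $\sigma_\Lambda\eta_{\Lambda^c}$ equals $\sigma$ on $\Lambda$ and $\eta$ off $\Lambda$; the specification is $\gamma_\Lambda(\sigma\mid\eta)=e^{-H^\eta_\Lambda(\sigma)}/Z^\eta_\Lambda$ ($Z^\eta_\Lambda$ the normalization over $\sigma_\Lambda$). $\mathbb{P}$ is a Gibbs measure with potential $U$ if, for every finite $\Lambda$, $\gamma_\Lambda(\sigma\mid\cdot)$ is a version of the conditional probability of $\sigma_\Lambda$ given the spins off $\Lambda$. The single-site conditional probabilities in $p_y$ are those given by $\gamma_{\{y\}}$. A function is local if it depends only on finitely many coordinates; $\delta_xg=\sup_\sigma|g(\sigma^x)-g(\sigma)|$ with $\sigma^x$ equal to $\sigma$ flipped at $x$; $\delta g=(\delta_xg)_x$; $\|\delta g\|^2_{\ell^2(\mathbb{Z}^d)}=\sum_x(\delta_xg)^2$. If $\delta g=0$ the exponential is read as $0$. $|\cdot|$ is a fixed norm on $\mathbb{Z}^d$. Ordering: $\Gamma:\mathbb{Z}^d\to\mathbb{N}$ is a fixed bijection, the "spiraling enumeration" (the origin first, then the sites of successive shells around the origin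 in a spiral); $(<x)=\{y:\Gamma(y)<\Gamma(x)\}$ and $(\le x)=\{y:\Gamma(y)\le\Gamma(x)\}$. $\mathbb{P}(\cdot\mid\sigma_{<x},\pm_x)$ is $\mathbb{P}$ conditioned on the configuration being equal to $\sigma$ on $(<x)$ and to $\pm$ at $x$, regarded as a measure on $\Omega$. The maximal coupling of these two measures is the joint law of a pair $(X_1,X_2)$ having them as marginals for which the probability that $X_1$ and $X_2$ coincide off $(\le x)$ is as large as possible.
   Formalization: The maximal coupling is not unique and the estimate fails for some maximal couplings (e.g. a one-dimensional Ising chain with residual laws coupled independently); the formal statement asserts it for a suitably chosen maximal coupling for each x and σ. *)

theory Defs
  imports "HOL-Probability.Probability"
begin

text \<open>
  Sites are elements of \<^typ>\<open>int ^ 'd\<close>, so the dimension is \<open>CARD('d) \<ge> 1\<close>.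
  A spin \<open>+\<close> is \<^term>\<open>True\<close>, a spin \<open>-\<close> is \<^term>\<open>False\<close>.
  Diameters and adjacency are taken in the Euclidean metric: for lattice points, Euclidean distance
  at most 1 (equal to 1) is the same as graph distance at most 1 (equal to 1).
\<close>

type_synonym 'd site = "int ^ 'd"
type_synonym 'd config = "'d site \<Rightarrow> bool"

definition to_real :: "'d::finite site \<Rightarrow> real ^ 'd" where
  "to_real x = (\<chi> i. real_of_int (x $ i))"

definition lattice_norm :: "('d::finite site \<Rightarrow> real) \<Rightarrow> bool" where
  "lattice_norm nrm \<longleftrightarrow>
     (\<exists>N :: real ^ 'd \<Rightarrow> real.
        (\<forall>v. N v = 0 \<longleftrightarrow> v = 0) \<and>
        (\<forall>a v. N (a *\<^sub>R v) = \<bar>a\<bar> * N v) \<and>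
        (\<forall>v w. N (v + w) \<le> N v + N w) \<and>
        (\<forall>x. nrm x = N (to_real x)))"

text \<open>
  The origin comes first and then the sites of successive shells, a shell being a level set of
  some norm (the sup norm for the square spiral). The order inside a shell is left arbitrary.
\<close>
definition spiraling :: "('d::finite site \<Rightarrow> nat) \<Rightarrow> bool" where
  "spiraling \<Gamma> \<longleftrightarrow> bij \<Gamma> \<and> \<Gamma> 0 = 0 \<and>
     (\<exists>shell. lattice_norm shell \<and> (\<forall>x y. shell x < shell y \<longrightarrow> \<Gamma> x < \<Gamma> y))"

definition spin_space :: "'d::finite config measure" where
  "spin_space = PiM UNIV (\<lambda>_. count_space UNIV)"

definition outside :: "'d::finite site set \<Rightarrow> 'd config measure" where
  "outside \<Lambda> = vimage_algebra UNIV (\<lambda>\<omega>. restrict \<omega> (- \<Lambda>)) (PiM (- \<Lambda>) (\<lambda>_. count_space UNIV))"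

definition nearest_neighbor :: "('d::finite site set \<Rightarrow> 'd config \<Rightarrow> real) \<Rightarrow> bool" where
  "nearest_neighbor U \<longleftrightarrow>
     (\<forall>A. finite A \<longrightarrow>
        (\<forall>\<sigma> \<sigma>'. (\<forall>x\<in>A. \<sigma> x = \<sigma>' x) \<longrightarrow> U A \<sigma> = U A \<sigma>') \<and>
        (diameter (to_real ` A) > 1 \<longrightarrow> (\<forall>\<sigma>. U A \<sigma> = 0)))"

text \<open>
  \<^term>\<open>override_on \<eta> \<sigma> \<Lambda>\<close> is \<open>\<sigma>\<close> on \<open>\<Lambda>\<close> and \<open>\<eta>\<close> off \<open>\<Lambda>\<close>. For a nearest-neighbor potential and
  finite \<open>\<Lambda>\<close> only finitely many terms of the infinite sum are nonzero.
\<close>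
definition hamiltonian ::
  "('d::finite site set \<Rightarrow> 'd config \<Rightarrow> real) \<Rightarrow> 'd site set \<Rightarrow> 'd config \<Rightarrow> 'd config \<Rightarrow> real" where
  "hamiltonian U \<Lambda> \<eta> \<sigma> =
     (\<Sum>\<^sub>\<infinity>A\<in>{A. finite A \<and> A \<inter> \<Lambda> \<noteq> {}}. U A (override_on \<eta> \<sigma> \<Lambda>))"

definition partition_function ::
  "('d::finite site set \<Rightarrow> 'd config \<Rightarrow> real) \<Rightarrow> 'd site set \<Rightarrow> 'd config \<Rightarrow> real" where
  "partition_function U \<Lambda> \<eta> = (\<Sum>\<tau>\<in>\<Lambda> \<rightarrow>\<^sub>E UNIV. exp (- hamiltonian U \<Lambda> \<eta> \<tau>))"

definition gibbs_spec ::
  "('d::finite site set \<Rightarrow> 'd config \<Rightarrow> real) \<Rightarrow> 'd site set \<Rightarrow> 'd config \<Rightarrow> 'd config \<Rightarrow> real" where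
  "gibbs_spec U \<Lambda> \<sigma> \<eta> = exp (- hamiltonian U \<Lambda> \<eta> \<sigma>) / partition_function U \<Lambda> \<eta>"

definition gibbs_measure ::
  "('d::finite site set \<Rightarrow> 'd config \<Rightarrow> real) \<Rightarrow> 'd config measure \<Rightarrow> bool" where
  "gibbs_measure U P \<longleftrightarrow>
     prob_space P \<and> sets P = sets spin_space \<and>
     (\<forall>\<Lambda> \<sigma>. finite \<Lambda> \<longrightarrow>
        gibbs_spec U \<Lambda> \<sigma> \<in> borel_measurable (outside \<Lambda>) \<and>
        (AE \<eta> in P. real_cond_exp P (outside \<Lambda>) (indicator {\<omega>. \<forall>x\<in>\<Lambda>. \<omega> x = \<sigma> x}) \<eta>
                      = gibbs_spec U \<Lambda> \<sigma> \<eta>))"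

definition site_influence ::
  "('d::finite site set \<Rightarrow> 'd config \<Rightarrow> real) \<Rightarrow> 'd site \<Rightarrow> real" where
  "site_influence U y =
     2 * (SUP (\<sigma>, \<sigma>')\<in>UNIV. \<bar>gibbs_spec U {y} (\<lambda>_. True) \<sigma> - gibbs_spec U {y} (\<lambda>_. True) \<sigma>'\<bar>)"

definition open_cluster :: "'d::finite config \<Rightarrow> 'd site \<Rightarrow> 'd site set" where
  "open_cluster \<omega> x = {y. \<omega> x \<and> (\<lambda>u v. dist (to_real u) (to_real v) = 1 \<and> \<omega> u \<and> \<omega> v)\<^sup>*\<^sup>* x y}"

definition percolation :: "real \<Rightarrow> 'd::finite config measure" where
  "percolation p = PiM UNIV (\<lambda>_. measure_pmf (bernoulli_pmf p))"

definition critical_threshold :: "'d::finite itself \<Rightarrow> real" where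
  "critical_threshold _ =
     Sup {p \<in> {0..1}. measure (percolation p) {\<omega> :: 'd config. infinite (open_cluster \<omega> 0)} = 0}"

text \<open>\<open>uniform_measure P B\<close> is the conditional measure \<open>P(\<cdot> | B)\<close>.\<close>
definition cond_measure ::
  "('d::finite site \<Rightarrow> nat) \<Rightarrow> 'd config measure \<Rightarrow> 'd config \<Rightarrow> 'd site \<Rightarrow> bool \<Rightarrow> 'd config measure"
  where
  "cond_measure \<Gamma> P \<sigma> x s =
     uniform_measure P {\<omega>. (\<forall>y. \<Gamma> y < \<Gamma> x \<longrightarrow> \<omega> y = \<sigma> y) \<and> \<omega> x = s}"

definition coupling ::
  "'d::finite config measure \<Rightarrow> 'd config measure \<Rightarrow> ('d config \<times> 'd config) measure \<Rightarrow> bool" where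
  "coupling \<mu> \<nu> Q \<longleftrightarrow>
     sets Q = sets (\<mu> \<Otimes>\<^sub>M \<nu>) \<and> distr Q \<mu> fst = \<mu> \<and> distr Q \<nu> snd = \<nu>"

text \<open>
  Such a coupling is in general not unique: the definition does not determine the joint law on the
  event of disagreement.
\<close>
definition maximal_coupling ::
  "('d::finite site \<Rightarrow> nat) \<Rightarrow> 'd config measure \<Rightarrow> 'd config \<Rightarrow> 'd site \<Rightarrow>
     ('d config \<times> 'd config) measure \<Rightarrow> bool" where
  "maximal_coupling \<Gamma> P \<sigma> x Q \<longleftrightarrow>
     (let \<mu> = cond_measure \<Gamma> P \<sigma> x True;
          \<nu> = cond_measure \<Gamma> P \<sigma> x False;
          agree = {(\<omega>1, \<omega>2). \<forall>y. \<Gamma> x < \<Gamma> y \<longrightarrow> \<omega>1 y = \<omega>2 y}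
      in coupling \<mu> \<nu> Q \<and> (\<forall>Q'. coupling \<mu> \<nu> Q' \<longrightarrow> measure Q' agree \<le> measure Q agree))"

definition coupling_matrix ::
  "('d::finite site \<Rightarrow> 'd config \<Rightarrow> ('d config \<times> 'd config) measure) \<Rightarrow>
     'd config \<Rightarrow> 'd site \<Rightarrow> 'd site \<Rightarrow> real" where
  "coupling_matrix Q \<sigma> x y = measure (Q x \<sigma>) {(\<omega>1, \<omega>2). \<omega>1 y \<noteq> \<omega>2 y}"

definition local_function :: "('d::finite config \<Rightarrow> real) \<Rightarrow> bool" where
  "local_function g \<longleftrightarrow>
     (\<exists>S. finite S \<and> (\<forall>\<sigma> \<sigma>'. (\<forall>x\<in>S. \<sigma> x = \<sigma>' x) \<longrightarrow> g \<sigma> = g \<sigma>'))"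

definition oscillation :: "('d::finite config \<Rightarrow> real) \<Rightarrow> 'd site \<Rightarrow> real" where
  "oscillation g x = (SUP \<sigma>. \<bar>g (\<sigma>(x := \<not> \<sigma> x)) - g \<sigma>\<bar>)"

end

theory Submission
  imports Defs
begin

text \<open>
  Let \<open>q < p\<^sub>c\<close> bound the influences. Sharpness of the phase transition, in the form of
  Duminil-Copin and Tassion, gives a finite set \<open>S\<close> containing the origin such that the expected
  number of boundary sites of \<open>S\<close> connected to the origin inside \<open>S\<close>, times \<open>q\<close>, is less than 1;
  iterating this, connection probabilities at \<open>q\<close> decay exponentially. By disagreement percolation
  (van den Berg and Maes) the two conditional measures restricted to a finite window have a coupling
  whose disagreements are dominated by the Bernoulli cluster of \<open>x\<close> and of the window boundary.
  Rerouting mass makes this coupling maximal without increasing any disagreement probability; a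
  subsequential limit over growing windows is a maximal coupling with exponentially small
  disagreement probabilities. The martingale differences of \<open>g\<close> are then controlled by \<open>D \<delta>g\<close>, and
  Hoeffding's lemma with the Schur test yields Gaussian concentration with some constant, which is
  turned into \<open>1 / (1 - exp (- 2 * C))\<close> by making \<open>C\<close> small.
\<close>

section \<open>Finite Bernoulli percolation\<close>

text \<open>Percolation is handled through finite sums over open sets, because sharpness, decoupling
  and disagreement percolation are all explorations: the state of one well-chosen site is revealed
  and induction runs on the remaining ones. Russo's formula and the independence of explored and
  unexplored sites are then instances of conditioning on a single site. The obstacle is that
  maximality and locality pull apart. Maximality concerns the one event of agreement at all sites
  after \<open>x\<close> and does not determine where a pair differs otherwise; disagreement
  percolation controls each single site but need not be maximal. The two are reconciled because
  every cost \<open>of_bool (u y \<noteq> v y)\<close> is a pseudometric, so mass can be moved to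
  the diagonal without raising any of these costs, and one suitable maximal coupling is selected for
  each \<open>x\<close> and \<sigma>. A second obstacle is the rim of the window, where the
  conditional laws are not given by the specification. The rim is treated as disagreeing everywhere;
  the price is a connection to a distant rim, which vanishes in the limit.\<close>

definition bern_exp :: "real \<Rightarrow> 'a set \<Rightarrow> ('a set \<Rightarrow> real) \<Rightarrow> real" where
  "bern_exp p V f = (\<Sum>T\<in>Pow V. p ^ card T * (1 - p) ^ card (V - T) * f T)"

lemma bern_exp_empty [simp]: "bern_exp p {} f = f {}"
  by (simp add: bern_exp_def)

text \<open>Conditioning on the state of \<open>u\<close>; every exploration below is an induction
  along this identity.\<close>

lemma bern_exp_insert:
  assumes "finite V" "u \<notin> V"
  shows "bern_exp p (insert u V) f
    = p * bern_exp p V (\<lambda>T. f (insert u T)) + (1 - p) * bern_exp p V f"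
proof -
  have inj: "inj_on (insert u) (Pow V)"
    using assms(2) by (auto simp: inj_on_def)
  have disj: "Pow V \<inter> insert u ` Pow V = {}"
    using assms(2) by auto
  have closed: "p ^ card T * (1 - p) ^ card (insert u V - T) * f T
      = (1 - p) * (p ^ card T * (1 - p) ^ card (V - T) * f T)" if "T \<in> Pow V" for T
  proof -
    have "insert u V - T = insert u (V - T)" "u \<notin> V - T" using that assms by auto
    then show ?thesis using assms by simp
  qed
  have opened: "p ^ card (insert u T) * (1 - p) ^ card (insert u V - insert u T) * f (insert u T)
      = p * (p ^ card T * (1 - p) ^ card (V - T) * f (insert u T))" if "T \<in> Pow V" for T
  proof -
    have "insert u V - insert u T = V - T" "u \<notin> T" "finite T"
      using that assms finite_subset by auto
    then show ?thesis by simp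
  qed
  let ?w = "\<lambda>T. p ^ card T * (1 - p) ^ card (insert u V - T) * f T"
  have "bern_exp p (insert u V) f = sum ?w (Pow V) + sum ?w (insert u ` Pow V)"
    unfolding bern_exp_def Pow_insert using assms disj by (intro sum.union_disjoint) auto
  also have "sum ?w (insert u ` Pow V) = p * bern_exp p V (\<lambda>T. f (insert u T))"
    unfolding bern_exp_def sum_distrib_left sum.reindex[OF inj] o_def
    by (intro sum.cong refl opened)
  also have "sum ?w (Pow V) = (1 - p) * bern_exp p V f"
    unfolding bern_exp_def sum_distrib_left by (intro sum.cong refl closed)
  finally show ?thesis by simp
qed

lemma bern_exp_cong:
  assumes "\<And>T. T \<subseteq> V \<Longrightarrow> f T = g T"
  shows "bern_exp p V f = bern_exp p V g"
  using assms by (auto simp: bern_exp_def intro!: sum.cong)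

lemma bern_exp_mono:
  assumes "0 \<le> p" "p \<le> 1" "\<And>T. T \<subseteq> V \<Longrightarrow> f T \<le> g T"
  shows "bern_exp p V f \<le> bern_exp p V g"
  using assms by (auto simp: bern_exp_def intro!: sum_mono mult_left_mono)

lemma bern_exp_const [simp]: "finite V \<Longrightarrow> bern_exp p V (\<lambda>_. c) = c"
  by (induction V rule: finite_induct) (auto simp: bern_exp_insert algebra_simps)

lemma bern_exp_nonneg:
  assumes "0 \<le> p" "p \<le> 1" "\<And>T. T \<subseteq> V \<Longrightarrow> 0 \<le> f T"
  shows "0 \<le> bern_exp p V f"
  using assms by (auto simp: bern_exp_def intro!: sum_nonneg mult_nonneg_nonneg)

lemma bern_exp_add: "bern_exp p V (\<lambda>T. f T + g T) = bern_exp p V f + bern_exp p V g"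
  by (simp add: bern_exp_def sum.distrib algebra_simps)

lemma bern_exp_cmult: "bern_exp p V (\<lambda>T. c * f T) = c * bern_exp p V f"
  by (simp add: bern_exp_def sum_distrib_left algebra_simps)

lemma bern_exp_sum: "bern_exp p V (\<lambda>T. \<Sum>i\<in>I. f i T) = (\<Sum>i\<in>I. bern_exp p V (f i))"
  unfolding bern_exp_def by (subst sum.swap) (simp add: sum_distrib_left)

text \<open>The induction hypothesis raises the parameter on the other sites; at \<open>u\<close>
  the weight \<open>q - p\<close> then passes from the closed to the open branch, where a monotone
  \<open>f\<close> is larger.\<close>

lemma bern_exp_mono_param:
  assumes "0 \<le> p" "p \<le> q" "q \<le> 1" "finite V" "mono f"
  shows "bern_exp p V f \<le> bern_exp q V f"
  using assms(4,5)
proof (induction V arbitrary: f rule: finite_induct)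
  case (insert u V)
  let ?g = "\<lambda>T. f (insert u T)"
  have g: "mono ?g"
    using insert.prems by (auto intro!: monoI monoD[OF insert.prems])
  have le: "bern_exp q V f \<le> bern_exp q V ?g"
    using insert.prems assms by (intro bern_exp_mono) (auto intro: monoD)
  have "p * bern_exp p V ?g + (1 - p) * bern_exp p V f
      \<le> p * bern_exp q V ?g + (1 - p) * bern_exp q V f"
    using insert.IH[OF g] insert.IH[OF insert.prems] assms
    by (intro add_mono mult_left_mono) auto
  also have "\<dots> \<le> q * bern_exp q V ?g + (1 - q) * bern_exp q V f"
    using mult_right_mono[OF le, of "q - p"] assms by (simp add: algebra_simps)
  finally show ?case
    using insert.hyps by (simp add: bern_exp_insert)
qed auto

text \<open>An additional site has no effect when closed and can only increase \<open>f\<close> when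
  open.\<close>

lemma bern_exp_mono_set:
  assumes "0 \<le> p" "p \<le> 1" "finite V'" "V \<subseteq> V'" "mono f"
  shows "bern_exp p V f \<le> bern_exp p V' f"
  using assms(3,4)
proof (induction "V' - V" arbitrary: V' rule: infinite_finite_induct)
  case empty
  then have "V' = V" by auto
  then show ?case by simp
next
  case (insert u D)
  let ?L = "V' - {u}"
  have u: "u \<in> V'" "u \<notin> V" using insert.hyps by auto
  have "bern_exp p V f \<le> bern_exp p ?L f"
    using insert.hyps insert.prems u by (intro insert.hyps(3)) auto
  also have "\<dots> \<le> bern_exp p (insert u ?L) f"
  proof -
    have "bern_exp p ?L f \<le> bern_exp p ?L (\<lambda>T. f (insert u T))"
      using assms by (intro bern_exp_mono) (auto intro: monoD)
    from mult_left_mono[OF this assms(1)] show ?thesis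
      using insert.prems by (subst bern_exp_insert) (auto simp: algebra_simps)
  qed
  finally show ?case using u by (simp add: insert_absorb)
qed auto

text \<open>Injective relabelling of the sites, the source of translation invariance on the
  lattice.\<close>

lemma bern_exp_image:
  assumes "inj_on h V"
  shows "bern_exp p (h ` V) f = bern_exp p V (\<lambda>T. f (h ` T))"
proof -
  have inj: "inj_on (image h) (Pow V)"
    using assms by (rule inj_on_image_Pow)
  have "card (h ` T) = card T \<and> card (h ` V - h ` T) = card (V - T)" if "T \<subseteq> V" for T
    using that assms
    by (metis Diff_subset card_image inj_on_image_set_diff inj_on_subset order_refl)
  then show ?thesis
    unfolding bern_exp_def image_Pow_surj[OF refl, symmetric]
    by (auto simp: sum.reindex[OF inj] intro!: sum.cong)
qed

lemma bern_exp_differentiable: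
  "finite V \<Longrightarrow> (\<lambda>p. bern_exp p V f) differentiable (at (p::real))"
proof (induction V arbitrary: f rule: finite_induct)
  case (insert u V)
  show ?case
    unfolding bern_exp_insert[OF insert.hyps]
    by (intro differentiable_add differentiable_mult differentiable_diff insert.IH) auto
qed auto

section \<open>Clusters of open sites and finite-volume connection probabilities\<close>

inductive_set cluster :: "('a \<Rightarrow> 'a \<Rightarrow> bool) \<Rightarrow> 'a set \<Rightarrow> 'a set \<Rightarrow> 'a set"
  for E :: "'a \<Rightarrow> 'a \<Rightarrow> bool" and T B :: "'a set" where
  base: "b \<in> B \<Longrightarrow> b \<in> cluster E T B"
| step: "u \<in> cluster E T B \<Longrightarrow> v \<in> T \<Longrightarrow> E u v \<Longrightarrow> v \<in> cluster E T B"

text \<open>Only the intermediate sites of a connection from \<open>B\<close> to \<open>A\<close> have to be open.\<close>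

definition touches :: "('a \<Rightarrow> 'a \<Rightarrow> bool) \<Rightarrow> 'a set \<Rightarrow> 'a set \<Rightarrow> 'a set \<Rightarrow> bool" where
  "touches E T B A \<longleftrightarrow> (\<exists>u\<in>cluster E T B. \<exists>a\<in>A. E u a)"

definition conn_prob :: "('a \<Rightarrow> 'a \<Rightarrow> bool) \<Rightarrow> real \<Rightarrow> 'a set \<Rightarrow> 'a set \<Rightarrow> 'a set \<Rightarrow> real" where
  "conn_prob E p V B A = bern_exp p V (\<lambda>T. of_bool (touches E T B A))"

lemma cluster_subset: "cluster E T B \<subseteq> B \<union> T"
proof
  fix v assume "v \<in> cluster E T B" then show "v \<in> B \<union> T"
    by (induction rule: cluster.induct) auto
qed

lemma cluster_mono: assumes "T \<subseteq> T'" "B \<subseteq> B'" shows "cluster E T B \<subseteq> cluster E T' B'"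
proof
  fix v assume "v \<in> cluster E T B" then show "v \<in> cluster E T' B'"
    by (induction rule: cluster.induct) (use assms in \<open>auto intro: cluster.intros\<close>)
qed

lemma touches_mono: "T \<subseteq> T' \<Longrightarrow> B \<subseteq> B' \<Longrightarrow> A \<subseteq> A' \<Longrightarrow> touches E T B A \<Longrightarrow> touches E T' B' A'"
  unfolding touches_def using cluster_mono by blast

lemma cluster_Un: "cluster E T (B \<union> B') = cluster E T B \<union> cluster E T B'"
proof
  show "cluster E T (B \<union> B') \<subseteq> cluster E T B \<union> cluster E T B'"
  proof
    fix v assume "v \<in> cluster E T (B \<union> B')" then show "v \<in> cluster E T B \<union> cluster E T B'"
      by (induction rule: cluster.induct) (auto intro: cluster.intros)
  qed
qed (simp add: cluster_mono)

lemma cluster_idem: "B' \<subseteq> cluster E T B \<Longrightarrow> cluster E T B' \<subseteq> cluster E T B"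
proof
  fix v assume B': "B' \<subseteq> cluster E T B" and "v \<in> cluster E T B'"
  from this(2) show "v \<in> cluster E T B"
    by (induction rule: cluster.induct) (use B' in \<open>auto intro: cluster.intros\<close>)
qed

text \<open>A neighbour of a source is reached as soon as it is open, so an open \<open>u\<close>
  may be promoted to a source.\<close>

lemma cluster_insert_source:
  assumes "b \<in> B" "E b u"
  shows "cluster E (insert u T) B = cluster E T (insert u B)"
proof
  show "cluster E (insert u T) B \<subseteq> cluster E T (insert u B)"
  proof
    fix v assume "v \<in> cluster E (insert u T) B" then show "v \<in> cluster E T (insert u B)"
      by (induction rule: cluster.induct) (auto intro: cluster.intros)
  qed
  have u: "u \<in> cluster E (insert u T) B"
    by (rule cluster.step[of b]) (use assms in \<open>auto intro: cluster.base\<close>)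
  show "cluster E T (insert u B) \<subseteq> cluster E (insert u T) B"
  proof
    fix v assume "v \<in> cluster E T (insert u B)" then show "v \<in> cluster E (insert u T) B"
      by (induction rule: cluster.induct) (use u in \<open>auto intro: cluster.intros\<close>)
  qed
qed

lemma cluster_insert_isolated:
  assumes "\<not> touches E T B {u}"
  shows "cluster E (insert u T) B = cluster E T B"
proof
  show "cluster E (insert u T) B \<subseteq> cluster E T B"
  proof
    fix v assume "v \<in> cluster E (insert u T) B" then show "v \<in> cluster E T B"
      by (induction rule: cluster.induct)
         (use assms in \<open>auto simp: touches_def intro: cluster.intros\<close>)
  qed
qed (rule cluster_mono; blast)

lemma cluster_remove_source: "cluster E (T - {z}) {z} = cluster E T {z}"
proof
  show "cluster E T {z} \<subseteq> cluster E (T - {z}) {z}"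
  proof
    fix v assume "v \<in> cluster E T {z}" then show "v \<in> cluster E (T - {z}) {z}"
    proof (induction rule: cluster.induct)
      case (step u v)
      then show ?case by (cases "v = z") (auto intro: cluster.intros)
    qed (auto intro: cluster.base)
  qed
qed (rule cluster_mono; blast)

lemma cluster_first_step:
  assumes "v \<in> cluster E T B"
  shows "v \<in> B \<or> (\<exists>z\<in>T. (\<exists>b\<in>B. E b z) \<and> v \<in> cluster E T {z})"
  using assms
proof (induction rule: cluster.induct)
  case (step u v)
  then show ?case by (meson cluster.intros singletonI)
qed auto

text \<open>A path from \<open>A\<close> to \<open>v\<close> is read backwards. Sources need not be
  open but \<open>v\<close> must be, unless it lies in \<open>A\<close>; the conjunct
  \<open>v \<in> T\<close> later yields a factor \<open>p\<close>.\<close>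

lemma cluster_reverse:
  assumes sym: "\<And>u v. E u v \<Longrightarrow> E v u" and "v \<in> cluster E T A"
  shows "v \<in> A \<or> v \<in> T \<and> touches E T {v} A"
  using assms(2)
proof (induction rule: cluster.induct)
  case (step u v)
  have "u \<in> A \<or> u \<in> T \<and> touches E T {u} A" by (rule step.IH)
  then have "touches E T {v} A"
  proof
    assume "u \<in> A"
    then show ?thesis
      using sym[OF step.hyps(3)] by (auto simp: touches_def intro: cluster.base)
  next
    assume u: "u \<in> T \<and> touches E T {u} A"
    then have "u \<in> cluster E T {v}"
      using sym[OF step.hyps(3)] by (auto intro: cluster.intros)
    then have "cluster E T {u} \<subseteq> cluster E T {v}" by (intro cluster_idem) auto
    with u show ?thesis by (auto simp: touches_def)
  qed
  with step.hyps show ?case by auto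
qed auto

text \<open>If the cluster touches \<open>u\<close>, both sides hold; otherwise opening
  \<open>u\<close> leaves the cluster unchanged. This is the counterpart, on the target side, of
  promoting an open site to a source.\<close>

lemma touches_insert_target:
  assumes "a \<in> A" "E u a"
  shows "touches E (insert u T) B A \<longleftrightarrow> touches E T B (insert u A)"
proof (cases "touches E T B {u}")
  case True
  then obtain w where w: "w \<in> cluster E T B" "E w u" by (auto simp: touches_def)
  then have "w \<in> cluster E (insert u T) B" using cluster_mono[of T "insert u T" B B E] by auto
  then have "u \<in> cluster E (insert u T) B" using w by (auto intro: cluster.step)
  then show ?thesis using w assms by (auto simp: touches_def)
next
  case False
  then show ?thesis by (auto simp: touches_def cluster_insert_isolated[OF False])
qed

lemma conn_prob_explore_source:
  assumes "finite V" "u \<notin> V" "b \<in> B" "E b u"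
  shows "conn_prob E p (insert u V) B A
    = p * conn_prob E p V (insert u B) A + (1 - p) * conn_prob E p V B A"
  using assms by (simp add: conn_prob_def bern_exp_insert touches_def cluster_insert_source)

lemma conn_prob_explore_target:
  assumes "finite V" "u \<notin> V" "a \<in> A" "E u a"
  shows "conn_prob E p (insert u V) B A
    = p * conn_prob E p V B (insert u A) + (1 - p) * conn_prob E p V B A"
  using assms touches_insert_target[of a A E u] by (simp add: conn_prob_def bern_exp_insert)

lemma mono_touches: "mono (\<lambda>T. of_bool (touches E T B A) :: real)"
  by (auto intro!: monoI dest: touches_mono[OF _ order_refl order_refl])

lemma conn_prob_nonneg: "0 \<le> p \<Longrightarrow> p \<le> 1 \<Longrightarrow> finite V \<Longrightarrow> 0 \<le> conn_prob E p V B A"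
  using bern_exp_mono[of p V "\<lambda>_. 0"] by (simp add: conn_prob_def)

lemma conn_prob_le_1: "0 \<le> p \<Longrightarrow> p \<le> 1 \<Longrightarrow> finite V \<Longrightarrow> conn_prob E p V B A \<le> 1"
  using bern_exp_mono[of p V _ "\<lambda>_. 1"] by (simp add: conn_prob_def)

lemma conn_prob_mono_set:
  "0 \<le> p \<Longrightarrow> p \<le> 1 \<Longrightarrow> finite V' \<Longrightarrow> V \<subseteq> V' \<Longrightarrow> conn_prob E p V B A \<le> conn_prob E p V' B A"
  unfolding conn_prob_def by (intro bern_exp_mono_set mono_touches)

lemma conn_prob_mono_param:
  "0 \<le> p \<Longrightarrow> p \<le> q \<Longrightarrow> q \<le> 1 \<Longrightarrow> finite V \<Longrightarrow> conn_prob E p V B A \<le> conn_prob E q V B A"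
  unfolding conn_prob_def by (intro bern_exp_mono_param mono_touches)

lemma conn_prob_adjacent: "finite V \<Longrightarrow> b \<in> B \<Longrightarrow> a \<in> A \<Longrightarrow> E b a \<Longrightarrow> conn_prob E p V B A = 1"
proof -
  assume *: "finite V" "b \<in> B" "a \<in> A" "E b a"
  then have "touches E T B A" for T by (auto simp: touches_def intro: cluster.base)
  with * show ?thesis by (simp add: conn_prob_def)
qed

lemma conn_prob_isolated:
  assumes "finite V" "\<And>u a. u \<in> B \<union> V \<Longrightarrow> a \<in> A \<Longrightarrow> \<not> E u a"
  shows "conn_prob E p V B A = 0"
proof -
  have "\<not> touches E T B A" if "T \<subseteq> V" for T
    using cluster_subset[of E T B] assms(2) that by (fastforce simp: touches_def)
  then have "conn_prob E p V B A = bern_exp p V (\<lambda>_. 0)"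
    unfolding conn_prob_def by (intro bern_exp_cong) auto
  with assms show ?thesis by simp
qed

text \<open>The state of \<open>z\<close> is independent of the other sites, and a path from
  \<open>z\<close> need not return to \<open>z\<close>; hence the factor \<open>p\<close>.\<close>

lemma conn_prob_open_source:
  assumes "finite V" "z \<in> V"
  shows "bern_exp p V (\<lambda>T. of_bool (z \<in> T \<and> touches E T {z} A)) = p * conn_prob E p (V - {z}) {z} A"
proof -
  let ?L = "V - {z}"
  have "bern_exp p (insert z ?L) (\<lambda>T. of_bool (z \<in> T \<and> touches E T {z} A))
    = p * bern_exp p ?L (\<lambda>T. of_bool (touches E (insert z T) {z} A))
      + (1 - p) * bern_exp p ?L (\<lambda>T. of_bool (z \<in> T \<and> touches E T {z} A))"
    using assms by (subst bern_exp_insert) auto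
  also have "bern_exp p ?L (\<lambda>T. of_bool (z \<in> T \<and> touches E T {z} A)) = bern_exp p ?L (\<lambda>_. 0)"
    by (intro bern_exp_cong) auto
  also have "bern_exp p ?L (\<lambda>T. of_bool (touches E (insert z T) {z} A)) = conn_prob E p ?L {z} A"
    unfolding conn_prob_def
  proof (intro bern_exp_cong)
    fix T assume "T \<subseteq> ?L"
    then have "insert z T - {z} = T" by auto
    then show "of_bool (touches E (insert z T) {z} A) = of_bool (touches E T {z} A)"
      using cluster_remove_source[of E "insert z T" z] by (simp add: touches_def)
  qed
  finally show ?thesis using assms by (simp add: insert_absorb)
qed

text \<open>An inequality of Simon-Lieb type: a path from \<open>B\<close> to \<open>A\<close> has
  to leave \<open>S\<close>, through an open site \<open>z\<close> that is reached from
  \<open>B\<close> inside \<open>S\<close>. The product form comes from exploring the cluster of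
  \<open>B\<close> in \<open>S\<close> site by site, so no inequality for disjoint occurrence
  enters.\<close>

lemma conn_prob_decouple:
  assumes p: "0 \<le> p" "p \<le> 1" and "finite S" "finite V"
    and "\<And>u a. u \<in> S \<union> B \<Longrightarrow> a \<in> A \<Longrightarrow> \<not> E u a"
  shows "conn_prob E p V B A
    \<le> (\<Sum>z\<in>V - S. conn_prob E p S B {z} * (p * conn_prob E p (V - {z}) {z} A))"
  using assms(3-5)
proof (induction S arbitrary: V B rule: finite_psubset_induct)
  case (psubset S)
  let ?rhs = "\<lambda>S V B. \<Sum>z\<in>V - S. conn_prob E p S B {z} * (p * conn_prob E p (V - {z}) {z} A)"
  show ?case
  proof (cases "\<exists>u\<in>S \<inter> V. \<exists>b\<in>B. E b u")
    case True
    then obtain u b where u: "u \<in> S" "u \<in> V" "b \<in> B" "E b u" by auto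
    let ?S = "S - {u}" and ?L = "V - {u}"
    have fin: "finite ?S" "finite ?L" using psubset.hyps psubset.prems by auto
    have sub: "?S \<subset> S" and diff: "?L - ?S = V - S" using u by auto
    have ins: "insert u ?S = S" "insert u ?L = V" using u by auto
    \<comment> \<open>In the second factor the explored site \<open>u\<close> is put back, which can
      only increase it; both branches then share the same coefficients.\<close>
    have bound: "?rhs ?S ?L C \<le>
        (\<Sum>z\<in>V - S. conn_prob E p ?S C {z} * (p * conn_prob E p (V - {z}) {z} A))" for C
      unfolding diff using p psubset.prems fin
      by (intro sum_mono mult_left_mono conn_prob_mono_set conn_prob_nonneg) auto
    have 1: "conn_prob E p ?L (insert u B) A \<le> ?rhs ?S ?L (insert u B)"
      using psubset.prems u by (intro psubset.IH[OF sub]) auto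
    have 2: "conn_prob E p ?L B A \<le> ?rhs ?S ?L B"
      using psubset.prems u by (intro psubset.IH[OF sub]) auto
    have "conn_prob E p V B A
        = p * conn_prob E p ?L (insert u B) A + (1 - p) * conn_prob E p ?L B A"
      using conn_prob_explore_source[OF fin(2), of u b B E p A] u unfolding ins by simp
    also have "\<dots> \<le> p * (\<Sum>z\<in>V - S. conn_prob E p ?S (insert u B) {z} * (p * conn_prob E p (V - {z}) {z} A))
        + (1 - p) * (\<Sum>z\<in>V - S. conn_prob E p ?S B {z} * (p * conn_prob E p (V - {z}) {z} A))"
      using p order_trans[OF 1 bound] order_trans[OF 2 bound]
      by (intro add_mono mult_left_mono) auto
    also have "\<dots> = ?rhs S V B"
    proof -
      have "conn_prob E p S B {z}
          = p * conn_prob E p ?S (insert u B) {z} + (1 - p) * conn_prob E p ?S B {z}" for z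
        using conn_prob_explore_source[OF fin(1), of u b B E p "{z}"] u unfolding ins by simp
      then show ?thesis
        unfolding sum_distrib_left sum.distrib[symmetric]
        by (intro sum.cong refl) (simp only: distrib_right mult.assoc)
    qed
    finally show ?thesis .
  next
    \<comment> \<open>The exploration inside \<open>S\<close> is exhausted: the first site after
      \<open>B\<close> on any path lies outside \<open>S\<close> and next to \<open>B\<close>, so
      the first factor is 1 and a union bound is enough.\<close>
    case False
    have "conn_prob E p V B A
        \<le> bern_exp p V (\<lambda>T. \<Sum>z\<in>V - S. conn_prob E p S B {z} * of_bool (z \<in> T \<and> touches E T {z} A))"
      unfolding conn_prob_def[of E p V]
    proof (intro bern_exp_mono p)
      fix T assume T: "T \<subseteq> V"
      let ?c = "\<lambda>z. conn_prob E p S B {z} * of_bool (z \<in> T \<and> touches E T {z} A)"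
      have nonneg: "0 \<le> ?c z" for z
        using conn_prob_nonneg[OF p psubset.hyps] by simp
      show "of_bool (touches E T B A) \<le> (\<Sum>z\<in>V - S. ?c z)"
      proof (cases "touches E T B A")
        case True
        then obtain w a where w: "w \<in> cluster E T B" "a \<in> A" "E w a" by (auto simp: touches_def)
        then have "w \<notin> B" using psubset.prems by auto
        with cluster_first_step[OF w(1)] obtain z b where
          z: "z \<in> T" "b \<in> B" "E b z" "w \<in> cluster E T {z}" by auto
        then have zS: "z \<in> V - S" using False T by auto
        have "?c z = 1"
          using z w conn_prob_adjacent[OF psubset.hyps(1) z(2), of z "{z}" E p]
          by (auto simp: touches_def)
        moreover have "?c z \<le> (\<Sum>z\<in>V - S. ?c z)"
          using zS psubset.prems nonneg by (intro member_le_sum) auto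
        ultimately show ?thesis using True by simp
      qed (simp add: sum_nonneg nonneg)
    qed
    also have "\<dots> = ?rhs S V B"
      using psubset.prems
      by (simp only: bern_exp_sum bern_exp_cmult)
         (intro sum.cong refl arg_cong2[where f = "(*)"] conn_prob_open_source, auto)
    finally show ?thesis .
  qed
qed

lemma conn_prob_deriv:
  "finite V \<Longrightarrow> ((\<lambda>p. conn_prob E p V B A) has_real_derivative deriv (\<lambda>p. conn_prob E p V B A) p) (at p)"
  unfolding conn_prob_def DERIV_deriv_iff_real_differentiable by (rule bern_exp_differentiable)

section \<open>Sharpness of the phase transition\<close>

text \<open>Sites adjacent to \<open>A\<close> are revealed one at a time: an open site joins \<open>A\<close>, a closed one joins
  \<open>D\<close>. A site of \<open>D\<close> that is reached from \<open>x\<close> is pivotal, so the sum over \<open>D\<close> is the part of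
  Russo's formula that has already been explored.\<close>

lemma conn_prob_differential_inequality:
  assumes p: "0 \<le> p" "p \<le> 1" and "finite V\<^sub>0"
    and boundary: "\<And>S. S \<subseteq> V\<^sub>0 \<Longrightarrow> (\<forall>u\<in>insert x S. \<forall>a\<in>A\<^sub>0. \<not> E u a)
      \<Longrightarrow> 1 \<le> (\<Sum>z\<in>V\<^sub>0 - S. conn_prob E p S {x} {z})"
  assumes "finite V" "V \<union> D \<subseteq> V\<^sub>0" "V\<^sub>0 - V - D \<subseteq> A" "A\<^sub>0 \<subseteq> A" "V \<inter> D = {}"
  shows "1 - conn_prob E p V {x} A \<le> (1 - p) * deriv (\<lambda>p. conn_prob E p V {x} A) p
    + (\<Sum>d\<in>D. bern_exp p V (\<lambda>T. of_bool (touches E T {x} {d} \<and> \<not> touches E T {x} A)))"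
  using assms(5-)
proof (induction V arbitrary: D A rule: finite_psubset_induct)
  case (psubset V)
  let ?e = "\<lambda>V A d. bern_exp p V (\<lambda>T. of_bool (touches E T {x} {d} \<and> \<not> touches E T {x} A))"
  have finD: "finite D" using psubset.prems assms(3) finite_subset by blast
  show ?case
  proof (cases "\<exists>u\<in>V. \<exists>a\<in>A. E u a")
    case True
    then obtain u a where u: "u \<in> V" "a \<in> A" "E u a" by auto
    let ?L = "V - {u}"
    have L: "finite ?L" "?L \<subset> V" "insert u ?L = V" using psubset.hyps u by auto
    have uD: "u \<notin> D" using psubset.prems u by auto
    define fo where "fo = (\<lambda>p. conn_prob E p ?L {x} (insert u A))"
    define fc where "fc = (\<lambda>p. conn_prob E p ?L {x} A)"
    have split: "conn_prob E q V {x} A = q * fo q + (1 - q) * fc q" for q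
      using conn_prob_explore_target[of ?L u a A E q "{x}"] u L by (simp add: fo_def fc_def)
    have d: "(fo has_real_derivative deriv fo p) (at p)" "(fc has_real_derivative deriv fc p) (at p)"
      unfolding fo_def fc_def by (rule conn_prob_deriv[OF L(1)])+
    have "((\<lambda>q. q * fo q + (1 - q) * fc q) has_real_derivative
        fo p - fc p + p * deriv fo p + (1 - p) * deriv fc p) (at p)"
      using DERIV_add[OF DERIV_mult[OF DERIV_ident d(1)]
          DERIV_mult[OF DERIV_diff[OF DERIV_const DERIV_ident] d(2)], of 1]
      by (simp add: algebra_simps)
    then have deriv: "deriv (\<lambda>p. conn_prob E p V {x} A) p
        = fo p - fc p + p * deriv fo p + (1 - p) * deriv fc p"
      unfolding split by (rule DERIV_imp_deriv)
    have 1: "1 - fo p \<le> (1 - p) * deriv fo p + sum (?e ?L (insert u A)) D"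
      unfolding fo_def using psubset.prems u by (intro psubset.IH L) auto
    have "1 - fc p \<le> (1 - p) * deriv fc p + sum (?e ?L A) (insert u D)"
      unfolding fc_def using psubset.prems u by (intro psubset.IH L) auto
    also have "sum (?e ?L A) (insert u D) = ?e ?L A u + sum (?e ?L A) D"
      using finD uD by simp
    \<comment> \<open>The new term is the probability that \<open>u\<close> is pivotal:
      \<open>u\<close> is touched from \<open>x\<close> while \<open>A\<close> is not. The same
      difference arises from differentiating the weights \<open>p\<close> and \<open>1 - p\<close>
      of the two branches, so the two contributions combine.\<close>
    also have "?e ?L A u = fo p - fc p"
    proof -
      have "?e ?L A u + fc p = fo p"
        unfolding fo_def fc_def conn_prob_def bern_exp_add[symmetric]
        by (intro bern_exp_cong) (auto simp: touches_def)
      then show ?thesis by simp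
    qed
    finally have 2: "1 - fc p \<le> (1 - p) * deriv fc p + (fo p - fc p) + sum (?e ?L A) D"
      by simp
    have "p * sum (?e ?L (insert u A)) D + (1 - p) * sum (?e ?L A) D
        = (\<Sum>d\<in>D. p * ?e ?L (insert u A) d + (1 - p) * ?e ?L A d)"
      by (simp add: sum_distrib_left sum.distrib)
    also have "\<dots> \<le> sum (?e V A) D"
    proof (rule sum_mono)
      fix d
      \<comment> \<open>With \<open>u\<close> open, avoiding \<open>A\<close> means the same as
        avoiding \<open>insert u A\<close> before, while touching \<open>d\<close> only becomes
        easier.\<close>
      have "?e ?L (insert u A) d \<le> bern_exp p ?L (\<lambda>T. of_bool
          (touches E (insert u T) {x} {d} \<and> \<not> touches E (insert u T) {x} A))"
      proof (intro bern_exp_mono p)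
        fix T
        have "touches E T {x} {d} \<Longrightarrow> touches E (insert u T) {x} {d}"
          by (erule touches_mono[rotated 3]) auto
        then show "of_bool (touches E T {x} {d} \<and> \<not> touches E T {x} (insert u A)) \<le>
            (of_bool (touches E (insert u T) {x} {d} \<and> \<not> touches E (insert u T) {x} A) :: real)"
          using touches_insert_target[of a A E u T "{x}"] u by auto
      qed
      from mult_left_mono[OF this p(1)]
      have "p * ?e ?L (insert u A) d + (1 - p) * ?e ?L A d \<le> ?e (insert u ?L) A d"
        using L by (subst bern_exp_insert) auto
      then show "p * ?e ?L (insert u A) d + (1 - p) * ?e ?L A d \<le> ?e V A d"
        unfolding L .
    qed
    finally have 3: "p * sum (?e ?L (insert u A)) D + (1 - p) * sum (?e ?L A) D \<le> sum (?e V A) D" .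
    have "1 - conn_prob E p V {x} A = p * (1 - fo p) + (1 - p) * (1 - fc p)"
      unfolding split by (simp add: algebra_simps)
    also have "\<dots> \<le> p * ((1 - p) * deriv fo p + sum (?e ?L (insert u A)) D)
        + (1 - p) * ((1 - p) * deriv fc p + (fo p - fc p) + sum (?e ?L A) D)"
      using 1 2 p by (intro add_mono mult_left_mono) auto
    also have "\<dots> = (1 - p) * (fo p - fc p + p * deriv fo p + (1 - p) * deriv fc p)
        + (p * sum (?e ?L (insert u A)) D + (1 - p) * sum (?e ?L A) D)"
      by (simp add: algebra_simps)
    finally show ?thesis unfolding deriv using 3 by simp
  next
    case nonadj: False
    show ?thesis
    proof (cases "\<exists>a\<in>A. E x a")
      case True
      then have "conn_prob E q V {x} A = 1" for q
        using psubset.hyps conn_prob_adjacent[of V x "{x}"] by auto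
      then show ?thesis using p by (simp add: sum_nonneg bern_exp_nonneg)
    next
      case False
      then have zero: "conn_prob E q V {x} A' = 0" if "A' \<subseteq> A" for q A'
        using nonadj psubset.hyps that by (intro conn_prob_isolated) auto
      \<comment> \<open>The exploration from the target has stopped. The unrevealed sites
        \<open>V\<close> take the role of \<open>S\<close> in the hypothesis, and only the closed
        sites \<open>D\<close> around them contribute, since no site of \<open>A\<close> is adjacent
        to \<open>V\<close> or \<open>x\<close>.\<close>
      have "1 \<le> (\<Sum>z\<in>V\<^sub>0 - V. conn_prob E p V {x} {z})"
        using psubset.prems nonadj False by (intro boundary) auto
      also have "\<dots> = (\<Sum>z\<in>D. conn_prob E p V {x} {z})"
        using psubset.prems assms(3) zero by (intro sum.mono_neutral_right) auto
      also have "\<dots> = (\<Sum>d\<in>D. ?e V A d)"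
      proof (intro sum.cong refl)
        fix d assume "d \<in> D"
        have "\<not> touches E T {x} A" if "T \<subseteq> V" for T
          using cluster_subset[of E T "{x}"] nonadj False that by (fastforce simp: touches_def)
        then show "conn_prob E p V {x} {d} = ?e V A d"
          unfolding conn_prob_def by (intro bern_exp_cong) auto
      qed
      finally show ?thesis using zero[OF order_refl] by simp
    qed
  qed
qed

text \<open>With \<open>D\<close> empty the differential inequality says that
  \<open>(1 - f q) / (1 - q)\<close> is nonincreasing in \<open>q\<close>, where \<open>f\<close> is
  the connection probability. The hypothesis at \<open>p\<close> passes to larger parameters by
  monotonicity. The bound is independent of \<open>V\<close>, so it survives in infinite
  volume.\<close>

lemma conn_prob_supercritical:
  assumes p: "0 \<le> p" "p \<le> r" "r < 1" and "finite V"
    and boundary: "\<And>S. S \<subseteq> V \<Longrightarrow> (\<forall>u\<in>insert x S. \<forall>a\<in>A. \<not> E u a)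
      \<Longrightarrow> 1 \<le> (\<Sum>z\<in>V - S. conn_prob E p S {x} {z})"
  shows "(r - p) / (1 - p) \<le> conn_prob E r V {x} A"
proof -
  let ?f = "\<lambda>q. conn_prob E q V {x} A"
  let ?g = "\<lambda>q. (1 - ?f q) / (1 - q)"
  have "?g r \<le> ?g p"
  proof (rule DERIV_nonpos_imp_nonincreasing[OF p(2)])
    fix q assume q: "p \<le> q" "q \<le> r"
    have "(\<Sum>z\<in>V - S. conn_prob E p S {x} {z}) \<le> (\<Sum>z\<in>V - S. conn_prob E q S {x} {z})"
      if "S \<subseteq> V" for S
      using q p that assms(4) finite_subset by (intro sum_mono conn_prob_mono_param) auto
    then have "1 - ?f q \<le> (1 - q) * deriv ?f q
        + (\<Sum>d\<in>{}. bern_exp q V (\<lambda>T. of_bool (touches E T {x} {d} \<and> \<not> touches E T {x} A)))"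
      using q p assms(4) boundary
      by (intro conn_prob_differential_inequality[of q V x A]) (auto intro: order_trans)
    then have ineq: "1 - ?f q \<le> (1 - q) * deriv ?f q" by simp
    have "(?g has_real_derivative
        (- deriv ?f q * (1 - q) - (1 - ?f q) * (- 1)) / ((1 - q) * (1 - q))) (at q)"
    proof -
      have 1: "((\<lambda>q. 1 - ?f q) has_real_derivative 0 - deriv ?f q) (at q)"
        by (intro DERIV_diff DERIV_const conn_prob_deriv assms(4))
      have 2: "((\<lambda>q. 1 - q) has_real_derivative 0 - 1) (at q)"
        by (intro DERIV_diff DERIV_const DERIV_ident)
      show ?thesis using DERIV_divide[OF 1 2] q p by simp
    qed
    moreover have "(- deriv ?f q * (1 - q) - (1 - ?f q) * (- 1)) / ((1 - q) * (1 - q)) \<le> 0"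
      using ineq by (intro divide_nonpos_nonneg zero_le_square) (simp add: algebra_simps)
    ultimately show "\<exists>y. (?g has_real_derivative y) (at q) \<and> y \<le> 0" by blast
  qed
  also have "?g p \<le> 1 / (1 - p)"
    using p assms(4) conn_prob_nonneg[of p V] by (intro divide_right_mono) auto
  finally show ?thesis
    using p by (simp add: field_simps)
qed

text \<open>Unlike in \<open>conn_prob\<close>, the endpoint \<open>y\<close> itself has to be open
  unless it belongs to \<open>A\<close>. This is the quantity that bounds the spread of
  disagreements.\<close>

definition infl_prob :: "('a \<Rightarrow> 'a \<Rightarrow> bool) \<Rightarrow> real \<Rightarrow> 'a set \<Rightarrow> 'a set \<Rightarrow> 'a \<Rightarrow> real" where
  "infl_prob E p V A y = bern_exp p V (\<lambda>T. of_bool (y \<in> cluster E T A))"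

lemma cluster_image:
  assumes "inj h" "\<And>u v. E (h u) (h v) \<longleftrightarrow> E u v"
  shows "cluster E (h ` T) (h ` B) = h ` cluster E T B"
proof
  show "cluster E (h ` T) (h ` B) \<subseteq> h ` cluster E T B"
  proof
    fix v assume "v \<in> cluster E (h ` T) (h ` B)" then show "v \<in> h ` cluster E T B"
      by (induction rule: cluster.induct) (use assms in \<open>auto intro: cluster.intros\<close>)
  qed
  show "h ` cluster E T B \<subseteq> cluster E (h ` T) (h ` B)"
  proof
    fix v assume "v \<in> h ` cluster E T B"
    then obtain w where "w \<in> cluster E T B" "v = h w" by auto
    from this(1) have "h w \<in> cluster E (h ` T) (h ` B)"
      by (induction rule: cluster.induct) (use assms in \<open>auto intro: cluster.intros\<close>)
    with \<open>v = h w\<close> show "v \<in> cluster E (h ` T) (h ` B)" by simp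
  qed
qed

lemma conn_prob_image:
  assumes "inj h" "\<And>u v. E (h u) (h v) \<longleftrightarrow> E u v"
  shows "conn_prob E p (h ` V) (h ` B) (h ` A) = conn_prob E p V B A"
  using assms
  by (simp add: conn_prob_def bern_exp_image inj_on_subset touches_def cluster_image)

text \<open>A path using sites of \<open>A\<close> would have to touch \<open>A\<close> first. With
  \<open>A\<close> the complement of a ball, this confines a cluster to the ball.\<close>

lemma cluster_confined:
  assumes "T' \<subseteq> T \<union> A" "\<not> touches E T B A"
  shows "cluster E T' B \<subseteq> cluster E T B"
proof
  fix v assume "v \<in> cluster E T' B" then show "v \<in> cluster E T B"
    by (induction rule: cluster.induct) (use assms in \<open>auto simp: touches_def intro: cluster.intros\<close>)
qed

text \<open>The path is reversed so that \<open>y\<close> becomes the source; the factor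
  \<open>p\<close> is the cost of \<open>y\<close> being open.\<close>

lemma infl_prob_le:
  assumes "\<And>u v. E u v \<Longrightarrow> E v u" "0 \<le> p" "p \<le> 1" "finite V" "y \<notin> A"
  shows "infl_prob E p V A y \<le> p * conn_prob E p (V - {y}) {y} A"
proof (cases "y \<in> V")
  case True
  have "infl_prob E p V A y \<le> bern_exp p V (\<lambda>T. of_bool (y \<in> T \<and> touches E T {y} A))"
    unfolding infl_prob_def using assms cluster_reverse[of E y _ A]
    by (intro bern_exp_mono) auto
  then show ?thesis using assms True by (simp add: conn_prob_open_source)
next
  case False
  then have "infl_prob E p V A y = bern_exp p V (\<lambda>_. 0)"
    unfolding infl_prob_def using assms
    by (intro bern_exp_cong) (auto dest!: subsetD[OF cluster_subset])
  then show ?thesis using assms conn_prob_nonneg[of p "V - {y}"] by simp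
qed

section \<open>Lattice geometry and percolation on the whole lattice\<close>

abbreviation sdist :: "'d::finite site \<Rightarrow> 'd site \<Rightarrow> real" where
  "sdist u v \<equiv> dist (to_real u) (to_real v)"

definition adj :: "'d::finite site \<Rightarrow> 'd site \<Rightarrow> bool" where
  "adj u v \<longleftrightarrow> sdist u v = 1"

definition lattice_ball :: "'d::finite site \<Rightarrow> real \<Rightarrow> 'd site set" where
  "lattice_ball x r = {y. sdist x y \<le> r}"

lemma adj_sym: "adj u v \<Longrightarrow> adj v u"
  by (simp add: adj_def dist_commute)

lemma to_real_add: "to_real (x + y) = to_real x + to_real y"
  by (simp add: to_real_def vec_eq_iff)

lemma to_real_diff: "to_real (x - y) = to_real x - to_real y"
  by (simp add: to_real_def vec_eq_iff)

lemma to_real_inject [simp]: "to_real x = to_real y \<longleftrightarrow> x = y"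
  by (simp add: to_real_def vec_eq_iff)

lemma sdist_translate [simp]: "sdist (w + x) (w + y) = sdist x y"
  by (simp add: to_real_add)

lemma sdist_component_le: "\<bar>x $ i - y $ i\<bar> \<le> sdist x y"
proof -
  have "real_of_int \<bar>x $ i - y $ i\<bar> = \<bar>(to_real x - to_real y) $ i\<bar>"
    by (simp add: to_real_def)
  also have "\<dots> \<le> norm (to_real x - to_real y)" by (rule component_le_norm_cart)
  finally show ?thesis by (simp add: dist_norm)
qed

lemma finite_lattice_ball: "finite (lattice_ball x r)"
proof -
  let ?n = "\<lceil>r\<rceil>"
  let ?F = "\<Pi>\<^sub>E i\<in>UNIV. {x $ i - ?n..x $ i + ?n}"
  have "lattice_ball x r \<subseteq> vec_lambda ` ?F"
  proof
    fix y assume y: "y \<in> lattice_ball x r"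
    have bound: "\<bar>x $ i - y $ i\<bar> \<le> ?n" for i
      using sdist_component_le[of x i y] y by (simp add: lattice_ball_def) linarith
    have "x $ i - ?n \<le> y $ i \<and> y $ i \<le> x $ i + ?n" for i
      using bound[of i] by linarith
    then have "vec_nth y \<in> ?F" by auto
    then show "y \<in> vec_lambda ` ?F"
      by (intro image_eqI[of _ _ "vec_nth y"]) (simp add: vec_nth_inverse)
  qed
  moreover have "finite (vec_lambda ` ?F)"
    by (intro finite_imageI finite_PiE) auto
  ultimately show ?thesis
    by (rule finite_subset)
qed

lemma prob_space_percolation: "prob_space (percolation p)"
  unfolding percolation_def by (intro prob_space_PiM measure_pmf.prob_space_axioms)

lemma percolation_cylinder:
  assumes "0 \<le> p" "p \<le> 1" "finite V" "T \<subseteq> V"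
  shows "{\<omega>. {y\<in>V. \<omega> y} = T} \<in> sets (percolation p)"
    and "measure (percolation p) {\<omega>. {y\<in>V. \<omega> y} = T} = p ^ card T * (1 - p) ^ card (V - T)"
proof -
  let ?M = "\<lambda>_. measure_pmf (bernoulli_pmf p)"
  let ?X = "\<lambda>y. {y \<in> T}"
  interpret product_prob_space ?M UNIV
    by unfold_locales
  have eq: "{\<omega>. {y\<in>V. \<omega> y} = T} = prod_emb UNIV ?M V (Pi\<^sub>E V ?X)"
    using assms(4) by (auto simp: prod_emb_def PiE_iff)
  show "{\<omega>. {y\<in>V. \<omega> y} = T} \<in> sets (percolation p)"
    unfolding eq percolation_def by (intro sets_PiM_I assms) auto
  have "measure (percolation p) {\<omega>. {y\<in>V. \<omega> y} = T} = (\<Prod>y\<in>V. measure (?M y) (?X y))"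
    unfolding eq percolation_def using assms by (intro measure_PiM_emb) auto
  also have "\<dots> = (\<Prod>y\<in>V. if y \<in> T then p else 1 - p)"
    using assms by (intro prod.cong refl) (auto simp: measure_pmf_single)
  also have "\<dots> = p ^ card T * (1 - p) ^ card (V - T)"
    using assms by (simp add: prod.If_cases Int_absorb1 Diff_eq[symmetric] Collect_neg_eq)
  finally show "measure (percolation p) {\<omega>. {y\<in>V. \<omega> y} = T} = p ^ card T * (1 - p) ^ card (V - T)" .
qed

text \<open>Links the product measure to finite sums: an event determined by the sites of
  \<open>V\<close> is a finite disjoint union of cylinders.\<close>

lemma percolation_finite_event:
  assumes "0 \<le> p" "p \<le> 1" "finite V"
  shows "{\<omega>. G {y\<in>V. \<omega> y}} \<in> sets (percolation p)"
    and "measure (percolation p) {\<omega>. G {y\<in>V. \<omega> y}} = bern_exp p V (\<lambda>T. of_bool (G T))"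
proof -
  interpret prob_space "percolation p" by (rule prob_space_percolation)
  let ?C = "\<lambda>T. {\<omega>. {y\<in>V. \<omega> y} = T}"
  have eq: "{\<omega>. G {y\<in>V. \<omega> y}} = (\<Union>T\<in>{T \<in> Pow V. G T}. ?C T)" by auto
  have sets: "?C ` {T \<in> Pow V. G T} \<subseteq> sets (percolation p)"
    using percolation_cylinder(1)[OF assms] by auto
  show "{\<omega>. G {y\<in>V. \<omega> y}} \<in> sets (percolation p)"
    unfolding eq using sets assms by (intro sets.finite_UN) auto
  have "measure (percolation p) {\<omega>. G {y\<in>V. \<omega> y}} = (\<Sum>T\<in>{T \<in> Pow V. G T}. prob (?C T))"
    unfolding eq using sets assms
    by (intro finite_measure_finite_Union) (auto simp: disjoint_family_on_def)
  also have "\<dots> = (\<Sum>T\<in>{T \<in> Pow V. G T}. p ^ card T * (1 - p) ^ card (V - T))"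
    using assms by (intro sum.cong refl percolation_cylinder(2)) auto
  also have "\<dots> = bern_exp p V (\<lambda>T. of_bool (G T))"
    unfolding bern_exp_def using assms by (intro sum.mono_neutral_cong_left) auto
  finally show "measure (percolation p) {\<omega>. G {y\<in>V. \<omega> y}} = bern_exp p V (\<lambda>T. of_bool (G T))" .
qed

lemma open_cluster_eq: "open_cluster \<omega> x = (if \<omega> x then cluster adj (Collect \<omega>) {x} else {})"
proof -
  let ?r = "\<lambda>u v. sdist u v = 1 \<and> \<omega> u \<and> \<omega> v"
  have 1: "\<omega> x \<Longrightarrow> v \<in> cluster adj (Collect \<omega>) {x}" if "?r\<^sup>*\<^sup>* x v" for v
    using that by (induction rule: rtranclp_induct) (auto simp: adj_def intro: cluster.intros)
  have 2: "\<omega> x \<Longrightarrow> ?r\<^sup>*\<^sup>* x v \<and> \<omega> v" if "v \<in> cluster adj (Collect \<omega>) {x}" for v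
    using that
  proof (induction rule: cluster.induct)
    case (step u v)
    then have "?r u v" by (simp add: adj_def)
    with step show ?case by (metis (mono_tags, lifting) rtranclp.rtrancl_into_rtrancl)
  qed auto
  show ?thesis
  proof (cases "\<omega> x")
    case True
    then have "{y. ?r\<^sup>*\<^sup>* x y} = cluster adj (Collect \<omega>) {x}" using 1 2 by blast
    with True show ?thesis by (simp add: open_cluster_def)
  qed (simp add: open_cluster_def)
qed

text \<open>Expresses percolation as a countable intersection of events determined by balls. A
  cluster that does not touch the complement of a ball is confined to it; conversely a finite
  cluster cannot touch the complement of a ball whose radius exceeds its extent by at least
  1.\<close>

lemma infinite_open_cluster_iff:
  "infinite (open_cluster \<omega> 0) \<longleftrightarrow>
    (\<forall>n::nat. \<omega> 0 \<and> touches adj {y\<in>lattice_ball 0 n. \<omega> y} {0} (- lattice_ball 0 n))"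
proof
  assume inf: "infinite (open_cluster \<omega> 0)"
  then have "\<omega> 0" by (auto simp: open_cluster_eq split: if_splits)
  moreover have "touches adj {y\<in>lattice_ball 0 n. \<omega> y} {0} (- lattice_ball 0 n)" for n :: nat
  proof (rule ccontr)
    let ?T = "{y\<in>lattice_ball 0 n. \<omega> y}"
    assume "\<not> touches adj ?T {0} (- lattice_ball 0 n)"
    then have "cluster adj (Collect \<omega>) {0} \<subseteq> cluster adj ?T {0}"
      by (rule cluster_confined[rotated]) auto
    also have "\<dots> \<subseteq> {0} \<union> ?T" by (rule cluster_subset)
    finally have "finite (cluster adj (Collect \<omega>) {0})"
      by (rule finite_subset) (simp add: finite_lattice_ball)
    with inf show False by (simp add: open_cluster_eq split: if_splits)
  qed
  ultimately show "\<forall>n::nat. \<omega> 0 \<and> touches adj {y\<in>lattice_ball 0 n. \<omega> y} {0} (- lattice_ball 0 n)"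
    by simp
next
  assume *: "\<forall>n::nat. \<omega> 0 \<and> touches adj {y\<in>lattice_ball 0 n. \<omega> y} {0} (- lattice_ball 0 n)"
  show "infinite (open_cluster \<omega> 0)"
  proof
    assume "finite (open_cluster \<omega> 0)"
    then have "finite (sdist 0 ` open_cluster \<omega> 0)" by simp
    then obtain m :: real where m: "\<And>v. v \<in> open_cluster \<omega> 0 \<Longrightarrow> sdist 0 v \<le> m"
      by (meson Max_ge imageI)
    obtain n :: nat where n: "m + 1 \<le> n" using real_arch_simple by blast
    from * have "touches adj {y\<in>lattice_ball 0 n. \<omega> y} {0} (- lattice_ball 0 n)" by blast
    then obtain u a where u: "u \<in> cluster adj {y\<in>lattice_ball 0 n. \<omega> y} {0}"
      and a: "a \<notin> lattice_ball 0 n" "adj u a" by (auto simp: touches_def)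
    have "u \<in> cluster adj (Collect \<omega>) {0}"
      using u cluster_mono[of "{y\<in>lattice_ball 0 n. \<omega> y}" "Collect \<omega>" "{0}" "{0}" adj] by auto
    then have "sdist 0 u \<le> m" using m * by (simp add: open_cluster_eq)
    moreover have "sdist 0 a \<le> sdist 0 u + 1"
      using a dist_triangle[of "to_real 0" "to_real a" "to_real u"] by (simp add: adj_def)
    ultimately show False using a n by (simp add: lattice_ball_def)
  qed
qed

text \<open>Makes the set in \<open>critical_threshold\<close> nonempty, so that its
  \<open>Sup\<close> is a genuine supremum.\<close>

lemma no_percolation_at_0:
  "measure (percolation 0) {\<omega> :: 'd::finite config. infinite (open_cluster \<omega> 0)} = 0"
proof -
  let ?A = "{\<omega> :: 'd config. infinite (open_cluster \<omega> 0)}"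
  interpret prob_space "percolation 0 :: 'd config measure" by (rule prob_space_percolation)
  have "prob {\<omega>. 0 \<in> {y\<in>{0 :: 'd site}. \<omega> y}} = 0"
    by (subst percolation_finite_event) (simp_all add: bern_exp_insert)
  moreover have "prob ?A \<le> prob {\<omega>. 0 \<in> {y\<in>{0 :: 'd site}. \<omega> y}}"
    by (intro finite_measure_mono percolation_finite_event)
       (auto simp: open_cluster_eq split: if_splits)
  ultimately show ?thesis by (simp add: measure_le_0_iff)
qed

lemma critical_threshold_le_1: "critical_threshold TYPE('d::finite) \<le> 1"
  unfolding critical_threshold_def using no_percolation_at_0[where 'd = 'd]
  by (intro cSup_least) force+

text \<open>Without such a set every ball satisfies the hypothesis of
  \<open>conn_prob_supercritical\<close> at \<open>p\<close>. The probability of leaving a ball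
  would then be bounded below, uniformly in the radius, at some \<open>p' > p\<close> where
  percolation has probability 0.\<close>

lemma exists_contracting_set:
  assumes "0 \<le> p" "p < critical_threshold TYPE('d::finite)"
  shows "\<exists>(S :: 'd site set) R. 0 \<le> R \<and> S \<subseteq> lattice_ball 0 R - {0} \<and>
    (\<forall>u\<in>insert 0 S. \<forall>a. adj u a \<longrightarrow> a \<in> lattice_ball 0 R) \<and>
    (\<Sum>z\<in>lattice_ball 0 R - {0} - S. conn_prob adj p S {0} {z}) < 1"
proof (rule ccontr)
  assume neg: "\<not> ?thesis"
  define Inf where "Inf = {\<omega> :: 'd config. infinite (open_cluster \<omega> 0)}"
  let ?A = "{p \<in> {0..1}. measure (percolation p) Inf = 0}"
  have "?A \<noteq> {}" using no_percolation_at_0[where 'd = 'd] by (force simp: Inf_def)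
  then obtain p' where p': "p < p'" "p' \<le> 1" "measure (percolation p') Inf = 0"
    using assms(2) less_cSupE[of p ?A] by (auto simp: critical_threshold_def Inf_def)
  \<comment> \<open>The lower bound is available only for parameters below 1, and \<open>p'\<close>
    may be 1. The midpoint stays above \<open>p\<close>, which keeps the bound positive, and
    monotonicity carries it on to \<open>p'\<close>.\<close>
  define r where "r = (p + p') / 2"
  have r: "p < r" "r < p'" "r < 1" using p' by (auto simp: r_def)
  define G where "G = (\<lambda>n::nat. \<lambda>T :: 'd site set. 0 \<in> T \<and> touches adj T {0} (- lattice_ball 0 n))"
  define F where "F = (\<lambda>n::nat. {\<omega> :: 'd config. G n {y\<in>lattice_ball 0 n. \<omega> y}})"
  have in_ball: "0 \<in> lattice_ball (0 :: 'd site) (real n)" for n by (simp add: lattice_ball_def)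
  interpret prob_space "percolation p' :: 'd config measure" by (rule prob_space_percolation)
  have "p' * ((r - p) / (1 - p)) \<le> prob (F n)" for n
  proof -
    let ?L = "lattice_ball (0 :: 'd site) (real n) - {0}" and ?A = "- lattice_ball (0 :: 'd site) (real n)"
    have "(r - p) / (1 - p) \<le> conn_prob adj r ?L {0} ?A"
    proof (rule conn_prob_supercritical)
      fix S assume S: "S \<subseteq> ?L" "\<forall>u\<in>insert 0 S. \<forall>a\<in>?A. \<not> adj u a"
      show "1 \<le> (\<Sum>z\<in>?L - S. conn_prob adj p S {0} {z})"
      proof (rule ccontr)
        assume "\<not> 1 \<le> (\<Sum>z\<in>?L - S. conn_prob adj p S {0} {z})"
        moreover have "\<forall>u\<in>insert 0 S. \<forall>a. adj u a \<longrightarrow> a \<in> lattice_ball 0 (real n)"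
          using S(2) by blast
        ultimately show False
          using neg S(1) of_nat_0_le_iff[of n] unfolding not_le by blast
      qed
    qed (use assms r finite_lattice_ball in auto)
    also have "\<dots> \<le> conn_prob adj p' ?L {0} ?A"
      using assms p' r finite_lattice_ball by (intro conn_prob_mono_param) auto
    finally have "p' * ((r - p) / (1 - p)) \<le> p' * conn_prob adj p' ?L {0} ?A"
      using assms p' by (intro mult_left_mono) auto
    also have "\<dots> = bern_exp p' (lattice_ball 0 (real n)) (\<lambda>T. of_bool (G n T))"
      unfolding G_def using in_ball finite_lattice_ball by (subst conn_prob_open_source) auto
    also have "\<dots> = prob (F n)"
      unfolding F_def using assms p' finite_lattice_ball
      by (subst percolation_finite_event) auto
    finally show ?thesis .
  qed
  moreover have "(\<lambda>n. prob (F n)) \<longlonglongrightarrow> prob (\<Inter>n. F n)"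
  proof (rule finite_Lim_measure_decseq)
    show "range F \<subseteq> events"
      unfolding F_def using assms p'
      by (intro image_subsetI percolation_finite_event(1) finite_lattice_ball) auto
    show "decseq F"
    proof (rule decseq_SucI, rule subsetI)
      fix n \<omega> assume \<omega>: "\<omega> \<in> F (Suc n)"
      let ?B = "lattice_ball (0 :: 'd site) (real n)" and ?B' = "lattice_ball (0 :: 'd site) (real (Suc n))"
      let ?T = "{y\<in>?B. \<omega> y}" and ?T' = "{y\<in>?B'. \<omega> y}"
      have sub: "- ?B' \<subseteq> - ?B" by (auto simp: lattice_ball_def)
      \<comment> \<open>A path that leaves the larger ball has to touch the complement of the
        smaller one beforehand.\<close>
      have "touches adj ?T {0} (- ?B)"
      proof (rule ccontr)
        assume not: "\<not> touches adj ?T {0} (- ?B)"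
        then have "cluster adj ?T' {0} \<subseteq> cluster adj ?T {0}"
          by (rule cluster_confined[rotated]) auto
        then show False using not sub \<omega> unfolding F_def G_def touches_def by blast
      qed
      then show "\<omega> \<in> F n" using \<omega> in_ball by (auto simp: F_def G_def)
    qed
  qed
  moreover have "(\<Inter>n. F n) = Inf"
    unfolding F_def G_def Inf_def infinite_open_cluster_iff using in_ball by auto
  ultimately have "p' * ((r - p) / (1 - p)) \<le> 0"
    using p' by (auto intro: LIMSEQ_le_const)
  moreover have "0 < p' * ((r - p) / (1 - p))"
    using assms p' r by (intro mult_pos_pos divide_pos_pos) auto
  ultimately show False by simp
qed

text \<open>Each use of \<open>conn_prob_decouple\<close> with \<open>S\<close> translated to
  \<open>y\<close> gains a factor \<phi> and restarts at a site within distance \<open>R\<close> of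
  \<open>y\<close>.\<close>

lemma conn_prob_exponential_decay:
  assumes p: "0 \<le> p" "p < critical_threshold TYPE('d::finite)" "p \<le> 1"
  shows "\<exists>\<phi> L. 0 \<le> \<phi> \<and> \<phi> < 1 \<and> 0 < L \<and>
    (\<forall>(V :: 'd site set) A y k. finite V \<longrightarrow> (\<forall>a\<in>A. real k * L < sdist y a) \<longrightarrow>
      conn_prob adj p (V - {y}) {y} A \<le> \<phi> ^ k)"
proof -
  from exists_contracting_set[OF p(1,2)] obtain S :: "'d site set" and R where
    R: "0 \<le> R" and S: "S \<subseteq> lattice_ball 0 R - {0}"
    and nbrs: "\<And>u a. u \<in> insert 0 S \<Longrightarrow> adj u a \<Longrightarrow> a \<in> lattice_ball 0 R"
    and less: "(\<Sum>z\<in>lattice_ball 0 R - {0} - S. conn_prob adj p S {0} {z}) < 1"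
    by blast
  let ?Z = "lattice_ball 0 R - {0} - S"
  define \<phi> where "\<phi> = (\<Sum>z\<in>?Z. conn_prob adj p S {0} {z})"
  \<comment> \<open>One restart moves by at most \<open>R\<close>; the extra 1 keeps
    \<open>L\<close> positive even when \<open>R\<close> is 0.\<close>
  define L where "L = R + 1"
  have finS: "finite S" using S finite_lattice_ball finite_subset by blast
  have \<phi>: "0 \<le> \<phi>" "\<phi> < 1"
    using less p finS by (auto simp: \<phi>_def intro!: sum_nonneg conn_prob_nonneg)
  have "conn_prob adj p (V - {y}) {y} A \<le> \<phi> ^ k"
    if "finite V" "\<forall>a\<in>A. real k * L < sdist y a" for V A :: "'d site set" and y k
    using that
  proof (induction k arbitrary: V y)
    case 0
    then show ?case using p by (simp add: conn_prob_le_1)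
  next
    case (Suc k)
    let ?S = "(+) y ` S" and ?V = "V - {y}"
    have inj: "inj ((+) y)" by simp
    have shift: "conn_prob adj p ?S {y} {y + z} = conn_prob adj p S {0} {z}" for z
      using conn_prob_image[of "(+) y" adj p S "{0}" "{z}"] by (simp add: adj_def)
    have shift_adj: "adj (y + u) v \<Longrightarrow> adj u (v - y)" for u v
      using sdist_translate[of y u "v - y"] by (simp add: adj_def)
    have far: "L < sdist y a" if "a \<in> A" for a
    proof -
      have "L \<le> real (Suc k) * L" using R by (simp add: L_def algebra_simps)
      then show ?thesis using Suc.prems that by fastforce
    qed
    have decouple: "conn_prob adj p ?V {y} A
        \<le> (\<Sum>z\<in>?V - ?S. conn_prob adj p ?S {y} {z} * (p * conn_prob adj p (?V - {z}) {z} A))"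
    proof (rule conn_prob_decouple)
      fix u a assume u: "u \<in> ?S \<union> {y}" and a: "a \<in> A"
      from u obtain w where w: "w \<in> insert 0 S" "u = y + w" by force
      show "\<not> adj u a"
      proof
        assume "adj u a"
        then have "a - y \<in> lattice_ball 0 R" using shift_adj nbrs w by blast
        then have "sdist y a \<le> R"
          using sdist_translate[of y 0 "a - y"] by (simp add: lattice_ball_def)
        with far[OF a] show False by (simp add: L_def)
      qed
    qed (use p Suc.prems finS in auto)
    \<comment> \<open>A nonzero first factor forces \<open>z\<close> to be a neighbour of
      \<open>y\<close> or of the translated \<open>S\<close>, hence to lie in the translated ball,
      whatever the window \<open>V\<close> is.\<close>
    have near: "z - y \<in> lattice_ball 0 R"
      if z: "z \<in> ?V - ?S" "conn_prob adj p ?S {y} {z} \<noteq> 0" for z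
    proof -
      obtain u where u: "u \<in> insert y ?S" "adj u z"
        using z conn_prob_isolated[of ?S "{y}" "{z}" adj p] finS by auto
      from u(1) obtain w where w: "w \<in> insert 0 S" "u = y + w" by force
      then show ?thesis using u shift_adj nbrs by blast
    qed
    note decouple
    also have "(\<Sum>z\<in>?V - ?S. conn_prob adj p ?S {y} {z} * (p * conn_prob adj p (?V - {z}) {z} A))
        \<le> (\<Sum>z\<in>?V - ?S. conn_prob adj p ?S {y} {z} * \<phi> ^ k)"
    proof (rule sum_mono)
      fix z assume z: "z \<in> ?V - ?S"
      show "conn_prob adj p ?S {y} {z} * (p * conn_prob adj p (?V - {z}) {z} A)
          \<le> conn_prob adj p ?S {y} {z} * \<phi> ^ k"
      proof (cases "conn_prob adj p ?S {y} {z} = 0")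
        case False
        have near: "sdist y z \<le> R" using near[OF z False]
          using sdist_translate[of y 0 "z - y"] by (simp add: lattice_ball_def)
        have "real k * L < sdist z a" if "a \<in> A" for a
        proof -
          have "real (Suc k) * L < sdist y a" using Suc.prems that by auto
          also have "\<dots> \<le> R + sdist z a"
            using near dist_triangle[of "to_real y" "to_real a" "to_real z"] by linarith
          finally show ?thesis by (simp add: L_def algebra_simps)
        qed
        then have "conn_prob adj p (?V - {z}) {z} A \<le> \<phi> ^ k"
          using Suc.prems by (intro Suc.IH) auto
        moreover have "0 \<le> conn_prob adj p (?V - {z}) {z} A"
          using p Suc.prems by (intro conn_prob_nonneg) auto
        ultimately have "p * conn_prob adj p (?V - {z}) {z} A \<le> \<phi> ^ k"
          using p mult_left_le_one_le[of "conn_prob adj p (?V - {z}) {z} A" p] by linarith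
        then show ?thesis using p finS by (intro mult_left_mono conn_prob_nonneg) auto
      qed simp
    qed
    also have "\<dots> = (\<Sum>z\<in>?V - ?S. conn_prob adj p ?S {y} {z}) * \<phi> ^ k"
      by (simp add: sum_distrib_right)
    also have "(\<Sum>z\<in>?V - ?S. conn_prob adj p ?S {y} {z}) \<le> (\<Sum>z\<in>(+) y ` ?Z. conn_prob adj p ?S {y} {z})"
    proof -
      have "z \<in> (+) y ` ?Z" if "z \<in> ?V - ?S" "conn_prob adj p ?S {y} {z} \<noteq> 0" for z
        using near[OF that] that image_eqI[of z "(+) y" "z - y" S]
        by (intro image_eqI[of _ _ "z - y"]) auto
      then have "(\<Sum>z\<in>?V - ?S. conn_prob adj p ?S {y} {z})
          = (\<Sum>z\<in>(?V - ?S) \<inter> (+) y ` ?Z. conn_prob adj p ?S {y} {z})"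
        using Suc.prems by (intro sum.mono_neutral_right) auto
      also have "\<dots> \<le> (\<Sum>z\<in>(+) y ` ?Z. conn_prob adj p ?S {y} {z})"
        using p finS
        by (intro sum_mono2 conn_prob_nonneg finite_imageI finite_Diff finite_lattice_ball) auto
      finally show ?thesis .
    qed
    also have "\<dots> = \<phi>"
      unfolding \<phi>_def by (subst sum.reindex) (auto simp: shift)
    finally show ?case using \<phi> by (simp add: mult_right_mono)
  qed
  then show ?thesis using \<phi> R by (intro exI[of _ \<phi>] exI[of _ L]) (auto simp: L_def)
qed

section \<open>Gibbs measures on cylinders\<close>

definition cylinder :: "'d::finite site set \<Rightarrow> 'd config \<Rightarrow> 'd config set" where
  "cylinder X \<tau> = {\<omega>. \<forall>y\<in>X. \<omega> y = \<tau> y}"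

lemma space_spin_space [simp]: "space spin_space = UNIV"
  unfolding spin_space_def space_PiM space_count_space PiE_UNIV_domain by simp

lemma cylinder_split:
  assumes "y \<notin> X"
  shows "cylinder X \<tau> = cylinder (insert y X) (\<tau>(y := True)) \<union> cylinder (insert y X) (\<tau>(y := False))"
    and "cylinder (insert y X) (\<tau>(y := True)) \<inter> cylinder (insert y X) (\<tau>(y := False)) = {}"
  using assms by (auto simp: cylinder_def)

lemma cylinder_eq_prod_emb:
  "finite X \<Longrightarrow> cylinder X \<tau> = prod_emb UNIV (\<lambda>_. count_space UNIV) X (Pi\<^sub>E X (\<lambda>y. {\<tau> y}))"
  unfolding cylinder_def prod_emb_def
  by (intro set_eqI) (simp add: PiE_iff restrict_def extensional_def)

lemma cylinder_in_spin_space: "finite X \<Longrightarrow> cylinder X \<tau> \<in> sets spin_space"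
  unfolding cylinder_eq_prod_emb spin_space_def by (intro sets_PiM_I) auto

lemma cylinder_in_outside:
  assumes "finite X" "X \<inter> V = {}"
  shows "cylinder X \<tau> \<in> sets (outside V)"
proof -
  let ?A = "prod_emb (- V) (\<lambda>_. count_space UNIV) X (Pi\<^sub>E X (\<lambda>y. {\<tau> y}))"
  have "cylinder X \<tau> = (\<lambda>\<omega>. restrict \<omega> (- V)) -` ?A \<inter> UNIV"
    using assms(2) by (auto simp: cylinder_def prod_emb_def PiE_iff restrict_def)
  also have "\<dots> \<in> sets (outside V)"
    unfolding outside_def using assms by (intro in_vimage_algebra sets_PiM_I) auto
  finally show ?thesis .
qed

locale random_field = prob_space P for P :: "'d::finite config measure" +
  assumes sets_P: "sets P = sets spin_space"
begin

abbreviation w :: "'d site set \<Rightarrow> 'd config \<Rightarrow> real" where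
  "w X \<tau> \<equiv> prob (cylinder X \<tau>)"

lemma space_P [simp]: "space P = UNIV"
  using sets_eq_imp_space_eq[OF sets_P] by simp

lemma cylinder_sets: "finite X \<Longrightarrow> cylinder X \<tau> \<in> events"
  by (simp add: sets_P cylinder_in_spin_space)

lemma w_empty [simp]: "w {} \<tau> = 1"
  using prob_space by (simp add: cylinder_def)

lemma w_cong: "(\<And>y. y \<in> X \<Longrightarrow> \<tau> y = \<tau>' y) \<Longrightarrow> w X \<tau> = w X \<tau>'"
  by (rule arg_cong[where f = prob]) (auto simp: cylinder_def)

lemma w_split:
  assumes "finite X" "y \<notin> X"
  shows "w X \<tau> = w (insert y X) (\<tau>(y := True)) + w (insert y X) (\<tau>(y := False))"
  using assms(1) cylinder_split[OF assms(2), of \<tau>]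
  by (simp add: finite_measure_Union cylinder_sets)

end

lemma sdist_ge_1: "u \<noteq> v \<Longrightarrow> 1 \<le> sdist u v"
proof -
  assume "u \<noteq> v"
  then obtain i where "u $ i \<noteq> v $ i" by (auto simp: vec_eq_iff)
  then have "1 \<le> real_of_int \<bar>u $ i - v $ i\<bar>" by linarith
  then show ?thesis using sdist_component_le[of u i v] by linarith
qed

text \<open>Distinct lattice points are at distance at least 1, so a set of diameter at most 1 that
  contains \<open>u\<close> consists of \<open>u\<close> and neighbours of \<open>u\<close>.\<close>

lemma nearest_neighborD:
  assumes "nearest_neighbor U" "finite A" "u \<in> A"
    and "\<And>x. x \<in> A \<Longrightarrow> x = u \<or> adj u x \<Longrightarrow> \<sigma> x = \<sigma>' x"
  shows "U A \<sigma> = U A \<sigma>'"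
proof (cases "diameter (to_real ` A) > 1")
  case True
  then show ?thesis using assms unfolding nearest_neighbor_def by auto
next
  case False
  have "\<sigma> x = \<sigma>' x" if "x \<in> A" for x
  proof (cases "x = u")
    case False
    have "sdist u x \<le> diameter (to_real ` A)"
      using assms that by (intro diameter_bounded_bound finite_imp_bounded) auto
    then have "adj u x"
      using False sdist_ge_1[of u x] \<open>\<not> diameter (to_real ` A) > 1\<close> by (auto simp: adj_def)
    then show ?thesis using assms that by blast
  qed (use assms that in blast)
  then show ?thesis using assms unfolding nearest_neighbor_def by blast
qed

lemma hamiltonian_cong:
  assumes "nearest_neighbor U"
    and "\<And>x. x \<in> V \<Longrightarrow> \<sigma> x = \<sigma>' x"
    and "\<And>u x. u \<in> V \<Longrightarrow> x \<notin> V \<Longrightarrow> adj u x \<Longrightarrow> \<eta> x = \<eta>' x"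
  shows "hamiltonian U V \<eta> \<sigma> = hamiltonian U V \<eta>' \<sigma>'"
  unfolding hamiltonian_def
proof (rule infsum_cong)
  fix A assume "A \<in> {A. finite A \<and> A \<inter> V \<noteq> {}}"
  then obtain u where u: "finite A" "u \<in> A" "u \<in> V" by auto
  show "U A (override_on \<eta> \<sigma> V) = U A (override_on \<eta>' \<sigma>' V)"
    using u assms by (intro nearest_neighborD[of U A u]) (auto simp: override_on_def)
qed

lemma gibbs_spec_cong:
  assumes "nearest_neighbor U"
    and "\<And>x. x \<in> V \<Longrightarrow> \<sigma> x = \<sigma>' x"
    and "\<And>u x. u \<in> V \<Longrightarrow> x \<notin> V \<Longrightarrow> adj u x \<Longrightarrow> \<eta> x = \<eta>' x"
  shows "gibbs_spec U V \<sigma> \<eta> = gibbs_spec U V \<sigma>' \<eta>'"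
proof -
  have "hamiltonian U V \<eta> \<tau> = hamiltonian U V \<eta>' \<tau>" for \<tau>
    using assms by (intro hamiltonian_cong) auto
  then have "partition_function U V \<eta> = partition_function U V \<eta>'"
    by (simp add: partition_function_def)
  then show ?thesis
    unfolding gibbs_spec_def using hamiltonian_cong[of U V \<sigma> \<sigma>' \<eta> \<eta>'] assms by simp
qed

lemma partition_function_pos:
  assumes "finite V" shows "0 < partition_function U V \<eta>"
  unfolding partition_function_def
  using assms by (intro sum_pos finite_PiE) (auto simp: PiE_eq_empty_iff)

lemma gibbs_spec_pos: "finite V \<Longrightarrow> 0 < gibbs_spec U V \<sigma> \<eta>"
  by (simp add: gibbs_spec_def partition_function_pos)

lemma gibbs_spec_le_1:
  assumes "finite V" "nearest_neighbor U" shows "gibbs_spec U V \<sigma> \<eta> \<le> 1"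
proof -
  have "hamiltonian U V \<eta> \<sigma> = hamiltonian U V \<eta> (restrict \<sigma> V)"
    using assms by (intro hamiltonian_cong) auto
  then have "exp (- hamiltonian U V \<eta> \<sigma>) \<le> partition_function U V \<eta>"
    unfolding partition_function_def using assms
    by (simp only:) (intro member_le_sum finite_PiE; auto)
  then show ?thesis using assms partition_function_pos[of V U \<eta>]
    by (simp add: gibbs_spec_def)
qed

text \<open>The specification takes values in [0, 1], so the supremum runs over a bounded set and is
  a genuine upper bound.\<close>

lemma site_influence_bounds:
  assumes "nearest_neighbor U"
  shows "2 * \<bar>gibbs_spec U {y} (\<lambda>_. True) \<sigma> - gibbs_spec U {y} (\<lambda>_. True) \<sigma>'\<bar> \<le> site_influence U y"
    and "site_influence U y \<le> 2"
proof -
  let ?f = "\<lambda>(\<sigma>, \<sigma>'). \<bar>gibbs_spec U {y} (\<lambda>_. True) \<sigma> - gibbs_spec U {y} (\<lambda>_. True) \<sigma>'\<bar>"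
  have le: "?f s \<le> 1" for s
    using gibbs_spec_pos[of "{y}" U] gibbs_spec_le_1[of "{y}" U] assms
    by (cases s) (simp add: abs_le_iff, smt (verit))
  then have "bdd_above (range ?f)" by (intro bdd_aboveI) auto
  from cSUP_upper[OF UNIV_I this, of "(\<sigma>, \<sigma>')"]
  show "2 * \<bar>gibbs_spec U {y} (\<lambda>_. True) \<sigma> - gibbs_spec U {y} (\<lambda>_. True) \<sigma>'\<bar> \<le> site_influence U y"
    by (simp add: site_influence_def)
  show "site_influence U y \<le> 2"
    using cSUP_least[of UNIV ?f 1] le by (simp add: site_influence_def)
qed

lemma finite_neighbors: "finite {v. adj u v}"
  by (rule finite_subset[OF _ finite_lattice_ball[of u 1]]) (auto simp: adj_def lattice_ball_def)

locale gibbs_field = random_field P for P :: "'d::finite config measure" +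
  fixes U :: "'d site set \<Rightarrow> 'd config \<Rightarrow> real"
  assumes nn: "nearest_neighbor U" and gibbs: "gibbs_measure U P"
begin

lemma subalgebra_outside: "subalgebra P (outside V)"
proof -
  have "(\<lambda>\<omega>. restrict \<omega> (- V)) \<in> measurable spin_space (PiM (- V) (\<lambda>_. count_space UNIV))"
    unfolding spin_space_def by (intro measurable_restrict_subset) auto
  then have "sets (outside V) \<subseteq> sets P"
    unfolding outside_def sets_P
    by (subst sets_vimage_algebra2) (auto simp: space_PiM dest: measurable_sets)
  then show ?thesis
    by (simp add: subalgebra_def) (simp add: outside_def)
qed

text \<open>Integrated form of the conditional probabilities; the Gibbs property enters the later
  arguments through it.\<close>

lemma integral_gibbs_spec:
  assumes "finite V" "B \<in> sets (outside V)"
  shows "set_integrable P B (gibbs_spec U V \<sigma>)"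
    and "prob (B \<inter> cylinder V \<sigma>) = (LINT \<eta>:B|P. gibbs_spec U V \<sigma> \<eta>)"
proof -
  interpret S: finite_measure_subalgebra P "outside V"
    by unfold_locales (rule subalgebra_outside)
  let ?f = "indicator (cylinder V \<sigma>) :: 'd config \<Rightarrow> real"
  have B: "B \<in> events" using assms(2) subalgebra_outside[of V] by (auto simp: subalgebra_def)
  have f: "integrable P ?f" using assms by (simp add: cylinder_sets integrable_indicator_iff less_top[symmetric])
  have meas: "gibbs_spec U V \<sigma> \<in> borel_measurable P"
    using gibbs assms(1) measurable_from_subalg[OF subalgebra_outside]
    unfolding gibbs_measure_def by blast
  have ae: "AE \<eta> in P. real_cond_exp P (outside V) ?f \<eta> = gibbs_spec U V \<sigma> \<eta>"
    using gibbs assms(1) unfolding gibbs_measure_def cylinder_def by blast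
  have "integrable P (real_cond_exp P (outside V) ?f)"
    by (rule S.real_cond_exp_int(1)[OF f])
  then have "integrable P (gibbs_spec U V \<sigma>)"
    by (rule integrable_cong_AE_imp[OF _ meas]) (use ae in \<open>auto\<close>)
  then show "set_integrable P B (gibbs_spec U V \<sigma>)"
    unfolding set_integrable_def using B by (rule integrable_mult_indicator[rotated])
  have "prob (B \<inter> cylinder V \<sigma>) = (LINT \<eta>:B|P. ?f \<eta>)"
    using B cylinder_sets[OF assms(1)]
    by (simp add: set_lebesgue_integral_def indicator_inter_arith[symmetric])
  also have "\<dots> = (LINT \<eta>:B|P. real_cond_exp P (outside V) ?f \<eta>)"
    by (rule S.real_cond_exp_intA[OF f assms(2)])
  also have "\<dots> = (LINT \<eta>:B|P. gibbs_spec U V \<sigma> \<eta>)"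
    unfolding set_lebesgue_integral_def using ae meas B
    by (intro integral_cong_AE) (auto intro!: borel_measurable_scaleR borel_measurable_indicator)
  finally show "prob (B \<inter> cylinder V \<sigma>) = (LINT \<eta>:B|P. gibbs_spec U V \<sigma> \<eta>)" .
qed

text \<open>Finite energy: a strictly positive specification cannot have integral 0. Hence
  conditioning on finitely many spins always means conditioning on an event of positive
  probability.\<close>

lemma w_pos:
  assumes "finite X" shows "0 < w X \<tau>"
proof (rule ccontr)
  have U: "UNIV \<in> sets (outside X)"
    using sets.top[of "outside X"] by (simp add: outside_def)
  assume "\<not> 0 < w X \<tau>"
  then have "w X \<tau> = 0" by (simp add: zero_less_measure_iff)
  with integral_gibbs_spec[OF assms U, of \<tau>]
  have "integrable P (gibbs_spec U X \<tau>)" "integral\<^sup>L P (gibbs_spec U X \<tau>) = 0"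
    by (simp_all add: set_integrable_def set_lebesgue_integral_def)
  then have "AE \<eta> in P. gibbs_spec U X \<tau> \<eta> = 0"
    using assms gibbs_spec_pos[of X U] by (subst (asm) integral_nonneg_eq_0_iff_AE) (auto intro: less_imp_le)
  then have "AE \<eta> in P. False"
    by (rule eventually_mono) (metis gibbs_spec_pos[OF assms] less_irrefl)
  then show False by simp
qed

text \<open>Spatial Markov property in terms of cylinder weights: \<open>X\<close> contains all
  neighbours of \<open>V\<close>, so the specification is constant on the cylinder over
  \<open>X - V\<close>.\<close>

lemma w_gibbs:
  assumes "finite X" "V \<subseteq> X" "\<And>u v. u \<in> V \<Longrightarrow> adj u v \<Longrightarrow> v \<in> X"
  shows "w X \<tau> = w (X - V) \<tau> * gibbs_spec U V \<tau> \<tau>"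
proof -
  let ?B = "cylinder (X - V) \<tau>"
  have fin: "finite V" "finite (X - V)" using assms finite_subset by auto
  have B: "?B \<in> sets (outside V)" using fin by (intro cylinder_in_outside) auto
  have "cylinder X \<tau> = ?B \<inter> cylinder V \<tau>" using assms(2) by (auto simp: cylinder_def)
  then have "w X \<tau> = (LINT \<eta>:?B|P. gibbs_spec U V \<tau> \<eta>)"
    using integral_gibbs_spec(2)[OF fin(1) B] by simp
  also have "\<dots> = (LINT \<eta>:?B|P. gibbs_spec U V \<tau> \<tau>)"
    using cylinder_sets[OF fin(2)] assms
    by (intro set_lebesgue_integral_cong ballI impI allI gibbs_spec_cong nn)
       (auto simp: cylinder_def)
  also have "\<dots> = w (X - V) \<tau> * gibbs_spec U V \<tau> \<tau>"
    using cylinder_sets[OF fin(2)] by (simp add: set_lebesgue_integral_def)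
  finally show ?thesis .
qed

text \<open>Conditioning on fewer sites averages the single-site specification, so its oscillation
  cannot increase.\<close>

lemma conditional_oscillation:
  assumes q: "\<And>\<sigma> \<sigma>'. \<bar>gibbs_spec U {y} (\<lambda>_. True) \<sigma> - gibbs_spec U {y} (\<lambda>_. True) \<sigma>'\<bar> \<le> q"
    and "finite Y" "y \<notin> Y"
  shows "\<bar>w (insert y Y) (\<eta>(y := True)) / w Y \<eta> - w (insert y Y) (\<eta>'(y := True)) / w Y \<eta>'\<bar> \<le> q"
proof -
  let ?g = "\<lambda>\<sigma>. gibbs_spec U {y} (\<lambda>_. True) \<sigma>"
  \<comment> \<open>The oscillation bound is turned into confinement to one fixed interval, from
    \<open>lo\<close> to \<open>lo + q\<close>, because this is what averaging preserves.\<close>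
  define lo where "lo = (INF \<sigma>. ?g \<sigma>)"
  have "bdd_below (range ?g)"
    by (intro bdd_belowI[of _ 0]) (auto intro: less_imp_le gibbs_spec_pos)
  then have lo: "lo \<le> ?g \<sigma>" for \<sigma> unfolding lo_def by (rule cINF_lower) simp
  have hi: "?g \<sigma> \<le> lo + q" for \<sigma>
  proof -
    have "?g \<sigma> - q \<le> lo"
      unfolding lo_def using q by (intro cINF_greatest) (auto simp: abs_le_iff algebra_simps)
    then show ?thesis by simp
  qed
  \<comment> \<open>Given all neighbours of \<open>y\<close>, the conditional probability is the
    specification itself. The additional sites are afterwards summed out one at a time.\<close>
  define Z where "Z = (Y \<union> {v. adj y v}) - {y}"
  have Z: "finite Z" "Y \<subseteq> Z" "y \<notin> Z"
    using assms finite_neighbors[of y] by (auto simp: Z_def)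
  have key: "lo * w V \<eta> \<le> w (insert y V) (\<eta>(y := True))
      \<and> w (insert y V) (\<eta>(y := True)) \<le> (lo + q) * w V \<eta>" if "V \<subseteq> Z" for V \<eta>
    using that
  proof (induction "Z - V" arbitrary: V \<eta> rule: infinite_finite_induct)
    case infinite
    then show ?case using Z by simp
  next
    case empty
    then have V: "V = Z" by auto
    have "w (insert y Z) (\<eta>(y := True))
        = w (insert y Z - {y}) (\<eta>(y := True)) * gibbs_spec U {y} (\<eta>(y := True)) (\<eta>(y := True))"
      using Z(1) by (intro w_gibbs) (auto simp: Z_def)
    also have "gibbs_spec U {y} (\<eta>(y := True)) (\<eta>(y := True)) = ?g \<eta>"
      by (intro gibbs_spec_cong nn) auto
    also have "w (insert y Z - {y}) (\<eta>(y := True)) = w Z \<eta>"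
    proof -
      have "insert y Z - {y} = Z" using Z(3) by auto
      then show ?thesis using Z(3) by (simp only:) (rule w_cong, auto)
    qed
    finally show ?case
      unfolding V using lo[of \<eta>] hi[of \<eta>]
      by (auto simp: mult.commute[of "w Z \<eta>"] intro!: mult_right_mono)
  next
    case (insert z D)
    then have z: "z \<notin> V" "z \<in> Z" by auto
    then have "z \<noteq> y" using Z by auto
    have IH: "lo * w (insert z V) \<zeta> \<le> w (insert y (insert z V)) (\<zeta>(y := True))
      \<and> w (insert y (insert z V)) (\<zeta>(y := True)) \<le> (lo + q) * w (insert z V) \<zeta>" for \<zeta>
      using insert.hyps insert.prems z by (intro insert.hyps(3)) auto
    have finV: "finite V" using insert.prems Z finite_subset by auto
    have "w V \<eta> = w (insert z V) (\<eta>(z := True)) + w (insert z V) (\<eta>(z := False))"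
      using finV z(1) by (rule w_split)
    moreover have "w (insert y V) (\<eta>(y := True)) =
        w (insert y (insert z V)) (\<eta>(z := True, y := True)) + w (insert y (insert z V)) (\<eta>(z := False, y := True))"
      using w_split[of "insert y V" z "\<eta>(y := True)"] finV z \<open>z \<noteq> y\<close>
      by (simp add: fun_upd_twist insert_commute)
    ultimately show ?case
      using IH[of "\<eta>(z := True)"] IH[of "\<eta>(z := False)"] by (simp add: distrib_left)
  qed
  have "lo \<le> w (insert y Y) (\<eta>(y := True)) / w Y \<eta> \<and> w (insert y Y) (\<eta>(y := True)) / w Y \<eta> \<le> lo + q" for \<eta>
    using key[OF Z(2), of \<eta>] w_pos[OF assms(2), of \<eta>] by (simp add: field_simps)
  from this[of \<eta>] this[of \<eta>'] show ?thesis by (simp add: abs_le_iff)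
qed

end

section \<open>Disagreement percolation\<close>

text \<open>Total functions frozen to \<eta> off \<open>V\<close>: a configuration carries its
  boundary condition and can be passed to \<open>w\<close> and \<open>gibbs_spec\<close>
  directly.\<close>

definition configs :: "'a set \<Rightarrow> ('a \<Rightarrow> bool) \<Rightarrow> ('a \<Rightarrow> bool) set" where
  "configs V \<eta> = {\<tau>. \<forall>z. z \<notin> V \<longrightarrow> \<tau> z = \<eta> z}"

definition discrete_coupling ::
  "'a set \<Rightarrow> 'b set \<Rightarrow> ('a \<Rightarrow> real) \<Rightarrow> ('b \<Rightarrow> real) \<Rightarrow> ('a \<Rightarrow> 'b \<Rightarrow> real) \<Rightarrow> bool" where
  "discrete_coupling S S' p p' q \<longleftrightarrow> (\<forall>u v. 0 \<le> q u v) \<and>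
     (\<forall>u\<in>S. (\<Sum>v\<in>S'. q u v) = p u) \<and> (\<forall>v\<in>S'. (\<Sum>u\<in>S. q u v) = p' v)"

lemma configs_empty [simp]: "configs {} \<eta> = {\<eta>}"
  by (auto simp: configs_def)

lemma configs_insert:
  assumes "y \<notin> V"
  shows "configs (insert y V) \<eta> = configs V (\<eta>(y := True)) \<union> configs V (\<eta>(y := False))"
proof (intro set_eqI iffI)
  fix \<tau> assume "\<tau> \<in> configs (insert y V) \<eta>"
  then show "\<tau> \<in> configs V (\<eta>(y := True)) \<union> configs V (\<eta>(y := False))"
    by (cases "\<tau> y") (auto simp: configs_def)
next
  fix \<tau> assume "\<tau> \<in> configs V (\<eta>(y := True)) \<union> configs V (\<eta>(y := False))"
  then show "\<tau> \<in> configs (insert y V) \<eta>"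
    unfolding configs_def by (auto simp: fun_upd_def)
qed

lemma finite_configs: "finite V \<Longrightarrow> finite (configs V \<eta>)"
  by (induction V arbitrary: \<eta> rule: finite_induct) (auto simp: configs_insert)

lemma configs_value: "y \<notin> V \<Longrightarrow> \<tau> \<in> configs V (\<eta>(y := s)) \<Longrightarrow> \<tau> y = s"
  by (auto simp: configs_def)

lemma configs_fix: "\<tau> \<in> configs (insert y V) \<eta> \<Longrightarrow> \<tau> \<in> configs V (\<eta>(y := \<tau> y))"
  by (auto simp: configs_def)

lemma sum_configs_insert:
  fixes f :: "('a \<Rightarrow> bool) \<Rightarrow> real"
  assumes "finite V" "y \<notin> V"
  shows "(\<Sum>\<tau>\<in>configs (insert y V) \<eta>. f \<tau>) = (\<Sum>s\<in>UNIV. \<Sum>\<tau>\<in>configs V (\<eta>(y := s)). f \<tau>)"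
proof -
  have "configs V (\<eta>(y := True)) \<inter> configs V (\<eta>(y := False)) = {}"
    using assms(2) by (auto dest: configs_value)
  then show ?thesis
    using assms by (simp add: configs_insert sum.union_disjoint finite_configs UNIV_bool)
qed

lemma infl_prob_nonneg: "0 \<le> p \<Longrightarrow> p \<le> 1 \<Longrightarrow> 0 \<le> infl_prob E p V A y"
  unfolding infl_prob_def by (rule bern_exp_nonneg) auto

lemma infl_prob_mono:
  "0 \<le> p \<Longrightarrow> p \<le> 1 \<Longrightarrow> A \<subseteq> A' \<Longrightarrow> infl_prob E p V A y \<le> infl_prob E p V A' y"
  unfolding infl_prob_def by (intro bern_exp_mono) (auto dest: subsetD[OF cluster_mono[OF order_refl]])

lemma infl_prob_explore:
  assumes "finite V" "u \<notin> V" "a \<in> A" "E a u"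
  shows "infl_prob E p (insert u V) A y
    = p * infl_prob E p V (insert u A) y + (1 - p) * infl_prob E p V A y"
  using assms by (simp add: infl_prob_def bern_exp_insert cluster_insert_source)

lemma infl_prob_source: "finite V \<Longrightarrow> y \<in> A \<Longrightarrow> infl_prob E p V A y = 1"
  by (simp add: infl_prob_def cluster.base)

text \<open>Separates the connection to \<open>x\<close> from the connection to the rim of the
  window.\<close>

lemma infl_prob_Un:
  assumes "0 \<le> p" "p \<le> 1"
  shows "infl_prob E p V (A \<union> A') y \<le> infl_prob E p V A y + infl_prob E p V A' y"
  unfolding infl_prob_def bern_exp_add[symmetric] cluster_Un
  using assms by (intro bern_exp_mono) auto

text \<open>The optimal coupling of two Bernoulli laws with parameters \<open>a\<close> and
  \<open>a'\<close>: the common mass stays on the diagonal, so the spins differ with probability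
  \<open>\<bar>a - a'\<bar>\<close>.\<close>

definition bool_coupling :: "real \<Rightarrow> real \<Rightarrow> bool \<Rightarrow> bool \<Rightarrow> real" where
  "bool_coupling a a' s s' =
     (if s then if s' then min a a' else max (a - a') 0
      else if s' then max (a' - a) 0 else min (1 - a) (1 - a'))"

lemma bool_coupling:
  assumes "0 \<le> a" "a \<le> 1" "0 \<le> a'" "a' \<le> 1"
  shows "0 \<le> bool_coupling a a' s s'"
    and "(\<Sum>s'\<in>UNIV. bool_coupling a a' s s') = (if s then a else 1 - a)"
    and "(\<Sum>s\<in>UNIV. bool_coupling a a' s s') = (if s' then a' else 1 - a')"
    and "bool_coupling a a' True False + bool_coupling a a' False True = \<bar>a - a'\<bar>"
    and "bool_coupling a a' True True + bool_coupling a a' False False = 1 - \<bar>a - a'\<bar>"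
  using assms by (auto simp: bool_coupling_def UNIV_bool min_def max_def)

context random_field
begin

text \<open>For \<tau> in \<open>configs V \<eta>\<close> this is the conditional probability of
  \<tau> on \<open>X\<close> given \<eta> on \<open>X - V\<close>.\<close>

definition \<kappa> :: "'d site set \<Rightarrow> 'd site set \<Rightarrow> 'd config \<Rightarrow> 'd config \<Rightarrow> real" where
  "\<kappa> X V \<eta> \<tau> = w X \<tau> / w (X - V) \<eta>"

lemma sum_w_configs:
  assumes "finite V" "finite Y" "V \<inter> Y = {}"
  shows "(\<Sum>u\<in>configs V \<eta>. w (Y \<union> V) u) = w Y \<eta>"
  using assms
proof (induction V arbitrary: Y \<eta> rule: finite_induct)
  case (insert y V)
  have "(\<Sum>u\<in>configs V (\<eta>(y := s)). w (Y \<union> insert y V) u) = w (insert y Y) (\<eta>(y := s))" for s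
  proof -
    have eq: "Y \<union> insert y V = insert y Y \<union> V" by auto
    show ?thesis
      unfolding eq using insert.hyps insert.prems by (intro insert.IH) auto
  qed
  then show ?case
    using insert.hyps insert.prems w_split[of Y y \<eta>] by (simp add: sum_configs_insert UNIV_bool)
qed simp

end

context gibbs_field
begin

lemma single_site_prob:
  fixes \<eta> :: "'d config"
  assumes "finite Y" "y \<notin> Y"
  defines "a \<equiv> w (insert y Y) (\<eta>(y := True)) / w Y \<eta>"
  shows "0 \<le> a" "a \<le> 1" "w (insert y Y) (\<eta>(y := s)) = (if s then a else 1 - a) * w Y \<eta>"
proof -
  have pos: "0 < w Y \<eta>" using assms(1) by (rule w_pos)
  have split: "w Y \<eta> = w (insert y Y) (\<eta>(y := True)) + w (insert y Y) (\<eta>(y := False))"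
    using assms by (intro w_split)
  show "0 \<le> a" by (simp add: a_def)
  show "a \<le> 1" using pos split by (simp add: a_def)
  show "w (insert y Y) (\<eta>(y := s)) = (if s then a else 1 - a) * w Y \<eta>"
  proof (cases s)
    case True
    then have "\<eta>(y := s) = \<eta>(y := True)" by simp
    then show ?thesis using pos True by (simp add: a_def)
  next
    case False
    then have "\<eta>(y := s) = \<eta>(y := False)" by simp
    then show ?thesis using pos split False by (simp add: a_def left_diff_distrib)
  qed
qed

lemma sum_\<kappa>:
  assumes "finite X" "V \<subseteq> X"
  shows "(\<Sum>u\<in>configs V \<eta>. \<kappa> X V \<eta> u) = 1"
proof -
  have "(\<Sum>u\<in>configs V \<eta>. w X u) = w (X - V) \<eta>"
  proof -
    have "X = (X - V) \<union> V" using assms(2) by auto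
    then show ?thesis
      using sum_w_configs[of V "X - V" \<eta>] assms finite_subset[OF assms(2,1)] by auto
  qed
  then show ?thesis
    using w_pos[of "X - V" \<eta>] assms by (simp add: \<kappa>_def sum_divide_distrib[symmetric])
qed

text \<open>Disagreement percolation: the sites of \<open>V\<close> are revealed one at a time, next to an existing
  disagreement as long as possible, and each of them is coupled optimally; the disagreements then
  spread at most like Bernoulli percolation with parameter \<open>q\<close>. Nothing is known about a site with
  a neighbour outside the window \<open>X\<close>, so such sites are revealed first and counted as
  disagreements.\<close>

lemma disagreement_percolation:
  assumes osc: "\<And>y \<sigma> \<sigma>'. \<bar>gibbs_spec U {y} (\<lambda>_. True) \<sigma> - gibbs_spec U {y} (\<lambda>_. True) \<sigma>'\<bar> \<le> q"
    and q: "q \<le> 1" and X: "finite X"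
  defines "I \<equiv> {z. \<forall>v. adj z v \<longrightarrow> v \<in> X}"
  assumes "V \<subseteq> X" "\<And>z. z \<in> X - V - A \<Longrightarrow> \<eta> z = \<eta>' z" "A \<inter> V = {}"
  shows "\<exists>c. discrete_coupling (configs V \<eta>) (configs V \<eta>') (\<kappa> X V \<eta>) (\<kappa> X V \<eta>') c \<and>
    (\<forall>y\<in>V \<inter> I. (\<Sum>u\<in>configs V \<eta>. \<Sum>v\<in>configs V \<eta>'. c u v * of_bool (u y \<noteq> v y))
      \<le> infl_prob adj q (V \<inter> I) (A \<union> (V - I)) y)"
proof -
  have "0 \<le> q" using osc[of 0 "\<lambda>_. True" "\<lambda>_. True"] by simp
  note q = this q
  have "finite V" using assms finite_subset by blast
  then show ?thesis using assms(5-)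
  proof (induction V arbitrary: A \<eta> \<eta>' rule: finite_psubset_induct)
    case (psubset V)
    show ?case
    proof (cases "\<exists>y0\<in>V. y0 \<notin> I \<or> (\<exists>a\<in>A. adj a y0)")
      case True
      then obtain y0 where y0: "y0 \<in> V" "y0 \<notin> I \<or> (\<exists>a\<in>A. adj a y0)" by blast
      define L where "L = V - {y0}"
      have L: "finite L" "L \<subset> V" "insert y0 L = V" "y0 \<notin> L" "L \<subseteq> X"
        using y0 psubset.hyps psubset.prems by (auto simp: L_def)
      let ?S = "\<lambda>s. configs L (\<eta>(y0 := s))" and ?S' = "\<lambda>s'. configs L (\<eta>'(y0 := s'))"
      define Y where "Y = X - V"
      have Y: "finite Y" "y0 \<notin> Y" "X - L = insert y0 Y" "X - V = Y"
        using X y0 psubset.prems by (auto simp: Y_def L_def)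
      define a where "a = w (insert y0 Y) (\<eta>(y0 := True)) / w Y \<eta>"
      define a' where "a' = w (insert y0 Y) (\<eta>'(y0 := True)) / w Y \<eta>'"
      note a = single_site_prob[OF Y(1,2), of \<eta>, folded a_def]
      note a' = single_site_prob[OF Y(1,2), of \<eta>', folded a'_def]
      note bc = bool_coupling[OF a(1,2) a'(1,2)]
      \<comment> \<open>Equal spins at \<open>y0\<close> create no new disagreement; unequal spins
        make \<open>y0\<close> an additional source.\<close>
      define A1 where "A1 = (\<lambda>s s' :: bool. if s = s' then A else insert y0 A)"
      define good where "good = (\<lambda>s s' c.
          discrete_coupling (?S s) (?S' s')
            (\<kappa> X L (\<eta>(y0 := s))) (\<kappa> X L (\<eta>'(y0 := s'))) c \<and>
          (\<forall>y\<in>L \<inter> I. (\<Sum>u\<in>?S s. \<Sum>v\<in>?S' s'.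
              c u v * of_bool (u y \<noteq> v y)) \<le> infl_prob adj q (L \<inter> I) (A1 s s' \<union> (L - I)) y))"
      have "\<exists>c. good s s' c" for s s'
        unfolding good_def
        using L psubset.prems by (intro psubset.IH) (auto simp: A1_def split: if_splits)
      then obtain c where good: "\<And>s s'. good s s' (c s s')" by metis
      note c = good[unfolded good_def, THEN conjunct1]
      note dis = good[unfolded good_def, THEN conjunct2, rule_format]
      define d where "d = (\<lambda>u v. bool_coupling a a' (u y0) (v y0) * c (u y0) (v y0) u v)"
      have d_at: "d u v = bool_coupling a a' s s' * c s s' u v"
        if "u \<in> ?S s" "v \<in> ?S' s'" for u v s s'
        using configs_value[OF L(4) that(1)] configs_value[OF L(4) that(2)] by (simp add: d_def)
      \<comment> \<open>Chain rule: revealing \<open>y0\<close> and then \<open>L\<close> gives the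
        same weight as revealing \<open>V\<close> at once.\<close>
      have ratio: "(if s then b else 1 - b) * \<kappa> X L (\<zeta>(y0 := s)) u = \<kappa> X V \<zeta> u"
        if "w (insert y0 Y) (\<zeta>(y0 := s)) = (if s then b else 1 - b) * w Y \<zeta>" for s b \<zeta> u
      proof -
        have "0 < w (insert y0 Y) (\<zeta>(y0 := s))" "0 < w Y \<zeta>" using Y by (auto intro: w_pos)
        then show ?thesis using that unfolding \<kappa>_def Y by (auto simp: field_simps)
      qed
      have "discrete_coupling (configs V \<eta>) (configs V \<eta>') (\<kappa> X V \<eta>) (\<kappa> X V \<eta>') d"
        unfolding discrete_coupling_def
      proof (intro conjI ballI allI)
        show "0 \<le> d u v" for u v
          using bc(1) c by (simp add: d_def discrete_coupling_def)
      next
        fix u assume u: "u \<in> configs V \<eta>"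
        define s where "s = u y0"
        have us: "u \<in> ?S s" using u configs_fix[of u y0 L \<eta>] L by (simp add: s_def)
        have "(\<Sum>v\<in>configs V \<eta>'. d u v) = (\<Sum>s'\<in>UNIV. \<Sum>v\<in>?S' s'. d u v)"
          using sum_configs_insert[OF L(1,4)] unfolding L(3) .
        also have "\<dots> = (\<Sum>s'\<in>UNIV. bool_coupling a a' s s' * \<kappa> X L (\<eta>(y0 := s)) u)"
          using us c by (simp add: d_at discrete_coupling_def sum_distrib_left[symmetric])
        also have "\<dots> = (if s then a else 1 - a) * \<kappa> X L (\<eta>(y0 := s)) u"
          by (simp only: sum_distrib_right[symmetric] bc(2))
        also have "\<dots> = \<kappa> X V \<eta> u" using a(3) by (rule ratio)
        finally show "(\<Sum>v\<in>configs V \<eta>'. d u v) = \<kappa> X V \<eta> u" .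
      next
        fix v assume v: "v \<in> configs V \<eta>'"
        define s' where "s' = v y0"
        have vs: "v \<in> ?S' s'" using v configs_fix[of v y0 L \<eta>'] L by (simp add: s'_def)
        have "(\<Sum>u\<in>configs V \<eta>. d u v) = (\<Sum>s\<in>UNIV. \<Sum>u\<in>?S s. d u v)"
          using sum_configs_insert[OF L(1,4)] unfolding L(3) .
        also have "\<dots> = (\<Sum>s\<in>UNIV. bool_coupling a a' s s' * \<kappa> X L (\<eta>'(y0 := s')) v)"
          using vs c by (simp add: d_at discrete_coupling_def sum_distrib_left[symmetric])
        also have "\<dots> = (if s' then a' else 1 - a') * \<kappa> X L (\<eta>'(y0 := s')) v"
          by (simp only: sum_distrib_right[symmetric] bc(3))
        also have "\<dots> = \<kappa> X V \<eta>' v" using a'(3) by (rule ratio)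
        finally show "(\<Sum>u\<in>configs V \<eta>. d u v) = \<kappa> X V \<eta>' v" .
      qed
      moreover have "(\<Sum>u\<in>configs V \<eta>. \<Sum>v\<in>configs V \<eta>'. d u v * of_bool (u y \<noteq> v y))
          \<le> infl_prob adj q (V \<inter> I) (A \<union> (V - I)) y" (is "?lhs \<le> ?rhs") if y: "y \<in> V \<inter> I" for y
      proof -
        define r where "r = \<bar>a - a'\<bar>"
        have r: "0 \<le> r" "r \<le> q"
          using conditional_oscillation[OF osc Y(1,2), of \<eta> \<eta>'] by (auto simp: r_def a_def a'_def)
        define D where "D = (\<lambda>s s'. \<Sum>u\<in>?S s. \<Sum>v\<in>?S' s'. c s s' u v * of_bool (u y \<noteq> v y))"
        have "?lhs = (\<Sum>s\<in>UNIV. \<Sum>u\<in>?S s. \<Sum>s'\<in>UNIV. \<Sum>v\<in>?S' s'. d u v * of_bool (u y \<noteq> v y))"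
          using sum_configs_insert[OF L(1,4)] unfolding L(3) by simp
        also have "\<dots> = (\<Sum>s\<in>UNIV. \<Sum>s'\<in>UNIV. \<Sum>u\<in>?S s. \<Sum>v\<in>?S' s'. d u v * of_bool (u y \<noteq> v y))"
          by (intro sum.cong refl sum.swap)
        also have "\<dots> = (\<Sum>s\<in>UNIV. \<Sum>s'\<in>UNIV. bool_coupling a a' s s' * D s s')"
          unfolding D_def sum_distrib_left
          by (intro sum.cong refl) (simp add: d_at)
        finally have lhs: "?lhs = (\<Sum>s\<in>UNIV. \<Sum>s'\<in>UNIV. bool_coupling a a' s s' * D s s')" .
        define J J' where "J = infl_prob adj q (L \<inter> I) (A \<union> (L - I)) y"
          and "J' = infl_prob adj q (L \<inter> I) (insert y0 A \<union> (L - I)) y"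
        have JJ: "J \<le> J'" unfolding J_def J'_def using q by (intro infl_prob_mono) auto
        show ?thesis
        proof (cases "y = y0")
          case True
          have D01: "D s s' = (if s = s' then 0 else 1)" for s s'
          proof -
            have "D s s' = (\<Sum>u\<in>?S s. \<Sum>v\<in>?S' s'. c s s' u v) * of_bool (s \<noteq> s')"
              unfolding D_def sum_distrib_right using True
              by (intro sum.cong refl) (simp add: configs_value[OF L(4)])
            also have "(\<Sum>u\<in>?S s. \<Sum>v\<in>?S' s'. c s s' u v) = (\<Sum>u\<in>?S s. \<kappa> X L (\<eta>(y0 := s)) u)"
              using c by (simp add: discrete_coupling_def)
            also have "\<dots> = 1" by (rule sum_\<kappa>) (use X L in auto)
            finally show ?thesis by simp
          qed
          obtain b where b: "b \<in> A" "adj b y0" using y y0 True by auto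
          have "?lhs = r"
            unfolding lhs D01 using bc(4) by (simp add: UNIV_bool r_def)
          \<comment> \<open>In the first branch \<open>y = y0\<close> is a source and has influence
            1, so the right-hand side is at least \<open>q\<close>.\<close>
          also have "\<dots> \<le> q * infl_prob adj q (L \<inter> I) (insert y0 (A \<union> (V - I))) y + (1 - q) * infl_prob adj q (L \<inter> I) (A \<union> (V - I)) y"
          proof -
            have "0 \<le> (1 - q) * infl_prob adj q (L \<inter> I) (A \<union> (V - I)) y"
              using q by (intro mult_nonneg_nonneg infl_prob_nonneg) auto
            then show ?thesis using r(2) True L(1) by (simp add: infl_prob_source)
          qed
          also have "\<dots> = infl_prob adj q (insert y0 (L \<inter> I)) (A \<union> (V - I)) y"
            using L b by (intro infl_prob_explore[symmetric, of _ _ b]) auto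
          also have "insert y0 (L \<inter> I) = V \<inter> I" using L y True by auto
          finally show ?thesis .
        next
          case False
          then have yL: "y \<in> L \<inter> I" using y L by auto
          have "?lhs \<le> (\<Sum>s\<in>UNIV. \<Sum>s'\<in>UNIV. bool_coupling a a' s s' * (if s = s' then J else J'))"
          proof -
            have "D s s' \<le> (if s = s' then J else J')" for s s'
              using dis[OF yL, of s s'] unfolding D_def J_def J'_def A1_def
              by (cases "s = s'") (simp_all only: if_True if_False refl)
            then show ?thesis unfolding lhs by (intro sum_mono mult_left_mono bc(1))
          qed
          also have "\<dots> = (bool_coupling a a' True True + bool_coupling a a' False False) * J
              + (bool_coupling a a' True False + bool_coupling a a' False True) * J'"
            by (simp add: UNIV_bool distrib_right)
          also have "\<dots> = (1 - r) * J + r * J'" by (simp only: bc(4,5) r_def)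
          \<comment> \<open>Raising \<open>r\<close> to \<open>q\<close> shifts weight to the larger
            value \<open>J'\<close>.\<close>
          also have "\<dots> \<le> (1 - q) * J + q * J'"
            using mult_right_mono[OF r(2), of "J' - J"] JJ by (simp add: algebra_simps)
          also have "\<dots> \<le> ?rhs"
          proof (cases "y0 \<in> I")
            case True
            then obtain b where b: "b \<in> A" "adj b y0" using y0 by auto
            have "L - I = V - I" "insert y0 (L \<inter> I) = V \<inter> I" using L True by auto
            moreover have "infl_prob adj q (insert y0 (L \<inter> I)) (A \<union> (L - I)) y
                = q * infl_prob adj q (L \<inter> I) (insert y0 (A \<union> (L - I))) y + (1 - q) * J"
              unfolding J_def using L b by (intro infl_prob_explore[of _ _ b]) auto
            ultimately show ?thesis by (simp add: J'_def)
          next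
            \<comment> \<open>A site \<open>y0\<close> on the rim already counts as a source on the
              right-hand side, so both branches may be bounded by \<open>J'\<close>.\<close>
            case False
            have "(1 - q) * J + q * J' \<le> J'"
              using mult_left_mono[OF JJ, of "1 - q"] q by (simp add: algebra_simps)
            moreover have "J' = ?rhs"
              unfolding J'_def using False L
              by (intro arg_cong2[where f = "\<lambda>a b. infl_prob adj q a b y"]) auto
            ultimately show ?thesis by simp
          qed
          finally show ?thesis .
        qed
      qed
      ultimately show ?thesis by blast
    next
      case False
      let ?S = "configs V \<eta>" and ?S' = "configs V \<eta>'"
      \<comment> \<open>No site of \<open>V\<close> is next to a disagreement or to the outside of
        \<open>X\<close>. By the Markov property the two conditional laws agree on \<open>V\<close>,
        so they are coupled identically.\<close>
      define d where "d = (\<lambda>u v. \<kappa> X V \<eta> u * of_bool (\<forall>z\<in>V. u z = v z))"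
      have nonneg: "0 \<le> d u v" for u v
        by (simp add: d_def \<kappa>_def)
      have eq: "\<kappa> X V \<eta> u = \<kappa> X V \<eta>' v"
        if "u \<in> ?S" "v \<in> ?S'" "\<forall>z\<in>V. u z = v z" for u v
      proof -
        have spec: "\<kappa> X V \<zeta> \<tau> = gibbs_spec U V \<tau> \<zeta>" if "\<tau> \<in> configs V \<zeta>" for \<tau> \<zeta>
        proof -
          have "w X \<tau> = w (X - V) \<tau> * gibbs_spec U V \<tau> \<tau>"
            using False psubset.prems X by (intro w_gibbs) (auto simp: I_def)
          moreover have "w (X - V) \<tau> = w (X - V) \<zeta>"
            using that by (intro w_cong) (auto simp: configs_def)
          moreover have "gibbs_spec U V \<tau> \<tau> = gibbs_spec U V \<tau> \<zeta>"
            using that by (intro gibbs_spec_cong nn) (auto simp: configs_def)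
          moreover have "0 < w (X - V) \<zeta>" using X by (intro w_pos) auto
          ultimately show ?thesis by (simp add: \<kappa>_def)
        qed
        have "gibbs_spec U V u \<eta> = gibbs_spec U V v \<eta>'"
        proof (intro gibbs_spec_cong nn)
          fix z x assume *: "z \<in> V" "x \<notin> V" "adj z x"
          then have "x \<in> X" using False by (auto simp: I_def)
          moreover have "x \<notin> A" using False * adj_sym by blast
          ultimately show "\<eta> x = \<eta>' x" using psubset.prems * by auto
        qed (use that in auto)
        then show ?thesis using spec that by simp
      qed
      have unique: "(\<Sum>v\<in>configs V \<zeta>. f v * of_bool (\<forall>z\<in>V. u z = v z)) = f (override_on \<zeta> u V)"
        for \<zeta> u and f :: "'d config \<Rightarrow> real"
      proof -
        have "(\<Sum>v\<in>configs V \<zeta>. f v * of_bool (\<forall>z\<in>V. u z = v z)) =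
            (\<Sum>v\<in>configs V \<zeta>. if v = override_on \<zeta> u V then f v else 0)"
          by (intro sum.cong refl) (auto simp: configs_def override_on_def fun_eq_iff)
        also have "\<dots> = f (override_on \<zeta> u V)"
          using finite_configs[OF psubset.hyps(1)]
          by (subst sum.delta) (auto simp: configs_def)
        finally show ?thesis .
      qed
      have "discrete_coupling ?S ?S' (\<kappa> X V \<eta>) (\<kappa> X V \<eta>') d"
        unfolding discrete_coupling_def
      proof (intro conjI ballI allI nonneg)
        fix u assume "u \<in> ?S"
        show "(\<Sum>v\<in>?S'. d u v) = \<kappa> X V \<eta> u"
          unfolding d_def by (rule unique)
      next
        fix v assume v: "v \<in> ?S'"
        have "(\<Sum>u\<in>?S. d u v) = (\<Sum>u\<in>?S. \<kappa> X V \<eta> u * of_bool (\<forall>z\<in>V. v z = u z))"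
          by (intro sum.cong refl) (auto simp: d_def)
        also have "\<dots> = \<kappa> X V \<eta> (override_on \<eta> v V)" by (rule unique)
        also have "\<dots> = \<kappa> X V \<eta>' v"
          using v by (intro eq) (auto simp: configs_def)
        finally show "(\<Sum>u\<in>?S. d u v) = \<kappa> X V \<eta>' v" .
      qed
      moreover have "(\<Sum>u\<in>?S. \<Sum>v\<in>?S'. d u v * of_bool (u y \<noteq> v y)) = 0" if "y \<in> V" for y
        using that by (intro sum.neutral ballI) (auto simp: d_def)
      ultimately show ?thesis
        using infl_prob_nonneg[OF q] by (intro exI[of _ d]) auto
    qed
  qed
qed

end

section \<open>Maximal couplings and weak limits\<close>

text \<open>Mass transported \<open>u \<rightarrow> z\<close> and \<open>z \<rightarrow> v\<close> is rerouted to \<open>z \<rightarrow> z\<close> and \<open>u \<rightarrow> v\<close>; by the triangle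
  inequality no pseudometric cost increases.\<close>

lemma discrete_coupling_merge:
  assumes "finite S" "z \<in> S" and q: "discrete_coupling S S p p' q"
    and cost: "\<And>c. c \<in> \<C> \<Longrightarrow> c z z = 0 \<and> (\<forall>u v. c u v \<le> c u z + c z v)"
  shows "\<exists>q'. discrete_coupling S S p p' q' \<and> min (p z) (p' z) \<le> q' z z \<and> (\<forall>y. q y y \<le> q' y y) \<and>
    (\<forall>c\<in>\<C>. (\<Sum>u\<in>S. \<Sum>v\<in>S. q' u v * c u v) \<le> (\<Sum>u\<in>S. \<Sum>v\<in>S. q u v * (c u v :: real)))"
proof -
  let ?S = "S - {z}"
  have split: "(\<Sum>u\<in>S. f u) = f z + (\<Sum>u\<in>?S. f u)" for f :: "_ \<Rightarrow> real"
    by (rule sum.remove[OF assms(1,2)])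
  have nonneg: "0 \<le> q u v" for u v using q by (simp add: discrete_coupling_def)
  have row: "(\<Sum>v\<in>S. q u v) = p u" and col: "(\<Sum>v\<in>S. q v u) = p' u" if "u \<in> S" for u
    using q that by (auto simp: discrete_coupling_def)
  \<comment> \<open>\<open>a\<close> is the mass leaving \<open>z\<close>, \<open>b\<close> the mass
    arriving at \<open>z\<close>, and \<open>m\<close> the amount of both that can be joined on the
    diagonal.\<close>
  define a b m where "a = p z - q z z" and "b = p' z - q z z" and "m = min a b"
  have a: "(\<Sum>v\<in>?S. q z v) = a" using row[OF assms(2)] split[of "q z"] by (simp add: a_def)
  have b: "(\<Sum>u\<in>?S. q u z) = b"
    using col[OF assms(2)] split[of "\<lambda>u. q u z"] by (simp add: b_def)
  have m: "0 \<le> m" "m \<le> a" "m \<le> b" "m = 0 \<or> 0 < a \<and> 0 < b"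
    using sum_nonneg[of ?S "q z"] sum_nonneg[of ?S "\<lambda>u. q u z"] nonneg a b by (auto simp: m_def)
  \<comment> \<open>The mass \<open>m\<close> is withdrawn proportionally from the row and from the
    column of \<open>z\<close>; the loose ends are glued as a product, with weight
    \<open>\<gamma> * (q u z * q z v)\<close>. A zero denominator occurs only when
    \<open>m = 0\<close>, and then all three coefficients are 0.\<close>
  define \<alpha> \<beta> \<gamma> where "\<alpha> = m / a" and "\<beta> = m / b" and "\<gamma> = m / (a * b)"
  have coef: "0 \<le> \<gamma>" "\<alpha> \<le> 1" "\<beta> \<le> 1" "\<gamma> * a = \<beta>" "\<gamma> * b = \<alpha>" "\<alpha> * a = m" "\<beta> * b = m"
    using m by (auto simp: \<alpha>_def \<beta>_def \<gamma>_def divide_le_eq_1 zero_le_divide_iff)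
  define q' where "q' = (\<lambda>u v. if u = z then (if v = z then q z z + m else (1 - \<alpha>) * q z v)
      else if v = z then (1 - \<beta>) * q u z else q u v + \<gamma> * (q u z * q z v))"
  have q'_simps: "q' z z = q z z + m" "\<And>v. v \<in> ?S \<Longrightarrow> q' z v = (1 - \<alpha>) * q z v"
    "\<And>u. u \<in> ?S \<Longrightarrow> q' u z = (1 - \<beta>) * q u z"
    "\<And>u v. u \<in> ?S \<Longrightarrow> v \<in> ?S \<Longrightarrow> q' u v = q u v + \<gamma> * (q u z * q z v)"
    by (auto simp: q'_def)
  have "discrete_coupling S S p p' q'"
    unfolding discrete_coupling_def
  proof (intro conjI allI ballI)
    show "0 \<le> q' u v" for u v
      using coef nonneg m by (auto simp: q'_def)
  next
    fix u assume u: "u \<in> S"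
    show "(\<Sum>v\<in>S. q' u v) = p u"
    proof (cases "u = z")
      case True
      then have "(\<Sum>v\<in>S. q' u v) = q z z + m + (1 - \<alpha>) * a"
        by (simp add: split[of "q' z"] q'_simps sum_distrib_left[symmetric] a)
      then show ?thesis using coef True by (simp add: algebra_simps a_def)
    next
      case False
      then have "(\<Sum>v\<in>S. q' u v) = (1 - \<beta>) * q u z + ((\<Sum>v\<in>?S. q u v) + \<gamma> * (q u z * a))"
        using u by (simp add: split[of "q' u"] q'_simps sum.distrib sum_distrib_left[symmetric] a)
      also have "\<dots> = q u z + (\<Sum>v\<in>?S. q u v)"
        using coef(4) by (simp add: algebra_simps)
      finally show ?thesis using row[OF u] split[of "q u"] by simp
    qed
  next
    fix v assume v: "v \<in> S"
    show "(\<Sum>u\<in>S. q' u v) = p' v"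
    proof (cases "v = z")
      case True
      then have "(\<Sum>u\<in>S. q' u v) = q z z + m + (1 - \<beta>) * b"
        by (simp add: split[of "\<lambda>u. q' u z"] q'_simps sum_distrib_left[symmetric] b)
      then show ?thesis using coef True by (simp add: algebra_simps b_def)
    next
      case False
      then have "(\<Sum>u\<in>S. q' u v) = (1 - \<alpha>) * q z v + ((\<Sum>u\<in>?S. q u v) + \<gamma> * (b * q z v))"
        using v by (simp add: split[of "\<lambda>u. q' u v"] q'_simps sum.distrib
            sum_distrib_left[symmetric] sum_distrib_right[symmetric] b)
      also have "\<dots> = q z v + (\<Sum>u\<in>?S. q u v)"
        using coef(5) by (simp add: algebra_simps)
      finally show ?thesis using col[OF v] split[of "\<lambda>u. q u v"] by simp
    qed
  qed
  moreover have "min (p z) (p' z) \<le> q' z z"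
    by (simp add: q'_simps m_def a_def b_def)
  moreover have "q y y \<le> q' y y" for y
    using m coef nonneg by (auto simp: q'_def)
  moreover have "(\<Sum>u\<in>S. \<Sum>v\<in>S. q' u v * c u v) \<le> (\<Sum>u\<in>S. \<Sum>v\<in>S. q u v * c u v)"
    if "c \<in> \<C>" for c
  proof -
    have c: "c z z = 0" "\<And>u v. c u v \<le> c u z + c z v" using cost[OF that] by auto
    have four: "(\<Sum>u\<in>S. \<Sum>v\<in>S. f u v * c u v)
        = (\<Sum>v\<in>?S. f z v * c z v) + (\<Sum>u\<in>?S. f u z * c u z) + (\<Sum>u\<in>?S. \<Sum>v\<in>?S. f u v * c u v)"
      for f :: "_ \<Rightarrow> _ \<Rightarrow> real"
    proof -
      have "(\<Sum>u\<in>S. \<Sum>v\<in>S. f u v * c u v) = (\<Sum>u\<in>S. f u z * c u z + (\<Sum>v\<in>?S. f u v * c u v))"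
        by (intro sum.cong refl split)
      also have "\<dots> = f z z * c z z + (\<Sum>v\<in>?S. f z v * c z v)
          + (\<Sum>u\<in>?S. f u z * c u z + (\<Sum>v\<in>?S. f u v * c u v))"
        by (rule split)
      finally show ?thesis using c(1) by (simp add: sum.distrib)
    qed
    let ?A = "\<Sum>v\<in>?S. q z v * c z v" and ?B = "\<Sum>u\<in>?S. q u z * c u z"
    have "(\<Sum>u\<in>?S. \<Sum>v\<in>?S. q u z * q z v * c u v)
        \<le> (\<Sum>u\<in>?S. \<Sum>v\<in>?S. q u z * c u z * q z v + q u z * (q z v * c z v))"
    proof (intro sum_mono)
      fix u v
      have "q u z * q z v * c u v \<le> q u z * q z v * (c u z + c z v)"
        using nonneg c(2) by (intro mult_left_mono mult_nonneg_nonneg) auto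
      then show "q u z * q z v * c u v \<le> q u z * c u z * q z v + q u z * (q z v * c z v)"
        by (simp add: algebra_simps)
    qed
    also have "\<dots> = ?B * a + b * ?A"
      by (simp add: sum.distrib sum_distrib_left[symmetric] sum_distrib_right[symmetric] a b)
    finally have glue: "\<gamma> * (\<Sum>u\<in>?S. \<Sum>v\<in>?S. q u z * q z v * c u v) \<le> \<gamma> * (?B * a + b * ?A)"
      using coef(1) by (rule mult_left_mono)
    have "(\<Sum>u\<in>S. \<Sum>v\<in>S. q' u v * c u v) = (1 - \<alpha>) * ?A + (1 - \<beta>) * ?B
        + ((\<Sum>u\<in>?S. \<Sum>v\<in>?S. q u v * c u v) + \<gamma> * (\<Sum>u\<in>?S. \<Sum>v\<in>?S. q u z * q z v * c u v))"
      unfolding four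
      by (simp add: q'_simps sum_distrib_left sum.distrib distrib_right mult.assoc)
    also have "\<dots> \<le> (1 - \<alpha>) * ?A + (1 - \<beta>) * ?B
        + ((\<Sum>u\<in>?S. \<Sum>v\<in>?S. q u v * c u v) + \<gamma> * (?B * a + b * ?A))"
      using glue by simp
    also have "\<gamma> * (?B * a + b * ?A) = (\<gamma> * a) * ?B + (\<gamma> * b) * ?A"
      by (simp add: algebra_simps)
    also have "\<dots> = \<beta> * ?B + \<alpha> * ?A" by (simp only: coef)
    finally show ?thesis unfolding four by (simp add: algebra_simps)
  qed
  ultimately show ?thesis by (intro exI[of _ q']) auto
qed

text \<open>Diagonal entries are saturated one after another; a later merge neither lowers an entry
  saturated before nor raises a cost.\<close>

lemma discrete_coupling_maximal:
  assumes "finite S" and q: "discrete_coupling S S p p' q"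
    and cost: "\<And>c u v z. c \<in> \<C> \<Longrightarrow> c z z = 0 \<and> c u v \<le> c u z + c z v"
  shows "\<exists>q'. discrete_coupling S S p p' q' \<and> (\<forall>z\<in>S. min (p z) (p' z) \<le> q' z z) \<and>
    (\<forall>c\<in>\<C>. (\<Sum>u\<in>S. \<Sum>v\<in>S. q' u v * c u v) \<le> (\<Sum>u\<in>S. \<Sum>v\<in>S. q u v * (c u v :: real)))"
proof -
  have "\<exists>q'. discrete_coupling S S p p' q' \<and> (\<forall>z\<in>Z. min (p z) (p' z) \<le> q' z z) \<and>
    (\<forall>c\<in>\<C>. (\<Sum>u\<in>S. \<Sum>v\<in>S. q' u v * c u v) \<le> (\<Sum>u\<in>S. \<Sum>v\<in>S. q u v * c u v))" if "Z \<subseteq> S" for Z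
    using finite_subset[OF that assms(1)] that
  proof (induction Z rule: finite_induct)
    case empty
    then show ?case using q by auto
  next
    case (insert z Z)
    then obtain r where r: "discrete_coupling S S p p' r" "\<forall>z\<in>Z. min (p z) (p' z) \<le> r z z"
      "\<forall>c\<in>\<C>. (\<Sum>u\<in>S. \<Sum>v\<in>S. r u v * c u v) \<le> (\<Sum>u\<in>S. \<Sum>v\<in>S. q u v * c u v)" by auto
    from discrete_coupling_merge[OF assms(1) _ r(1), of z \<C>] insert.prems cost
    obtain q' where "discrete_coupling S S p p' q'" "min (p z) (p' z) \<le> q' z z" "\<forall>y. r y y \<le> q' y y"
      "\<forall>c\<in>\<C>. (\<Sum>u\<in>S. \<Sum>v\<in>S. q' u v * c u v) \<le> (\<Sum>u\<in>S. \<Sum>v\<in>S. r u v * c u v)" by auto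
    with r show ?case by (intro exI[of _ q']) (auto intro: order_trans)
  qed
  then show ?thesis by blast
qed

section \<open>Limits of finitely supported laws on sequences\<close>

lemma bounded_sequence_pointwise_subsequence:
  fixes f :: "nat \<Rightarrow> 'a::countable \<Rightarrow> real"
  assumes "\<And>n x. f n x \<in> {0..1}"
  shows "\<exists>g r. strict_mono (r :: nat \<Rightarrow> nat) \<and> (\<forall>x. (\<lambda>n. f (r n) x) \<longlonglongrightarrow> g x)"
proof -
  \<comment> \<open>Tychonoff's theorem; countability of the index type makes the product
    metrizable, so compactness gives convergent subsequences.\<close>
  have "compactin (product_topology (\<lambda>_. euclidean) UNIV) (Pi\<^sub>E (UNIV :: 'a set) (\<lambda>_. {0..1::real}))"
    by (simp add: compactin_PiE)
  then have "compact (Pi\<^sub>E (UNIV :: 'a set) (\<lambda>_. {0..1::real}))"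
    by (simp add: euclidean_product_topology)
  then have "seq_compact (Pi\<^sub>E (UNIV :: 'a set) (\<lambda>_. {0..1::real}))"
    by (rule compact_imp_seq_compact)
  moreover have "\<forall>n. f n \<in> Pi\<^sub>E UNIV (\<lambda>_. {0..1})" using assms by auto
  ultimately obtain g r where r: "strict_mono r" "(f \<circ> r) \<longlonglongrightarrow> g"
    by (rule seq_compactE)
  have "(\<lambda>n. f (r n) x) \<longlonglongrightarrow> g x" for x
  proof -
    have "isCont (\<lambda>h :: 'a \<Rightarrow> real. h x) g"
      using continuous_on_product_coordinates[of x] continuous_on_eq_continuous_at[OF open_UNIV]
      by blast
    from isCont_tendsto_compose[OF this r(2)] show ?thesis by (simp add: o_def)
  qed
  with r(1) show ?thesis by blast
qed

text \<open>The ratios \<open>f (l @ [s]) / f l\<close> are transition probabilities, and the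
  Ionescu-Tulcea theorem assembles them into a measure with the prescribed cylinder weights.\<close>

lemma cylinder_extension:
  fixes f :: "'a::finite list \<Rightarrow> real"
  assumes nonneg: "\<And>l. 0 \<le> f l" and one: "f [] = 1"
    and consistent: "\<And>l. (\<Sum>s\<in>UNIV. f (l @ [s])) = f l"
  shows "\<exists>Q. prob_space Q \<and> sets Q = sets (PiM UNIV (\<lambda>_::nat. count_space (UNIV :: 'a set))) \<and>
    (\<forall>n x. measure Q {s. \<forall>i<n. s i = x i} = f (map x [0..<n]))"
proof -
  let ?M = "\<lambda>_::nat. count_space (UNIV :: 'a set)"
  \<comment> \<open>After a word of weight 0 a point mass at \<open>undefined\<close> serves as
    default, so that \<open>g l\<close> is always a probability vector.\<close>
  define g where "g = (\<lambda>l s. if f l = 0 then (if s = undefined then 1 else 0) else f (l @ [s]) / f l)"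
  have g: "0 \<le> g l s" "(\<Sum>s\<in>UNIV. g l s) = 1" for l s
    using nonneg consistent[of l] by (cases "f l = 0"; simp add: g_def sum_divide_distrib[symmetric])+
  define K where "K = (\<lambda>l. embed_pmf (g l))"
  have K: "pmf (K l) s = g l s" for l s
    unfolding K_def using g(1)[of l] g(2)[of l]
    by (intro pmf_embed_pmf) (auto simp: nn_integral_count_space_finite sum_ennreal)
  \<comment> \<open>Words of weight 0 are covered as well: by consistency their extensions have
    weight 0.\<close>
  have fK: "f l * pmf (K l) s = f (l @ [s])" for l s
  proof (cases "f l = 0")
    case True
    then have "f (l @ [s]) \<le> 0"
      using consistent[of l] member_le_sum[of s UNIV "\<lambda>s. f (l @ [s])"] nonneg by simp
    then show ?thesis using True nonneg[of "l @ [s]"] by simp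
  next
    case False
    then show ?thesis by (simp add: K g_def)
  qed
  have PiM: "PiM {0..<n} ?M = count_space (Pi\<^sub>E {0..<n} (\<lambda>_. UNIV))" for n
    by (rule count_space_PiM_finite) auto
  interpret Ionescu_Tulcea "\<lambda>n \<omega>. measure_pmf (K (map \<omega> [0..<n]))" ?M
  proof
    fix i
    show "(\<lambda>\<omega>. measure_pmf (K (map \<omega> [0..<i]))) \<in> PiM {0..<i} ?M \<rightarrow>\<^sub>M subprob_algebra (count_space UNIV)"
      unfolding PiM by (simp add: measurable_count_space_eq1 measure_pmf_in_subprob_algebra)
  qed
  let ?u = "\<lambda>_::nat. undefined :: 'a"
  have u: "?u \<in> space (PiM {0..<0} ?M)" by (simp add: space_PiM)
  have C: "emeasure (C 0 n ?u) {restrict x {0..<n}} = f (map x [0..<n])" for n x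
  proof (induction n)
    case 0
    have "restrict x {} = ?u" by auto
    then show ?case using one by (simp add: PiM_empty)
  next
    case (Suc n)
    let ?x = "restrict x {0..<Suc n}" and ?y = "restrict x {0..<n}"
    have "emeasure (C 0 (Suc n) ?u) {?x} = (\<integral>\<^sup>+\<omega>. emeasure (eP n \<omega>) {?x} \<partial>C 0 n ?u)"
    proof -
      have "eP n \<in> C 0 n ?u \<rightarrow>\<^sub>M subprob_algebra (PiM {0..<Suc n} ?M)"
        unfolding measurable_cong_sets[OF sets_C[OF u, of n] refl]
        by (simp only: add_0 measurable_eP)
      moreover have "space (C 0 n ?u) \<noteq> {}" by (rule prob_space.not_empty[OF prob_space_C[OF u]])
      moreover have "{?x} \<in> sets (PiM {0..<Suc n} ?M)" unfolding PiM by auto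
      ultimately show ?thesis by (simp add: emeasure_bind)
    qed
    also have "\<dots> = (\<integral>\<^sup>+\<omega>. ennreal (pmf (K (map x [0..<n])) (x n)) * indicator {?y} \<omega> \<partial>C 0 n ?u)"
    proof (rule nn_integral_cong)
      fix \<omega> assume "\<omega> \<in> space (C 0 n ?u)"
      then have \<omega>: "\<omega> \<in> space (PiM {0..<n} ?M)" using space_C[OF u] by simp
      have "emeasure (eP n \<omega>) {?x} = emeasure (measure_pmf (K (map \<omega> [0..<n]))) ((\<lambda>s. fun_upd \<omega> n s) -` {?x})"
        using emeasure_eP[OF \<omega>, of "{?x}"] by (simp add: PiM)
      also have "(\<lambda>s. fun_upd \<omega> n s) -` {?x} = (if \<omega> = ?y then {x n} else {})"
      proof -
        have ext: "\<omega> i = undefined" if "n \<le> i" for i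
          using \<omega> that by (auto simp: space_PiM PiE_iff extensional_def)
        have "fun_upd \<omega> n s = ?x \<longleftrightarrow> \<omega> = ?y \<and> s = x n" for s
        proof
          assume *: "fun_upd \<omega> n s = ?x"
          then have "fun_upd \<omega> n s i = ?x i" for i by simp
          from this[of n] have "s = x n" by simp
          moreover have "\<omega> i = ?y i" for i
            using \<open>\<And>i. fun_upd \<omega> n s i = ?x i\<close>[of i] ext[of i] by (cases "i < n") (auto split: if_splits)
          ultimately show "\<omega> = ?y \<and> s = x n" by blast
        next
          assume *: "\<omega> = ?y \<and> s = x n"
          show "fun_upd \<omega> n s = ?x"
          proof
            fix i show "fun_upd \<omega> n s i = ?x i"
              using * by (cases "i = n") (simp_all add: less_Suc_eq)
          qed
        qed
        then show ?thesis by (simp add: set_eq_iff)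
      qed
      finally have eP: "emeasure (eP n \<omega>) {?x}
          = emeasure (measure_pmf (K (map \<omega> [0..<n]))) (if \<omega> = ?y then {x n} else {})" .
      show "emeasure (eP n \<omega>) {?x}
          = ennreal (pmf (K (map x [0..<n])) (x n)) * indicator {?y} \<omega>"
      proof (cases "\<omega> = ?y")
        case True
        then have map: "map \<omega> [0..<n] = map x [0..<n]" by simp
        show ?thesis
          unfolding eP if_P[OF True] map emeasure_pmf_single by (simp add: True)
      next
        case False
        then show ?thesis unfolding eP if_not_P[OF False] by simp
      qed
    qed
    also have "\<dots> = ennreal (pmf (K (map x [0..<n])) (x n)) * emeasure (C 0 n ?u) {?y}"
      by (subst nn_integral_cmult_indicator) (auto simp: sets_C[OF u] PiM)
    also have "\<dots> = ennreal (f (map x [0..<Suc n]))"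
      unfolding Suc.IH using nonneg by (simp add: ennreal_mult'[symmetric] fK mult.commute)
    finally show ?case .
  qed
  have lim: "emeasure PF.lim {s. \<forall>i<n. s i = x i} = f (map x [0..<n])" for n x
  proof -
    have "{s. \<forall>i<n. s i = x i} = PF.emb UNIV {0..<n} {restrict x {0..<n}}"
    proof -
      have "restrict s {0..<n} = restrict x {0..<n} \<longleftrightarrow> (\<forall>i<n. s i = x i)" for s
      proof (intro iffI allI impI)
        fix i assume "restrict s {0..<n} = restrict x {0..<n}" "i < n"
        from fun_cong[OF this(1), of i] this(2) show "s i = x i" by simp
      qed (auto simp: restrict_def)
      then show ?thesis by (auto simp: prod_emb_def)
    qed
    also have "emeasure PF.lim \<dots> = emeasure (CI {0..<n}) {restrict x {0..<n}}"
      by (rule lim) (auto simp: PiM)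
    also have "\<dots> = emeasure (C 0 n ?u) (PF.emb {0..<n} {0..<n} {restrict x {0..<n}})"
      by (rule emeasure_CI) (auto simp: PiM)
    also have "PF.emb {0..<n} {0..<n} {restrict x {0..<n}} = {restrict x {0..<n}}"
      by (rule prod_emb_id) (auto)
    finally show ?thesis by (simp add: C)
  qed
  have "prob_space PF.lim"
    using lim[of 0] one by (intro prob_spaceI) (simp add: space_PiM)
  moreover have "measure PF.lim {s. \<forall>i<n. s i = x i} = f (map x [0..<n])" for n x
    using nonneg by (simp add: measure_def lim)
  ultimately show ?thesis
    by (intro exI[of _ PF.lim]) simp
qed

text \<open>Cylinders over initial segments of the enumeration are nested or disjoint, so together
  with the empty set they form an intersection-stable generator.\<close>

lemma spin_measure_eqI:
  fixes M N :: "'d::finite config measure" and \<Gamma> :: "'d site \<Rightarrow> nat"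
  assumes "bij \<Gamma>" "prob_space M" "prob_space N"
    and sets: "sets M = sets spin_space" "sets N = sets spin_space"
    and eq: "\<And>n \<tau>. measure M (cylinder {y. \<Gamma> y < n} \<tau>) = measure N (cylinder {y. \<Gamma> y < n} \<tau>)"
  shows "M = N"
proof -
  interpret M: prob_space M by fact
  interpret N: prob_space N by fact
  define E where "E = insert {} {cylinder {y. \<Gamma> y < n} \<tau> | n \<tau>. True}"
  have fin: "finite {y. \<Gamma> y < n}" for n
    using finite_vimageI[of "{..<n}" \<Gamma>] assms(1) by (simp add: bij_is_inj vimage_def)
  have inter: "cylinder {y. \<Gamma> y < n} \<tau> \<inter> cylinder {y. \<Gamma> y < m} \<tau>' \<in> E" if "n \<le> m" for n m \<tau> \<tau>'
  proof (cases "\<forall>y. \<Gamma> y < n \<longrightarrow> \<tau> y = \<tau>' y")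
    case True
    then have "cylinder {y. \<Gamma> y < n} \<tau> \<inter> cylinder {y. \<Gamma> y < m} \<tau>' = cylinder {y. \<Gamma> y < m} \<tau>'"
      using that by (auto simp: cylinder_def)
    then show ?thesis by (auto simp: E_def)
  next
    case False
    then obtain y where y: "\<Gamma> y < n" "\<tau> y \<noteq> \<tau>' y" by blast
    then have "\<Gamma> y < m" using that by simp
    note y = y this
    then have "\<omega> \<notin> cylinder {y. \<Gamma> y < m} \<tau>'" if "\<omega> \<in> cylinder {y. \<Gamma> y < n} \<tau>" for \<omega>
      using that unfolding cylinder_def by (metis (mono_tags, lifting) mem_Collect_eq)
    then have "cylinder {y. \<Gamma> y < n} \<tau> \<inter> cylinder {y. \<Gamma> y < m} \<tau>' = {}" by blast
    then show ?thesis by (auto simp: E_def)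
  qed
  have sub: "E \<subseteq> sets spin_space"
    using fin cylinder_in_spin_space by (auto simp: E_def)
  have gen: "sets spin_space = sigma_sets UNIV E"
  proof
    show "sigma_sets UNIV E \<subseteq> sets spin_space"
      using sub sets.sigma_sets_subset[of E spin_space] by simp
    have "{\<omega>. \<omega> i \<in> A} \<in> sigma_sets UNIV E" for i :: "'d site" and A
    proof -
      define X where "X = {y. \<Gamma> y < Suc (\<Gamma> i)}"
      let ?T = "{\<tau> \<in> configs X (\<lambda>_. False). \<tau> i \<in> A}"
      have "{\<omega>. \<omega> i \<in> A} = (\<Union>\<tau>\<in>?T. cylinder X \<tau>)"
      proof (intro set_eqI iffI)
        fix \<omega> assume "\<omega> \<in> {\<omega>. \<omega> i \<in> A}"
        then show "\<omega> \<in> (\<Union>\<tau>\<in>?T. cylinder X \<tau>)"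
          by (intro UN_I[of "override_on (\<lambda>_. False) \<omega> X"])
             (auto simp: configs_def cylinder_def X_def override_on_def)
      qed (auto simp: cylinder_def X_def)
      moreover have "countable ?T"
        using finite_configs[OF fin, of "Suc (\<Gamma> i)"] by (auto simp: X_def intro: countable_finite)
      then have "\<Union> (cylinder X ` ?T) \<in> sigma_sets UNIV E"
        by (intro sigma_sets_UNION countable_image) (auto intro!: sigma_sets.Basic simp: E_def X_def)
      ultimately show ?thesis by simp
    qed
    then have "{{\<omega> \<in> \<Pi>\<^sub>E i\<in>UNIV. space (count_space UNIV). \<omega> i \<in> A} | i A. i \<in> UNIV \<and> A \<in> sets (count_space UNIV)}
        \<subseteq> sigma_sets UNIV E"
      by auto
    from sigma_sets_mono[OF this] show "sets spin_space \<subseteq> sigma_sets UNIV E"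
      unfolding spin_space_def sets_PiM_single by (simp add: PiE_UNIV_domain)
  qed
  show ?thesis
  proof (rule measure_eqI_generator_eq[where E = E and \<Omega> = UNIV and A = "\<lambda>_. UNIV"])
    show "Int_stable E"
      unfolding Int_stable_def
    proof (intro ballI)
      fix a b assume "a \<in> E" "b \<in> E"
      show "a \<inter> b \<in> E"
      proof (cases "a = {} \<or> b = {}")
        case True
        then show ?thesis by (auto simp: E_def)
      next
        case False
        with \<open>a \<in> E\<close> \<open>b \<in> E\<close> obtain n \<tau> m \<tau>' where
          "a = cylinder {y. \<Gamma> y < n} \<tau>" "b = cylinder {y. \<Gamma> y < m} \<tau>'" by (auto simp: E_def)
        then show ?thesis
          using inter[of n m \<tau> \<tau>'] inter[of m n \<tau>' \<tau>] by (cases "n \<le> m") (auto simp: Int_commute)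
      qed
    qed
    show "emeasure M A = emeasure N A" if "A \<in> E" for A
      using that eq by (auto simp: E_def M.emeasure_eq_measure N.emeasure_eq_measure)
    have "cylinder {y. \<Gamma> y < 0} (\<lambda>_. False) \<in> E" unfolding E_def by blast
    then show "range (\<lambda>_. UNIV) \<subseteq> E" by (auto simp: cylinder_def)
  qed (use gen sets M.emeasure_eq_measure in auto)
qed

lemma finite_words: "finite {l :: 'a::finite list. length l = n}"
  using finite_lists_length_eq[of "UNIV :: 'a set" n] by simp

text \<open>Regroups a weighted family according to the words of length \<open>n\<close>; each
  member spells exactly one of them.\<close>

lemma sum_word_weights:
  fixes c :: "'b \<Rightarrow> real" and h :: "'b \<Rightarrow> nat \<Rightarrow> 'a::finite"
  shows "(\<Sum>l\<in>{l. length l = n \<and> G l}. \<Sum>b\<in>B. c b * of_bool (map (h b) [0..<length l] = l))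
    = (\<Sum>b\<in>B. c b * of_bool (G (map (h b) [0..<n])))"
proof -
  have fin: "finite {l :: 'a list. length l = n \<and> G l}"
    by (rule finite_subset[OF _ finite_words[of n]]) auto
  have "(\<Sum>l\<in>{l. length l = n \<and> G l}. c b * of_bool (map (h b) [0..<length l] = l))
      = c b * of_bool (G (map (h b) [0..<n]))" for b
  proof -
    have "(\<Sum>l\<in>{l. length l = n \<and> G l}. c b * of_bool (map (h b) [0..<length l] = l))
        = (\<Sum>l\<in>{l. length l = n \<and> G l}. if map (h b) [0..<n] = l then c b else 0)"
      by (intro sum.cong) auto
    then show ?thesis using fin by (simp add: sum.delta')
  qed
  then show ?thesis by (subst sum.swap) simp
qed

lemma word_event_measure:
  fixes Q :: "(nat \<Rightarrow> 'a::finite) measure"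
  assumes "prob_space Q" and sets: "sets Q = sets (PiM UNIV (\<lambda>_::nat. count_space UNIV))"
    and f: "\<And>n x. measure Q {s. \<forall>i<n. s i = x i} = f (map x [0..<n])"
  shows "{s. G (map s [0..<n])} \<in> sets Q"
    and "measure Q {s. G (map s [0..<n])} = (\<Sum>l\<in>{l. length l = n \<and> G l}. f l)"
proof -
  interpret prob_space Q by fact
  let ?C = "\<lambda>l :: 'a list. {s. \<forall>i<n. s i = l ! i}"
  have meas: "?C l \<in> sets Q" for l
  proof -
    have "?C l = prod_emb UNIV (\<lambda>_. count_space UNIV) {..<n} (Pi\<^sub>E {..<n} (\<lambda>i. {l ! i}))"
      by (intro set_eqI) (simp add: prod_emb_def PiE_iff restrict_def extensional_def Ball_def)
    also have "\<dots> \<in> sets Q" unfolding sets by (intro sets_PiM_I) auto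
    finally show ?thesis .
  qed
  let ?W = "{l. length l = n \<and> G l}"
  have fin: "finite ?W" by (rule finite_subset[OF _ finite_words[of n]]) auto
  have map_nth': "map s [0..<n] = l \<longleftrightarrow> (\<forall>i<n. s i = l ! i)" if "length l = n" for s l
    using that by (auto simp: list_eq_iff_nth_eq)
  have eq: "{s. G (map s [0..<n])} = (\<Union>l\<in>?W. ?C l)"
  proof (intro set_eqI iffI)
    fix s assume "s \<in> {s. G (map s [0..<n])}"
    then show "s \<in> (\<Union>l\<in>?W. ?C l)" by (intro UN_I[of "map s [0..<n]"]) auto
  next
    fix s assume "s \<in> (\<Union>l\<in>?W. ?C l)"
    then obtain l where "length l = n" "G l" "\<forall>i<n. s i = l ! i" by auto
    then show "s \<in> {s. G (map s [0..<n])}" using map_nth'[of l s] by simp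
  qed
  show "{s. G (map s [0..<n])} \<in> sets Q"
    unfolding eq using fin meas by (intro sets.finite_UN) auto
  have "prob {s. G (map s [0..<n])} = (\<Sum>l\<in>?W. prob (?C l))"
    unfolding eq
  proof (intro finite_measure_finite_Union fin)
    show "disjoint_family_on ?C ?W"
      unfolding disjoint_family_on_def
    proof (intro ballI impI)
      fix l l' assume "l \<in> ?W" "l' \<in> ?W" "l \<noteq> l'"
      then obtain i where "i < n" "l ! i \<noteq> l' ! i" by (auto simp: list_eq_iff_nth_eq)
      then show "?C l \<inter> ?C l' = {}" by auto
    qed
  qed (use meas in auto)
  also have "\<dots> = (\<Sum>l\<in>?W. f l)"
  proof (intro sum.cong refl)
    fix l assume "l \<in> ?W"
    then have "map ((!) l) [0..<n] = l" by (auto intro: map_nth)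
    then show "prob (?C l) = f l" using f[of n "(!) l"] by simp
  qed
  finally show "prob {s. G (map s [0..<n])} = (\<Sum>l\<in>?W. f l)" .
qed

text \<open>Along one subsequence the weights of all finite words converge, and with them the
  probabilities of events determined by the first \<open>n\<close> letters. The alphabet is finite,
  so consistency of the weights passes to the limit.\<close>

lemma sequence_limit_law:
  fixes c :: "nat \<Rightarrow> 'b \<Rightarrow> real" and h :: "nat \<Rightarrow> 'b \<Rightarrow> nat \<Rightarrow> 'a::finite"
  assumes "\<And>N b. 0 \<le> c N b" "\<And>N. (\<Sum>b\<in>B N. c N b) = 1"
  shows "\<exists>Q r. prob_space Q \<and> sets Q = sets (PiM UNIV (\<lambda>_::nat. count_space (UNIV :: 'a set))) \<and>
    strict_mono r \<and> (\<forall>n G. {s. G (map s [0..<n])} \<in> sets Q \<and>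
      (\<lambda>N. \<Sum>b\<in>B (r N). c (r N) b * of_bool (G (map (h (r N) b) [0..<n])))
        \<longlonglongrightarrow> measure Q {s. G (map s [0..<n])})"
proof -
  define F where "F = (\<lambda>N l. \<Sum>b\<in>B N. c N b * of_bool (map (h N b) [0..<length l] = l))"
  have F_nonneg: "0 \<le> F N l" for N l
    unfolding F_def using assms by (intro sum_nonneg) auto
  have F_empty: "F N [] = 1" for N using assms by (simp add: F_def)
  have F_consistent: "(\<Sum>s\<in>UNIV. F N (l @ [s])) = F N l" for N l
  proof -
    have "(\<Sum>s\<in>UNIV. F N (l @ [s]))
        = (\<Sum>b\<in>B N. \<Sum>s\<in>UNIV. if h N b (length l) = s then c N b * of_bool (map (h N b) [0..<length l] = l) else 0)"
      unfolding F_def by (subst sum.swap) (intro sum.cong refl, auto)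
    then show ?thesis by (simp add: F_def)
  qed
  have "F N l \<in> {0..1}" for N l
  proof -
    have "F N l \<le> (\<Sum>b\<in>B N. c N b * 1)"
      unfolding F_def using assms(1) by (intro sum_mono mult_left_mono) auto
    then show ?thesis using F_nonneg assms(2) by simp
  qed
  then obtain f r where r: "strict_mono (r :: nat \<Rightarrow> nat)" and lim: "\<And>l. (\<lambda>N. F (r N) l) \<longlonglongrightarrow> f l"
    using bounded_sequence_pointwise_subsequence[of F] by blast
  have "0 \<le> f l" for l by (rule LIMSEQ_le_const[OF lim]) (use F_nonneg in auto)
  moreover have "f [] = 1" using lim[of "[]"] by (simp add: F_empty LIMSEQ_const_iff)
  moreover have "(\<Sum>s\<in>UNIV. f (l @ [s])) = f l" for l
  proof (rule LIMSEQ_unique)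
    have "(\<lambda>N. \<Sum>s\<in>UNIV. F (r N) (l @ [s])) \<longlonglongrightarrow> (\<Sum>s\<in>UNIV. f (l @ [s]))"
      by (intro tendsto_sum lim)
    then show "(\<lambda>N. F (r N) l) \<longlonglongrightarrow> (\<Sum>s\<in>UNIV. f (l @ [s]))"
      by (simp only: F_consistent)
  qed (rule lim)
  ultimately obtain Q where Q: "prob_space Q"
      "sets Q = sets (PiM UNIV (\<lambda>_::nat. count_space (UNIV :: 'a set)))"
      "\<And>n x. measure Q {s. \<forall>i<n. s i = x i} = f (map x [0..<n])"
    using cylinder_extension[of f] by blast
  note event = word_event_measure[OF Q]
  have "(\<lambda>N. \<Sum>b\<in>B (r N). c (r N) b * of_bool (G (map (h (r N) b) [0..<n])))
      \<longlonglongrightarrow> measure Q {s. G (map s [0..<n])}" for n G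
  proof -
    have "(\<Sum>b\<in>B (r N). c (r N) b * of_bool (G (map (h (r N) b) [0..<n])))
        = (\<Sum>l\<in>{l. length l = n \<and> G l}. F (r N) l)" for N
      unfolding F_def by (rule sum_word_weights[symmetric])
    moreover have "(\<lambda>N. \<Sum>l\<in>{l. length l = n \<and> G l}. F (r N) l) \<longlonglongrightarrow> (\<Sum>l\<in>{l. length l = n \<and> G l}. f l)"
      by (intro tendsto_sum lim)
    ultimately show ?thesis by (simp only: event(2))
  qed
  then show ?thesis using Q r event(1) by blast
qed

section \<open>Couplings of the conditional measures in a finite window\<close>

lemma coupling_prob_space:
  assumes "coupling \<mu> \<nu> Q" "prob_space \<mu>" shows "prob_space Q"
proof -
  have "sets Q = sets (\<mu> \<Otimes>\<^sub>M \<nu>)" "distr Q \<mu> fst = \<mu>"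
    using assms(1) by (auto simp: coupling_def)
  moreover from this have "fst \<in> measurable Q \<mu>"
    using measurable_cong_sets by (metis measurable_fst)
  ultimately show ?thesis using assms(2) prob_space_distrD by metis
qed

context gibbs_field
begin

text \<open>Fixing the past of \<open>x\<close> and the spin at \<open>x\<close> fixes exactly the
  sites of index below \<open>Suc (\<Gamma> x)\<close>, since by injectivity no other site has the
  index of \<open>x\<close>.\<close>

lemma cond_measure_eq:
  assumes "inj \<Gamma>"
  shows "cond_measure \<Gamma> P \<sigma> x s = uniform_measure P (cylinder {y. \<Gamma> y < Suc (\<Gamma> x)} (\<sigma>(x := s)))"
proof -
  have "\<Gamma> y < Suc (\<Gamma> x) \<longleftrightarrow> \<Gamma> y < \<Gamma> x \<or> y = x" for y
    using assms by (auto simp: less_Suc_eq dest: injD)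
  then have "{\<omega>. (\<forall>y. \<Gamma> y < \<Gamma> x \<longrightarrow> \<omega> y = \<sigma> y) \<and> \<omega> x = s}
      = cylinder {y. \<Gamma> y < Suc (\<Gamma> x)} (\<sigma>(x := s))"
    unfolding cylinder_def by (intro set_eqI) (auto simp: fun_upd_def)
  then show ?thesis by (simp add: cond_measure_def)
qed

lemma prob_space_uniform_cylinder:
  "finite Y \<Longrightarrow> prob_space (uniform_measure P (cylinder Y \<eta>))"
  using w_pos[of Y \<eta>] by (intro prob_space_uniform_measure) (auto simp: emeasure_eq_measure)

lemma measure_uniform_cylinder:
  assumes "finite Y" "A \<in> events"
  shows "measure (uniform_measure P (cylinder Y \<eta>)) A = prob (cylinder Y \<eta> \<inter> A) / w Y \<eta>"
  using assms w_pos[of Y \<eta>] cylinder_sets[of Y \<eta>]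
  by (intro measure_uniform_measure) (auto simp: emeasure_eq_measure)

text \<open>Identifies \<kappa> with the law of the window under the conditional measure.\<close>

lemma sum_\<kappa>_cylinder:
  assumes "finite X" "V \<subseteq> X" "Y \<subseteq> X"
  shows "(\<Sum>u\<in>configs V \<eta>. \<kappa> X V \<eta> u * of_bool (\<forall>y\<in>Y. u y = \<tau> y))
    = measure (uniform_measure P (cylinder (X - V) \<eta>)) (cylinder Y \<tau>)"
proof -
  let ?S = "{u \<in> configs V \<eta>. \<forall>y\<in>Y. u y = \<tau> y}"
  have fin: "finite V" "finite Y" using assms finite_subset by auto
  have finS: "finite ?S" using finite_configs[OF fin(1), of \<eta>] by auto
  have union: "cylinder (X - V) \<eta> \<inter> cylinder Y \<tau> = (\<Union>u\<in>?S. cylinder X u)"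
  proof (intro set_eqI iffI)
    fix \<omega> assume \<omega>: "\<omega> \<in> cylinder (X - V) \<eta> \<inter> cylinder Y \<tau>"
    then show "\<omega> \<in> (\<Union>u\<in>?S. cylinder X u)"
      using assms(3)
      by (intro UN_I[of "override_on \<eta> \<omega> V"])
         (auto simp: cylinder_def configs_def override_on_def)
  next
    fix \<omega> assume "\<omega> \<in> (\<Union>u\<in>?S. cylinder X u)"
    then show "\<omega> \<in> cylinder (X - V) \<eta> \<inter> cylinder Y \<tau>"
      using assms(3) by (auto simp: cylinder_def configs_def)
  qed
  have "disjoint_family_on (cylinder X) ?S"
    unfolding disjoint_family_on_def
  proof (intro ballI impI)
    fix u v assume uv: "u \<in> ?S" "v \<in> ?S" "u \<noteq> v"
    then obtain z where "u z \<noteq> v z" by blast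
    moreover from this uv have "z \<in> X" using assms(2) by (auto simp: configs_def)
    ultimately show "cylinder X u \<inter> cylinder X v = {}" by (auto simp: cylinder_def)
  qed
  then have "prob (\<Union>u\<in>?S. cylinder X u) = (\<Sum>u\<in>?S. w X u)"
    using finS assms cylinder_sets by (intro finite_measure_finite_Union) auto
  then have "measure (uniform_measure P (cylinder (X - V) \<eta>)) (cylinder Y \<tau>)
      = (\<Sum>u\<in>?S. \<kappa> X V \<eta> u)"
    using assms fin
    by (simp add: measure_uniform_cylinder cylinder_sets union \<kappa>_def sum_divide_distrib)
  also have "\<dots> = (\<Sum>u\<in>configs V \<eta>. \<kappa> X V \<eta> u * of_bool (\<forall>y\<in>Y. u y = \<tau> y))"
    using finite_configs[OF fin(1)] by (intro sum.mono_neutral_cong_left) auto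
  finally show ?thesis by simp
qed

text \<open>The two configuration spaces differ only in the spin at \<open>x\<close>. Resetting this
  spin identifies them and turns agreement after \<open>x\<close> into the diagonal, so the merging
  argument applies, with one cost for each site of \<open>V\<close>, to the coupling obtained from
  disagreement percolation.\<close>

lemma maximal_window_coupling:
  fixes \<sigma> :: "'d config" and x :: "'d site" and X V :: "'d site set"
  assumes osc: "\<And>y \<sigma> \<sigma>'. \<bar>gibbs_spec U {y} (\<lambda>_. True) \<sigma> - gibbs_spec U {y} (\<lambda>_. True) \<sigma>'\<bar> \<le> q"
    and q: "q \<le> 1" and X: "finite X" and "V \<subseteq> X" "x \<notin> V"
  defines "I \<equiv> {z. \<forall>v. adj z v \<longrightarrow> v \<in> X}"
    and "\<eta> \<equiv> \<sigma>(x := True)" and "\<eta>' \<equiv> \<sigma>(x := False)"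
  shows "\<exists>c. discrete_coupling (configs V \<eta>) (configs V \<eta>') (\<kappa> X V \<eta>) (\<kappa> X V \<eta>') c \<and>
    (\<forall>u\<in>configs V \<eta>. min (\<kappa> X V \<eta> u) (\<kappa> X V \<eta>' (u(x := False))) \<le> c u (u(x := False))) \<and>
    (\<forall>y\<in>V \<inter> I. (\<Sum>u\<in>configs V \<eta>. \<Sum>v\<in>configs V \<eta>'. c u v * of_bool (u y \<noteq> v y))
      \<le> infl_prob adj q (V \<inter> I) ({x} \<union> (V - I)) y)"
proof -
  let ?S = "configs V \<eta>" and ?S' = "configs V \<eta>'"
  have finS: "finite ?S" using assms(4) X by (intro finite_configs) (rule finite_subset)
  have flip: "(\<Sum>v\<in>?S'. f v) = (\<Sum>v\<in>?S. f (v(x := False)))" for f :: "_ \<Rightarrow> real"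
    using assms(5)
    by (intro sum.reindex_bij_witness[of _ "\<lambda>v. v(x := False)" "\<lambda>v. v(x := True)"])
       (auto simp: configs_def \<eta>_def \<eta>'_def fun_eq_iff intro!: arg_cong[where f = f])
  have "\<eta> z = \<eta>' z" if "z \<in> X - V - {x}" for z using that by (simp add: \<eta>_def \<eta>'_def)
  then obtain c where c: "discrete_coupling ?S ?S' (\<kappa> X V \<eta>) (\<kappa> X V \<eta>') c"
    and dis: "\<And>y. y \<in> V \<inter> I \<Longrightarrow> (\<Sum>u\<in>?S. \<Sum>v\<in>?S'. c u v * of_bool (u y \<noteq> v y))
      \<le> infl_prob adj q (V \<inter> I) ({x} \<union> (V - I)) y"
    using disagreement_percolation[OF osc q X assms(4), of "{x}" \<eta> \<eta>'] assms(5)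
    unfolding I_def by auto
  define \<C> :: "('d config \<Rightarrow> 'd config \<Rightarrow> real) set" where
    "\<C> = (\<lambda>y u v. of_bool (u y \<noteq> v y)) ` V"
  have flipped: "discrete_coupling ?S ?S (\<kappa> X V \<eta>) (\<lambda>v. \<kappa> X V \<eta>' (v(x := False))) (\<lambda>u v. c u (v(x := False)))"
    using c assms(5) unfolding discrete_coupling_def flip
    by (auto simp: configs_def \<eta>_def \<eta>'_def)
  have "\<exists>c'. discrete_coupling ?S ?S (\<kappa> X V \<eta>) (\<lambda>v. \<kappa> X V \<eta>' (v(x := False))) c' \<and>
      (\<forall>z\<in>?S. min (\<kappa> X V \<eta> z) (\<kappa> X V \<eta>' (z(x := False))) \<le> c' z z) \<and>
      (\<forall>k\<in>\<C>. (\<Sum>u\<in>?S. \<Sum>v\<in>?S. c' u v * k u v) \<le> (\<Sum>u\<in>?S. \<Sum>v\<in>?S. c u (v(x := False)) * k u v))"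
    by (rule discrete_coupling_maximal[OF finS flipped]) (auto simp: \<C>_def)
  then obtain c' where c': "discrete_coupling ?S ?S (\<kappa> X V \<eta>) (\<lambda>v. \<kappa> X V \<eta>' (v(x := False))) c'"
    and max: "\<forall>z\<in>?S. min (\<kappa> X V \<eta> z) (\<kappa> X V \<eta>' (z(x := False))) \<le> c' z z"
    and cost: "\<forall>k\<in>\<C>. (\<Sum>u\<in>?S. \<Sum>v\<in>?S. c' u v * k u v) \<le> (\<Sum>u\<in>?S. \<Sum>v\<in>?S. c u (v(x := False)) * k u v)"
    by blast
  let ?c = "\<lambda>u v. c' u (v(x := True))"
  have same: "v(x := True) = v" if "v \<in> ?S" for v
    using that assms(5) by (auto simp: configs_def \<eta>_def fun_eq_iff)
  have "discrete_coupling ?S ?S' (\<kappa> X V \<eta>) (\<kappa> X V \<eta>') ?c"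
    unfolding discrete_coupling_def
  proof (intro conjI allI ballI)
    show "0 \<le> ?c u v" for u v using c' by (simp add: discrete_coupling_def)
    show "(\<Sum>v\<in>?S'. ?c u v) = \<kappa> X V \<eta> u" if "u \<in> ?S" for u
      using c' that unfolding flip by (simp add: discrete_coupling_def same)
    fix v assume "v \<in> ?S'"
    then have mem: "v(x := True) \<in> ?S" and restore: "v(x := True, x := False) = v"
      using assms(5) by (auto simp: configs_def \<eta>_def \<eta>'_def fun_eq_iff)
    have "(\<Sum>u\<in>?S. ?c u v) = \<kappa> X V \<eta>' (v(x := True, x := False))"
      using c' mem unfolding discrete_coupling_def by blast
    then show "(\<Sum>u\<in>?S. ?c u v) = \<kappa> X V \<eta>' v" unfolding restore .
  qed
  moreover have "\<forall>u\<in>?S. min (\<kappa> X V \<eta> u) (\<kappa> X V \<eta>' (u(x := False))) \<le> ?c u (u(x := False))"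
    using max by (simp add: same)
  moreover have "(\<Sum>u\<in>?S. \<Sum>v\<in>?S'. ?c u v * of_bool (u y \<noteq> v y))
      \<le> infl_prob adj q (V \<inter> I) ({x} \<union> (V - I)) y" if y: "y \<in> V \<inter> I" for y
  proof -
    have "y \<noteq> x" using y assms(5) by auto
    have "(\<Sum>u\<in>?S. \<Sum>v\<in>?S'. ?c u v * of_bool (u y \<noteq> v y))
        = (\<Sum>u\<in>?S. \<Sum>v\<in>?S. c' u v * of_bool (u y \<noteq> v y))"
      unfolding flip using \<open>y \<noteq> x\<close> by (simp add: same cong: sum.cong)
    also have "\<dots> \<le> (\<Sum>u\<in>?S. \<Sum>v\<in>?S. c u (v(x := False)) * of_bool (u y \<noteq> v y))"
      using cost y by (auto simp: \<C>_def)
    also have "\<dots> = (\<Sum>u\<in>?S. \<Sum>v\<in>?S'. c u v * of_bool (u y \<noteq> v y))"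
      unfolding flip using \<open>y \<noteq> x\<close> by simp
    also have "\<dots> \<le> infl_prob adj q (V \<inter> I) ({x} \<union> (V - I)) y"
      by (rule dis[OF y])
    finally show ?thesis .
  qed
  ultimately show ?thesis by blast
qed

text \<open>No coupling agrees more often than the overlap of the two window laws: agreement in a
  common pattern \<open>u\<close> is at most as likely as \<open>u\<close> under either marginal.
  The window couplings reach this overlap, which is what makes their limit maximal.\<close>

lemma coupling_agree_le:
  fixes \<sigma> :: "'d config" and \<Gamma> :: "'d site \<Rightarrow> nat" and x :: "'d site" and N :: nat
  assumes "inj \<Gamma>" "\<And>n. finite {y. \<Gamma> y < n}"
  defines "\<mu> \<equiv> cond_measure \<Gamma> P \<sigma> x True" and "\<nu> \<equiv> cond_measure \<Gamma> P \<sigma> x False"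
    and "\<eta> \<equiv> \<sigma>(x := True)" and "\<eta>' \<equiv> \<sigma>(x := False)"
  assumes Q: "coupling \<mu> \<nu> Q" and N: "\<Gamma> x < N"
  defines "X \<equiv> {y. \<Gamma> y < N}" and "V \<equiv> {y. \<Gamma> x < \<Gamma> y \<and> \<Gamma> y < N}"
  shows "measure Q {(\<omega>1, \<omega>2). \<forall>y. \<Gamma> x < \<Gamma> y \<longrightarrow> \<omega>1 y = \<omega>2 y}
    \<le> (\<Sum>u\<in>configs V \<eta>. min (\<kappa> X V \<eta> u) (\<kappa> X V \<eta>' (u(x := False))))"
proof -
  have X: "finite X" "V \<subseteq> X" "finite V" using assms(2) finite_subset by (auto simp: X_def V_def)
  have XL: "X - V = {y. \<Gamma> y < Suc (\<Gamma> x)}" using N by (auto simp: X_def V_def)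
  have xL: "x \<notin> V" by (simp add: V_def)
  have \<mu>: "\<mu> = uniform_measure P (cylinder (X - V) \<eta>)" and \<nu>: "\<nu> = uniform_measure P (cylinder (X - V) \<eta>')"
    using assms(1) by (simp_all add: \<mu>_def \<nu>_def \<eta>_def \<eta>'_def XL cond_measure_eq)
  have sets: "sets \<mu> = sets spin_space" "sets \<nu> = sets spin_space"
    by (simp_all add: \<mu> \<nu> sets_P)
  have prob: "prob_space \<mu>" "prob_space \<nu>"
    unfolding \<mu> \<nu> using X by (auto intro: prob_space_uniform_cylinder)
  have setsQ: "sets Q = sets (\<mu> \<Otimes>\<^sub>M \<nu>)" and fst: "distr Q \<mu> fst = \<mu>" and snd: "distr Q \<nu> snd = \<nu>"
    using Q by (auto simp: coupling_def)
  have meas: "fst \<in> measurable Q \<mu>" "snd \<in> measurable Q \<nu>"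
    unfolding measurable_cong_sets[OF setsQ refl] by simp_all
  interpret Q: prob_space Q
    using Q prob(1) by (rule coupling_prob_space)
  have space: "space \<mu> = UNIV" "space \<nu> = UNIV"
    using sets_eq_imp_space_eq sets by (metis space_spin_space)+
  have spaceQ: "space Q = UNIV"
    using sets_eq_imp_space_eq[OF setsQ] space by (simp add: space_pair_measure)
  let ?E = "\<lambda>u. {(\<omega>1, \<omega>2). \<omega>1 \<in> cylinder V u \<and> \<omega>2 \<in> cylinder V u}"
  have E_eq: "?E u = fst -` cylinder V u \<inter> snd -` cylinder V u \<inter> space Q" for u
    using spaceQ by auto
  have cyl: "cylinder V u \<in> sets \<mu>" "cylinder V u \<in> sets \<nu>" for u
    using X cylinder_in_spin_space sets by auto
  have E1: "fst -` cylinder V u \<inter> space Q \<in> Q.events" and E2: "snd -` cylinder V u \<inter> space Q \<in> Q.events" for u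
    using meas cyl by (auto intro: measurable_sets)
  have E: "?E u \<in> Q.events" for u
    unfolding E_eq using sets.Int[OF E1[of u] E2[of u]] by (simp add: Int_ac)
  have \<kappa>: "measure (uniform_measure P (cylinder (X - V) \<zeta>)) (cylinder V u) = \<kappa> X V \<zeta> v"
    if "v \<in> configs V \<zeta>" "\<And>z. z \<in> V \<Longrightarrow> u z = v z" for \<zeta> u v
  proof -
    have "cylinder (X - V) \<zeta> \<inter> cylinder V u = cylinder X v"
      using that X(2) by (auto simp: cylinder_def configs_def)
    then show ?thesis using X by (simp add: measure_uniform_cylinder cylinder_sets \<kappa>_def)
  qed
  have "Q.prob {(\<omega>1, \<omega>2). \<forall>y. \<Gamma> x < \<Gamma> y \<longrightarrow> \<omega>1 y = \<omega>2 y} \<le> Q.prob (\<Union>u\<in>configs V \<eta>. ?E u)"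
  proof (rule Q.finite_measure_mono)
    show "{(\<omega>1, \<omega>2). \<forall>y. \<Gamma> x < \<Gamma> y \<longrightarrow> \<omega>1 y = \<omega>2 y} \<subseteq> (\<Union>u\<in>configs V \<eta>. ?E u)"
    proof clarify
      fix \<omega>1 \<omega>2 assume "\<forall>y. \<Gamma> x < \<Gamma> y \<longrightarrow> \<omega>1 y = (\<omega>2 y :: bool)"
      then show "(\<omega>1, \<omega>2) \<in> (\<Union>u\<in>configs V \<eta>. ?E u)"
        by (intro UN_I[of "override_on \<eta> \<omega>1 V"]) (auto simp: configs_def cylinder_def V_def)
    qed
    show "(\<Union>u\<in>configs V \<eta>. ?E u) \<in> Q.events"
      using E X by (intro sets.finite_UN finite_configs) auto
  qed
  also have "\<dots> \<le> (\<Sum>u\<in>configs V \<eta>. Q.prob (?E u))"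
    using E X by (intro Q.finite_measure_subadditive_finite finite_configs) auto
  also have "\<dots> \<le> (\<Sum>u\<in>configs V \<eta>. min (\<kappa> X V \<eta> u) (\<kappa> X V \<eta>' (u(x := False))))"
  proof (intro sum_mono min.boundedI)
    fix u assume u: "u \<in> configs V \<eta>"
    have "Q.prob (?E u) \<le> Q.prob (fst -` cylinder V u \<inter> space Q)"
      using E1 by (intro Q.finite_measure_mono) (auto simp: spaceQ)
    also have "\<dots> = measure \<mu> (cylinder V u)"
      using measure_distr[OF meas(1) cyl(1)] by (simp add: fst)
    also have "\<dots> = \<kappa> X V \<eta> u" unfolding \<mu> by (rule \<kappa>[OF u refl])
    finally show "Q.prob (?E u) \<le> \<kappa> X V \<eta> u" .
    have "Q.prob (?E u) \<le> Q.prob (snd -` cylinder V u \<inter> space Q)"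
      using E2 by (intro Q.finite_measure_mono) (auto simp: spaceQ)
    also have "\<dots> = measure \<nu> (cylinder V u)"
      using measure_distr[OF meas(2) cyl(2)] by (simp add: snd)
    also have "\<dots> = \<kappa> X V \<eta>' (u(x := False))"
      unfolding \<nu> using u xL by (intro \<kappa>) (auto simp: configs_def \<eta>_def \<eta>'_def)
    finally show "Q.prob (?E u) \<le> \<kappa> X V \<eta>' (u(x := False))" .
  qed
  finally show ?thesis .
qed

end

section \<open>Passage to the infinite lattice\<close>

lemma finite_below:
  assumes "inj (\<Gamma> :: 'a \<Rightarrow> nat)" shows "finite {y. \<Gamma> y < n}"
  using finite_vimageI[OF finite_lessThan assms, of n] by (simp add: vimage_def)

lemma eventually_window:
  assumes "inj (\<Gamma> :: 'a \<Rightarrow> nat)" "finite A"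
  shows "eventually (\<lambda>N. A \<subseteq> {y. \<Gamma> y < N}) sequentially"
proof -
  have "eventually (\<lambda>N. \<Gamma> y < N) sequentially" for y by (rule eventually_gt_at_top)
  then have "eventually (\<lambda>N. \<forall>y\<in>A. \<Gamma> y < N) sequentially"
    using assms(2) by (simp add: eventually_ball_finite_distrib)
  then show ?thesis by (rule eventually_mono) auto
qed

lemma agreement_in_sets:
  "{(\<omega>1, \<omega>2). \<omega>1 y = \<omega>2 y} \<in> sets (spin_space \<Otimes>\<^sub>M (spin_space :: 'd::finite config measure))"
proof -
  have y: "(\<lambda>\<omega>. \<omega> y) \<in> measurable (spin_space :: 'd config measure) (count_space UNIV)"
    unfolding spin_space_def by (rule measurable_component_singleton) simp
  have "{\<omega> \<in> space (spin_space \<Otimes>\<^sub>M spin_space). fst \<omega> y = snd \<omega> y} \<in> sets (spin_space \<Otimes>\<^sub>M (spin_space :: 'd config measure))"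
    using measurable_compose[OF measurable_fst y] measurable_compose[OF measurable_snd y]
    by measurable
  then show ?thesis by (simp add: space_pair_measure case_prod_unfold)
qed

lemma disagreement_in_sets:
  "{(\<omega>1, \<omega>2). \<omega>1 y \<noteq> \<omega>2 y} \<in> sets (spin_space \<Otimes>\<^sub>M (spin_space :: 'd::finite config measure))"
proof -
  have "{(\<omega>1 :: 'd config, \<omega>2). \<omega>1 y \<noteq> \<omega>2 y} = space (spin_space \<Otimes>\<^sub>M spin_space) - {(\<omega>1, \<omega>2). \<omega>1 y = \<omega>2 y}"
    by (auto simp: space_pair_measure)
  then show ?thesis using sets.compl_sets[OF agreement_in_sets[of y]] by simp
qed

context gibbs_field
begin

text \<open>The window couplings are encoded along the enumeration as laws of sequences of spin
  pairs, and a subsequential limit is decoded again. Marginals, maximality and disagreement bounds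
  are all reduced to events involving finitely many letters, whose probabilities converge.\<close>

lemma exists_maximal_coupling:
  fixes \<Gamma> :: "'d site \<Rightarrow> nat" and \<sigma> :: "'d config" and x :: "'d site"
  assumes \<Gamma>: "bij \<Gamma>"
    and osc: "\<And>y \<sigma> \<sigma>'. \<bar>gibbs_spec U {y} (\<lambda>_. True) \<sigma> - gibbs_spec U {y} (\<lambda>_. True) \<sigma>'\<bar> \<le> q"
    and q: "q \<le> 1" and \<phi>: "0 \<le> \<phi>" "\<phi> < 1" and L: "0 < L"
    and decay: "\<And>V A (y :: 'd site) k. finite V \<Longrightarrow> (\<forall>a\<in>A. real k * L < sdist y a)
      \<Longrightarrow> infl_prob adj q V A y \<le> q * \<phi> ^ k"
  shows "\<exists>Q. maximal_coupling \<Gamma> P \<sigma> x Q \<and>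
    (\<forall>y k. real k * L < sdist y x \<longrightarrow> measure Q {(\<omega>1, \<omega>2). \<omega>1 y \<noteq> \<omega>2 y} \<le> q * \<phi> ^ k)"
proof -
  have inj: "inj \<Gamma>" using \<Gamma> by (rule bij_is_inj)
  note below = finite_below[OF inj]
  have q: "0 \<le> q" "q \<le> 1" using osc[of 0 "\<lambda>_. True" "\<lambda>_. True"] q by auto
  define e where "e = inv \<Gamma>"
  have e: "\<Gamma> (e n) = n" "e (\<Gamma> y) = y" for n y
    using \<Gamma> by (simp_all add: e_def bij_is_inj bij_is_surj surj_f_inv_f)
  have sites: "(\<forall>y. \<Gamma> y < n \<longrightarrow> F y) \<longleftrightarrow> (\<forall>i<n. F (e i))" for n F
    using e by metis
  define X where "X = (\<lambda>N. {y. \<Gamma> y < N})"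
  define V where "V = (\<lambda>N. {y. \<Gamma> x < \<Gamma> y \<and> \<Gamma> y < N})"
  define I where "I = (\<lambda>N. {z :: 'd site. \<forall>v. adj z v \<longrightarrow> v \<in> X N})"
  define \<eta> where "\<eta> = \<sigma>(x := True)"
  define \<eta>' where "\<eta>' = \<sigma>(x := False)"
  define S where "S = (\<lambda>N. configs (V N) \<eta>)"
  define S' where "S' = (\<lambda>N. configs (V N) \<eta>')"
  have XL: "finite (X N)" "V N \<subseteq> X N" "finite (V N)" "x \<notin> V N" for N
    using below finite_subset[OF _ below[of N]] by (auto simp: X_def V_def)
  have diff: "X N - V N = {y. \<Gamma> y < Suc (\<Gamma> x)}" if "\<Gamma> x < N" for N
    using that by (auto simp: X_def V_def)
  have finS: "finite (S N)" "finite (S' N)" for N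
    unfolding S_def S'_def using XL by (auto intro: finite_configs)
  define \<mu> where "\<mu> = cond_measure \<Gamma> P \<sigma> x True"
  define \<nu> where "\<nu> = cond_measure \<Gamma> P \<sigma> x False"
  have \<mu>: "\<mu> = uniform_measure P (cylinder {y. \<Gamma> y < Suc (\<Gamma> x)} \<eta>)"
    and \<nu>: "\<nu> = uniform_measure P (cylinder {y. \<Gamma> y < Suc (\<Gamma> x)} \<eta>')"
    using inj by (simp_all add: \<mu>_def \<nu>_def \<eta>_def \<eta>'_def cond_measure_eq)
  have sets: "sets \<mu> = sets spin_space" "sets \<nu> = sets spin_space"
    by (simp_all add: \<mu> \<nu> sets_P)
  have prob: "prob_space \<mu>" "prob_space \<nu>"
    unfolding \<mu> \<nu> using below by (auto intro: prob_space_uniform_cylinder)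

  define good where "good = (\<lambda>N c.
    discrete_coupling (S N) (S' N) (\<kappa> (X N) (V N) \<eta>) (\<kappa> (X N) (V N) \<eta>') c \<and>
    (\<forall>u\<in>S N. min (\<kappa> (X N) (V N) \<eta> u) (\<kappa> (X N) (V N) \<eta>' (u(x := False))) \<le> c u (u(x := False))) \<and>
    (\<forall>y\<in>V N \<inter> I N. (\<Sum>u\<in>S N. \<Sum>v\<in>S' N. c u v * of_bool (u y \<noteq> v y))
      \<le> infl_prob adj q (V N \<inter> I N) ({x} \<union> (V N - I N)) y))"
  have "\<exists>c. good N c" for N
    unfolding good_def S_def S'_def I_def \<eta>_def \<eta>'_def
    using XL[of N] by (intro maximal_window_coupling osc q) auto
  then obtain c where good: "\<And>N. good N (c N)" by metis
  note c = good[unfolded good_def, THEN conjunct1]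
    and max = good[unfolded good_def, THEN conjunct2, THEN conjunct1, rule_format]
    and dis = good[unfolded good_def, THEN conjunct2, THEN conjunct2, rule_format]
  have c_nonneg: "0 \<le> c N u v" for N u v using c by (simp add: discrete_coupling_def)
  have total: "(\<Sum>u\<in>S N. \<Sum>v\<in>S' N. c N u v) = 1" for N
    using c[of N] sum_\<kappa>[OF XL(1,2), of N \<eta>] by (simp add: discrete_coupling_def S_def)

  define word where "word = (\<lambda>(u :: 'd config, v :: 'd config) n. (u (e n), v (e n)))"
  have total': "(\<Sum>b\<in>S N \<times> S' N. case_prod (c N) b) = 1" for N
    using total[of N] by (simp add: sum.cartesian_product case_prod_unfold)
  have nonneg': "0 \<le> case_prod (c N) b" for N b
    using c_nonneg by (cases b) simp
  obtain Q r where Q: "prob_space Q" "sets Q = sets (PiM UNIV (\<lambda>_::nat. count_space (UNIV :: (bool \<times> bool) set)))"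
    and r: "strict_mono (r :: nat \<Rightarrow> nat)"
    and ev: "\<And>n G. {s. G (map s [0..<n])} \<in> sets Q"
    and lim': "\<And>n G. (\<lambda>N. \<Sum>b\<in>S (r N) \<times> S' (r N). case_prod (c (r N)) b * of_bool (G (map (word b) [0..<n])))
        \<longlonglongrightarrow> measure Q {s. G (map s [0..<n])}"
    using sequence_limit_law[of "\<lambda>N. case_prod (c N)" "\<lambda>N. S N \<times> S' N" "\<lambda>_. word", OF nonneg' total']
    by blast
  have lim: "(\<lambda>N. \<Sum>u\<in>S (r N). \<Sum>v\<in>S' (r N). c (r N) u v * of_bool (G (map (word (u, v)) [0..<n])))
        \<longlonglongrightarrow> measure Q {s. G (map s [0..<n])}" for n G
    using lim'[of G n] by (simp add: sum.cartesian_product case_prod_unfold)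
  have ev_r: "eventually (\<lambda>N. n < r N) sequentially" for n
    using eventually_compose_filterlim[OF eventually_gt_at_top filterlim_subseq[OF r]] .

  interpret Q: prob_space Q by (rule Q(1))
  have spaceQ: "space Q = UNIV"
    using sets_eq_imp_space_eq[OF Q(2)] by (simp add: space_PiM)
  \<comment> \<open>Inverse of the encoding \<open>word\<close>: a sequence is read back as a pair
    of configurations.\<close>
  define T where "T = (\<lambda>s :: nat \<Rightarrow> bool \<times> bool. ((\<lambda>y. fst (s (\<Gamma> y))), (\<lambda>y. snd (s (\<Gamma> y)))))"
  have comp: "(\<lambda>s. h (s (\<Gamma> y))) \<in> measurable Q (count_space UNIV)" for h :: "bool \<times> bool \<Rightarrow> bool" and y
    unfolding measurable_cong_sets[OF Q(2) refl]
    by (rule measurable_compose[OF measurable_component_singleton]) auto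
  have T: "T \<in> measurable Q (\<mu> \<Otimes>\<^sub>M \<nu>)"
  proof -
    have spins: "(\<lambda>s y. h (s (\<Gamma> y))) \<in> measurable Q spin_space" for h :: "bool \<times> bool \<Rightarrow> bool"
      unfolding spin_space_def using comp by (intro measurable_PiM_single') auto
    have "(\<lambda>s y. fst (s (\<Gamma> y))) \<in> measurable Q \<mu>"
      unfolding measurable_cong_sets[OF refl sets(1)] by (rule spins)
    moreover have "(\<lambda>s y. snd (s (\<Gamma> y))) \<in> measurable Q \<nu>"
      unfolding measurable_cong_sets[OF refl sets(2)] by (rule spins)
    ultimately show ?thesis unfolding T_def by (rule measurable_Pair)
  qed
  define R where "R = distr Q (\<mu> \<Otimes>\<^sub>M \<nu>) T"
  interpret R: prob_space R unfolding R_def by (rule Q.prob_space_distr[OF T])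
  have pairs: "sets (\<mu> \<Otimes>\<^sub>M \<nu>) = sets (spin_space \<Otimes>\<^sub>M spin_space)"
    using sets by (intro sets_pair_measure_cong)
  have space_pair: "space (\<mu> \<Otimes>\<^sub>M \<nu>) = UNIV"
    using sets_eq_imp_space_eq[OF sets(1)] sets_eq_imp_space_eq[OF sets(2)]
    by (simp add: space_pair_measure)
  have R_event: "measure R {(\<omega>1, \<omega>2). F \<omega>1 \<omega>2} = measure Q {s. F (fst (T s)) (snd (T s))}"
    if "{(\<omega>1, \<omega>2). F \<omega>1 \<omega>2} \<in> sets (spin_space \<Otimes>\<^sub>M spin_space)" for F
    unfolding R_def using that T spaceQ pairs
    by (subst measure_distr) (auto intro!: arg_cong[where f = "measure Q"] simp: case_prod_unfold)

  \<comment> \<open>Covers both projections; \<open>sel\<close> is the corresponding projection of a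
    pair of spins. Once the window exceeds \<open>n\<close> and the index of \<open>x\<close>, the
    approximating cylinder probabilities no longer depend on it.\<close>
  have marginal: "distr R M pr = M"
    if M: "prob_space M" "sets M = sets spin_space" and pr: "pr \<in> measurable (\<mu> \<Otimes>\<^sub>M \<nu>) M"
      and sel: "\<And>s y. pr (T s) y = sel (s (\<Gamma> y))"
      and level: "\<And>N n \<tau>. max n (Suc (\<Gamma> x)) < N \<Longrightarrow>
        (\<Sum>u\<in>S N. \<Sum>v\<in>S' N. c N u v * of_bool (\<forall>y\<in>{y. \<Gamma> y < n}. sel (u y, v y) = \<tau> y))
          = measure M (cylinder {y. \<Gamma> y < n} \<tau>)"
    for M pr sel
  proof (rule spin_measure_eqI[OF \<Gamma>])
    have R: "distr R M pr = distr Q M (pr \<circ> T)" unfolding R_def using T pr by (rule distr_distr[rotated])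
    have comp: "pr \<circ> T \<in> measurable Q M" using T pr by (rule measurable_comp)
    show "prob_space (distr R M pr)" unfolding R by (rule Q.prob_space_distr[OF comp])
    fix n \<tau>
    let ?Y = "{y. \<Gamma> y < n}"
    let ?G = "\<lambda>l. \<forall>i<n. sel (l ! i) = \<tau> (e i)"
    have "cylinder ?Y \<tau> \<in> sets M" by (simp add: M below cylinder_in_spin_space)
    then have "measure (distr R M pr) (cylinder ?Y \<tau>) = measure Q {s. pr (T s) \<in> cylinder ?Y \<tau>}"
      unfolding R using comp spaceQ by (simp add: measure_distr vimage_def)
    also have "{s. pr (T s) \<in> cylinder ?Y \<tau>} = {s. ?G (map s [0..<n])}"
      unfolding cylinder_def by (simp add: sites sel e)
    also have "measure Q \<dots> = measure M (cylinder ?Y \<tau>)"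
    proof (rule LIMSEQ_unique[OF lim[of ?G]])
      have "?G (map (word (u, v)) [0..<n]) \<longleftrightarrow> (\<forall>y\<in>?Y. sel (u y, v y) = \<tau> y)" for u v
        unfolding word_def by (simp add: sites e)
      then have "(\<Sum>u\<in>S N. \<Sum>v\<in>S' N. c N u v * of_bool (?G (map (word (u, v)) [0..<n])))
          = measure M (cylinder ?Y \<tau>)" if "max n (Suc (\<Gamma> x)) < N" for N
        using level[OF that, of \<tau>] by simp
      then show "(\<lambda>N. \<Sum>u\<in>S (r N). \<Sum>v\<in>S' (r N). c (r N) u v * of_bool (?G (map (word (u, v)) [0..<n])))
          \<longlonglongrightarrow> measure M (cylinder ?Y \<tau>)"
        by (intro tendsto_eventually eventually_mono[OF ev_r])
    qed
    finally show "measure (distr R M pr) (cylinder ?Y \<tau>) = measure M (cylinder ?Y \<tau>)" .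
  qed (use M in auto)

  have marg1: "distr R \<mu> fst = \<mu>"
  proof (rule marginal[of \<mu> fst fst])
    fix N n \<tau> assume N: "max n (Suc (\<Gamma> x)) < N"
    have "(\<Sum>u\<in>S N. \<Sum>v\<in>S' N. c N u v * of_bool (\<forall>y\<in>{y. \<Gamma> y < n}. fst (u y, v y) = \<tau> y))
        = (\<Sum>u\<in>S N. \<kappa> (X N) (V N) \<eta> u * of_bool (\<forall>y\<in>{y. \<Gamma> y < n}. u y = \<tau> y))"
      using c[of N] by (simp add: sum_distrib_right[symmetric] discrete_coupling_def)
    also have "\<dots> = measure \<mu> (cylinder {y. \<Gamma> y < n} \<tau>)"
      unfolding S_def \<mu> using N diff[of N] XL[of N] by (subst sum_\<kappa>_cylinder) (auto simp: X_def)
    finally show "(\<Sum>u\<in>S N. \<Sum>v\<in>S' N. c N u v * of_bool (\<forall>y\<in>{y. \<Gamma> y < n}. fst (u y, v y) = \<tau> y))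
        = measure \<mu> (cylinder {y. \<Gamma> y < n} \<tau>)" .
  qed (use prob sets in \<open>simp_all add: T_def\<close>)
  have marg2: "distr R \<nu> snd = \<nu>"
  proof (rule marginal[of \<nu> snd snd])
    fix N n \<tau> assume N: "max n (Suc (\<Gamma> x)) < N"
    have "(\<Sum>u\<in>S N. \<Sum>v\<in>S' N. c N u v * of_bool (\<forall>y\<in>{y. \<Gamma> y < n}. snd (u y, v y) = \<tau> y))
        = (\<Sum>v\<in>S' N. \<kappa> (X N) (V N) \<eta>' v * of_bool (\<forall>y\<in>{y. \<Gamma> y < n}. v y = \<tau> y))"
      using c[of N] by (subst sum.swap) (simp add: sum_distrib_right[symmetric] discrete_coupling_def)
    also have "\<dots> = measure \<nu> (cylinder {y. \<Gamma> y < n} \<tau>)"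
      unfolding S'_def \<nu> using N diff[of N] XL[of N] by (subst sum_\<kappa>_cylinder) (auto simp: X_def)
    finally show "(\<Sum>u\<in>S N. \<Sum>v\<in>S' N. c N u v * of_bool (\<forall>y\<in>{y. \<Gamma> y < n}. snd (u y, v y) = \<tau> y))
        = measure \<nu> (cylinder {y. \<Gamma> y < n} \<tau>)" .
  qed (use prob sets in \<open>simp_all add: T_def\<close>)

  have coupling: "coupling \<mu> \<nu> R"
    unfolding coupling_def using marg1 marg2 by (simp add: R_def)

  let ?agree = "{(\<omega>1 :: 'd config, \<omega>2 :: 'd config). \<forall>y. \<Gamma> x < \<Gamma> y \<longrightarrow> \<omega>1 y = \<omega>2 y}"
  let ?agree_n = "\<lambda>n. {(\<omega>1 :: 'd config, \<omega>2 :: 'd config). \<forall>i<n. \<Gamma> x < i \<longrightarrow> \<omega>1 (e i) = \<omega>2 (e i)}"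
  have agree_n: "?agree_n n \<in> sets (spin_space \<Otimes>\<^sub>M spin_space)" for n
  proof -
    let ?J = "{i. i < n \<and> \<Gamma> x < i}"
    have univ: "UNIV \<in> sets (spin_space \<Otimes>\<^sub>M (spin_space :: 'd config measure))"
      using sets.top[of "spin_space \<Otimes>\<^sub>M (spin_space :: 'd config measure)"]
      by (simp add: space_pair_measure)
    have "(\<Inter>i\<in>?J. {(\<omega>1, \<omega>2). \<omega>1 (e i) = \<omega>2 (e i)}) \<in> sets (spin_space \<Otimes>\<^sub>M spin_space)"
    proof (cases "?J = {}")
      case True
      then show ?thesis unfolding True using univ by simp
    next
      case False
      then show ?thesis by (intro sets.finite_INT agreement_in_sets) auto
    qed
    moreover have "?agree_n n = (\<Inter>i\<in>?J. {(\<omega>1, \<omega>2). \<omega>1 (e i) = \<omega>2 (e i)})" by auto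
    ultimately show ?thesis by (simp only:)
  qed
  have maximal: "measure Q'' ?agree \<le> measure R ?agree" if Q'': "coupling \<mu> \<nu> Q''" for Q''
  proof -
    \<comment> \<open>Full agreement is relaxed to agreement among the first \<open>n\<close> sites,
      an event to which the limit over windows applies; \<open>n\<close> tends to infinity
      afterwards.\<close>
    have "measure Q'' ?agree \<le> measure R (?agree_n n)" for n
    proof -
      let ?G = "\<lambda>l. \<forall>i<n. \<Gamma> x < i \<longrightarrow> fst (l ! i) = snd (l ! i)"
      have "measure R (?agree_n n) = measure Q {s. ?G (map s [0..<n])}"
        unfolding R_event[OF agree_n] T_def using e by (auto intro!: arg_cong[where f = "measure Q"])
      moreover have "measure Q'' ?agree \<le> \<dots>"
      proof (rule tendsto_lowerbound[OF lim[of ?G]])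
        have "measure Q'' ?agree \<le> (\<Sum>u\<in>S (r N). \<Sum>v\<in>S' (r N). c (r N) u v *
            of_bool (?G (map (word (u, v)) [0..<n])))"
          if N: "max n (Suc (\<Gamma> x)) < r N" for N
        proof -
          let ?g = "\<lambda>u v. of_bool (?G (map (word (u, v)) [0..<n])) :: real"
          have "measure Q'' ?agree \<le> (\<Sum>u\<in>S (r N). min (\<kappa> (X (r N)) (V (r N)) \<eta> u) (\<kappa> (X (r N)) (V (r N)) \<eta>' (u(x := False))))"
            unfolding S_def X_def V_def \<eta>_def \<eta>'_def using N Q''
            by (intro coupling_agree_le inj below) (auto simp: \<mu>_def \<nu>_def)
          also have "\<dots> \<le> (\<Sum>u\<in>S (r N). c (r N) u (u(x := False)))"
            by (intro sum_mono max)
          \<comment> \<open>A configuration \<open>u\<close> and its copy reset at \<open>x\<close>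
            agree after \<open>x\<close>, so the diagonal mass belongs to the relaxed agreement
            event.\<close>
          also have "\<dots> \<le> (\<Sum>u\<in>S (r N). \<Sum>v\<in>S' (r N). c (r N) u v * ?g u v)"
          proof (rule sum_mono)
            fix u assume u: "u \<in> S (r N)"
            have "u(x := False) \<in> S' (r N)"
              using u XL(4)[of "r N"] by (auto simp: S_def S'_def configs_def \<eta>_def \<eta>'_def)
            moreover have "?g u (u(x := False)) = 1"
              using e by (auto simp: word_def)
            moreover have "0 \<le> c (r N) u v * ?g u v" for v using c_nonneg by simp
            ultimately show "c (r N) u (u(x := False)) \<le> (\<Sum>v\<in>S' (r N). c (r N) u v * ?g u v)"
              using member_le_sum[of "u(x := False)" "S' (r N)" "\<lambda>v. c (r N) u v * ?g u v"] finS by simp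
          qed
          finally show ?thesis .
        qed
        then show "eventually (\<lambda>N. measure Q'' ?agree \<le> (\<Sum>u\<in>S (r N). \<Sum>v\<in>S' (r N). c (r N) u v *
            of_bool (?G (map (word (u, v)) [0..<n])))) sequentially"
          by (rule eventually_mono[OF ev_r])
      qed simp
      ultimately show ?thesis by simp
    qed
    moreover have "(\<lambda>n. measure R (?agree_n n)) \<longlonglongrightarrow> measure R (\<Inter>n. ?agree_n n)"
      using agree_n pairs by (intro R.finite_Lim_measure_decseq) (auto simp: R_def decseq_def)
    moreover have "(\<Inter>n. ?agree_n n) = ?agree"
    proof -
      have "(\<forall>y. \<Gamma> x < \<Gamma> y \<longrightarrow> \<omega>1 y = \<omega>2 y) \<longleftrightarrow> (\<forall>n. \<forall>i<n. \<Gamma> x < i \<longrightarrow> \<omega>1 (e i) = \<omega>2 (e i))"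
        for \<omega>1 \<omega>2 :: "'d config"
        by (metis e lessI)
      then show ?thesis by auto
    qed
    ultimately show ?thesis by (auto intro: LIMSEQ_le_const)
  qed

  have R_dis: "measure R {(\<omega>1, \<omega>2). \<omega>1 y \<noteq> \<omega>2 y} = measure Q {s. fst (map s [0..<Suc (\<Gamma> y)] ! \<Gamma> y) \<noteq> snd (map s [0..<Suc (\<Gamma> y)] ! \<Gamma> y)}" for y
    using R_event[OF disagreement_in_sets] by (simp add: T_def del: upt_Suc)
  have dis_lim: "(\<lambda>N. \<Sum>u\<in>S (r N). \<Sum>v\<in>S' (r N). c (r N) u v * of_bool (u y \<noteq> v y))
      \<longlonglongrightarrow> measure R {(\<omega>1, \<omega>2). \<omega>1 y \<noteq> \<omega>2 y}" for y
    unfolding R_dis using lim[of "\<lambda>l. fst (l ! \<Gamma> y) \<noteq> snd (l ! \<Gamma> y)" "Suc (\<Gamma> y)"]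
    by (simp add: word_def e del: upt_Suc)
  \<comment> \<open>Before \<open>x\<close> both conditional measures are frozen to
    \<sigma>.\<close>
  have before: "measure R {(\<omega>1, \<omega>2). \<omega>1 y \<noteq> \<omega>2 y} = 0" if y: "\<Gamma> y < \<Gamma> x" for y
  proof (rule LIMSEQ_unique[OF dis_lim])
    have "y \<noteq> x" using y by auto
    then have "(\<Sum>u\<in>S N. \<Sum>v\<in>S' N. c N u v * of_bool (u y \<noteq> v y)) = 0" for N
      using y by (intro sum.neutral ballI) (auto simp: S_def S'_def configs_def V_def \<eta>_def \<eta>'_def)
    then show "(\<lambda>N. \<Sum>u\<in>S (r N). \<Sum>v\<in>S' (r N). c (r N) u v * of_bool (u y \<noteq> v y)) \<longlonglongrightarrow> 0" by simp
  qed
  have "measure R {(\<omega>1, \<omega>2). \<omega>1 y \<noteq> \<omega>2 y} \<le> q * \<phi> ^ k" if k: "real k * L < sdist y x" for y k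
  proof (cases "\<Gamma> y < \<Gamma> x")
    case True
    then show ?thesis using before q \<phi> by simp
  next
    case False
    have "0 \<le> real k * L" using L by simp
    then have "y \<noteq> x" using k by auto
    then have y: "\<Gamma> x < \<Gamma> y" using False inj by (meson injD linorder_neqE_nat)
    \<comment> \<open>The first term stems from a connection to \<open>x\<close>, the second from a
      connection to the rim. For fixed \<open>j\<close> the window grows until its rim is far enough
      away; then \<open>j\<close> tends to infinity.\<close>
    have "measure R {(\<omega>1, \<omega>2). \<omega>1 y \<noteq> \<omega>2 y} \<le> q * \<phi> ^ k + q * \<phi> ^ j" for j
    proof (rule tendsto_upperbound[OF dis_lim])
      \<comment> \<open>In a window containing these sites, every site of the ball around
        \<open>y\<close> has all its neighbours in the window, so the rim lies outside the
        ball.\<close>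
      let ?near = "\<Union>z\<in>insert y (lattice_ball y (real j * L)). insert z {v. adj z v}"
      have "(\<Sum>u\<in>S N. \<Sum>v\<in>S' N. c N u v * of_bool (u y \<noteq> v y)) \<le> q * \<phi> ^ k + q * \<phi> ^ j"
        if N: "?near \<subseteq> {y. \<Gamma> y < N}" for N
      proof -
        have yI: "y \<in> V N \<inter> I N" using N y by (auto simp: V_def I_def X_def)
        have far: "\<forall>a\<in>V N - I N. real j * L < sdist y a"
        proof (rule ballI, rule ccontr)
          fix a assume a: "a \<in> V N - I N" "\<not> real j * L < sdist y a"
          then have "a \<in> lattice_ball y (real j * L)" by (simp add: lattice_ball_def)
          then show False using N a by (auto simp: I_def X_def)
        qed
        have fin: "finite (V N \<inter> I N)" using XL by auto
        have "infl_prob adj q (V N \<inter> I N) ({x} \<union> (V N - I N)) y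
            \<le> infl_prob adj q (V N \<inter> I N) {x} y + infl_prob adj q (V N \<inter> I N) (V N - I N) y"
          using q by (rule infl_prob_Un)
        also have "\<dots> \<le> q * \<phi> ^ k + q * \<phi> ^ j"
          using decay[OF fin, of "{x}" k y] decay[OF fin far] k by simp
        finally show ?thesis using dis[OF yI] by simp
      qed
      moreover have "eventually (\<lambda>N. ?near \<subseteq> {y. \<Gamma> y < N}) sequentially"
        by (intro eventually_window inj finite_UN_I) (auto simp: finite_lattice_ball finite_neighbors)
      moreover have "filterlim r sequentially sequentially" using r by (rule filterlim_subseq)
      ultimately show "eventually (\<lambda>N. (\<Sum>u\<in>S (r N). \<Sum>v\<in>S' (r N). c (r N) u v * of_bool (u y \<noteq> v y)) \<le> q * \<phi> ^ k + q * \<phi> ^ j) sequentially"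
        by (intro eventually_compose_filterlim[where f = r and F = sequentially]) (auto elim: eventually_mono)
    qed simp
    moreover have "(\<lambda>j. q * \<phi> ^ k + q * \<phi> ^ j) \<longlonglongrightarrow> q * \<phi> ^ k + q * 0"
      using \<phi> by (intro tendsto_intros LIMSEQ_realpow_zero)
    ultimately show ?thesis by (intro LIMSEQ_le_const[of _ "q * \<phi> ^ k"]) auto
  qed
  moreover have "maximal_coupling \<Gamma> P \<sigma> x R"
    unfolding maximal_coupling_def Let_def using coupling maximal by (simp add: \<mu>_def \<nu>_def)
  ultimately show ?thesis by blast
qed

end

section \<open>Concentration\<close>

definition depends_on :: "'a set \<Rightarrow> (('a \<Rightarrow> bool) \<Rightarrow> real) \<Rightarrow> bool" where
  "depends_on Y g \<longleftrightarrow> (\<forall>\<sigma> \<sigma>'. (\<forall>x\<in>Y. \<sigma> x = \<sigma>' x) \<longrightarrow> g \<sigma> = g \<sigma>')"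

lemma depends_onD: "depends_on Y g \<Longrightarrow> (\<And>x. x \<in> Y \<Longrightarrow> \<sigma> x = \<sigma>' x) \<Longrightarrow> g \<sigma> = g \<sigma>'"
  by (auto simp: depends_on_def)

lemma depends_on_mono: "depends_on Y g \<Longrightarrow> Y \<subseteq> Y' \<Longrightarrow> depends_on Y' g"
  by (auto simp: depends_on_def)

lemma depends_on_compose: "depends_on Y g \<Longrightarrow> depends_on Y (\<lambda>\<sigma>. f (g \<sigma>))"
  unfolding depends_on_def by metis

text \<open>Reduces integrals of local functions to finitely many cylinder probabilities.\<close>

lemma local_expansion:
  assumes "finite Y" "depends_on Y g"
  shows "g \<omega> = (\<Sum>u\<in>configs Y (\<lambda>_. False). g u * indicator (cylinder Y u) \<omega>)"
proof -
  let ?v = "override_on (\<lambda>_. False) \<omega> Y"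
  have "(\<Sum>u\<in>configs Y (\<lambda>_. False). g u * indicator (cylinder Y u) \<omega>)
      = (\<Sum>u\<in>configs Y (\<lambda>_. False). if u = ?v then g u else 0)"
    by (intro sum.cong refl)
       (auto simp: configs_def cylinder_def override_on_def fun_eq_iff split: split_indicator)
  also have "\<dots> = g ?v"
    by (subst sum.delta[OF finite_configs[OF assms(1)]]) (auto simp: configs_def)
  also have "\<dots> = g \<omega>"
    using assms(2) by (intro depends_onD) auto
  finally show ?thesis by simp
qed

lemma local_integral:
  fixes g :: "'d::finite config \<Rightarrow> real"
  assumes "prob_space M" "sets M = sets spin_space" "finite Y" "depends_on Y g"
  shows "integrable M g"
    and "integral\<^sup>L M g = (\<Sum>u\<in>configs Y (\<lambda>_. False). g u * measure M (cylinder Y u))"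
proof -
  interpret prob_space M by fact
  have cyl: "cylinder Y u \<in> sets M" for u
    using assms by (simp add: cylinder_in_spin_space)
  have space: "space M = UNIV" using sets_eq_imp_space_eq[OF assms(2)] by simp
  have int: "integrable M (\<lambda>\<omega>. g u * indicator (cylinder Y u) \<omega>)" for u
    using cyl by (intro integrable_mult_right) (simp add: less_top[symmetric])
  have g: "g = (\<lambda>\<omega>. \<Sum>u\<in>configs Y (\<lambda>_. False). g u * indicator (cylinder Y u) \<omega>)"
    using local_expansion[OF assms(3,4)] by (rule ext)
  show "integrable M g" by (subst g) (intro Bochner_Integration.integrable_sum int)
  have "integral\<^sup>L M g = (\<integral>\<omega>. (\<Sum>u\<in>configs Y (\<lambda>_. False). g u * indicator (cylinder Y u) \<omega>) \<partial>M)"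
    by (subst g) simp
  also have "\<dots> = (\<Sum>u\<in>configs Y (\<lambda>_. False). \<integral>\<omega>. g u * indicator (cylinder Y u) \<omega> \<partial>M)"
    by (intro Bochner_Integration.integral_sum int)
  also have "\<dots> = (\<Sum>u\<in>configs Y (\<lambda>_. False). g u * measure M (cylinder Y u))"
    using space by simp
  finally show "integral\<^sup>L M g = (\<Sum>u\<in>configs Y (\<lambda>_. False). g u * measure M (cylinder Y u))" .
qed

text \<open>Hoeffding's lemma for a variable with the two values \<open>u\<close> and
  \<open>v\<close>; the case \<open>u < v\<close> follows by exchanging their roles.\<close>

lemma two_point_hoeffding:
  fixes a u v l :: real
  assumes "0 \<le> a" "a \<le> 1" "0 \<le> l"
  shows "a * exp (l * u) + (1 - a) * exp (l * v)
    \<le> exp (l * (a * u + (1 - a) * v) + l\<^sup>2 * (u - v)\<^sup>2 / 8)"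
proof -
  have *: "a * exp (l * u) + (1 - a) * exp (l * v)
      \<le> exp (l * (a * u + (1 - a) * v) + l\<^sup>2 * (u - v)\<^sup>2 / 8)"
    if "0 \<le> a" "a \<le> 1" "v \<le> u" for a u v
  proof -
    define h where "h = l * (u - v)"
    have h: "0 \<le> h" using that assms by (simp add: h_def)
    have pos: "0 < 1 + a * (exp h - 1)"
      using that h by (intro add_pos_nonneg mult_nonneg_nonneg) auto
    have "ln (1 + a * (exp h - 1)) \<le> h * a + h\<^sup>2 / 8"
      using Hoeffdings_lemma_aux[OF h that(1)] by simp
    then have "1 + a * (exp h - 1) \<le> exp (h * a + h\<^sup>2 / 8)"
      using pos by (metis exp_le_cancel_iff exp_ln)
    then have "exp (l * v) * (1 + a * (exp h - 1)) \<le> exp (l * v) * exp (h * a + h\<^sup>2 / 8)"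
      by (intro mult_left_mono) auto
    also have "exp (l * v) * exp (h * a + h\<^sup>2 / 8) = exp (l * (a * u + (1 - a) * v) + l\<^sup>2 * (u - v)\<^sup>2 / 8)"
      by (simp add: exp_add[symmetric] h_def algebra_simps power2_eq_square)
    also have "exp (l * v) * (1 + a * (exp h - 1)) = a * (exp (l * v) * exp h) + (1 - a) * exp (l * v)"
      by (simp add: algebra_simps)
    also have "exp (l * v) * exp h = exp (l * u)"
      by (simp add: exp_add[symmetric] h_def algebra_simps)
    finally show ?thesis .
  qed
  show ?thesis
  proof (cases "v \<le> u")
    case True
    then show ?thesis using * assms by blast
  next
    case False
    then show ?thesis
      using *[of "1 - a" u v] assms by (simp add: add.commute power2_commute)
  qed
qed

context gibbs_field
begin

text \<open>Conditional expectation given the sites of index below \<open>n\<close>, as a function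
  defined at every \<sigma> and not only almost everywhere.\<close>

definition cexp :: "('d site \<Rightarrow> nat) \<Rightarrow> nat \<Rightarrow> 'd config \<Rightarrow> ('d config \<Rightarrow> real) \<Rightarrow> real" where
  "cexp \<Gamma> n \<sigma> f = integral\<^sup>L (uniform_measure P (cylinder {y. \<Gamma> y < n} \<sigma>)) f"

lemma cexp_0: "cexp \<Gamma> 0 \<sigma> f = integral\<^sup>L P f"
proof -
  have "uniform_measure P (cylinder {} \<sigma>) = P"
  proof (rule measure_eqI)
    fix A assume "A \<in> sets (uniform_measure P (cylinder {} \<sigma>))"
    then show "emeasure (uniform_measure P (cylinder {} \<sigma>)) A = emeasure P A"
      using emeasure_space_1 emeasure_uniform_measure[of "cylinder {} \<sigma>" P A] cylinder_sets[of "{}" \<sigma>]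
      by (simp add: cylinder_def divide_ennreal_def)
  qed simp
  then show ?thesis by (simp add: cexp_def)
qed

text \<open>The weight \<open>a\<close> is the conditional probability of \<open>+\<close> at the
  next site. It is chosen before \<open>f\<close>, because the same weight has to serve for
  \<open>g\<close> and for \<open>exp (l * g \<omega>)\<close>.\<close>

lemma cexp_step:
  assumes "bij \<Gamma>" "finite Y"
  defines "e \<equiv> inv \<Gamma>"
  obtains a where "0 \<le> a" "a \<le> 1"
    "\<And>f. depends_on Y f \<Longrightarrow> cexp \<Gamma> n \<sigma> f
      = a * cexp \<Gamma> (Suc n) (\<sigma>(e n := True)) f + (1 - a) * cexp \<Gamma> (Suc n) (\<sigma>(e n := False)) f"
proof -
  let ?X = "{y. \<Gamma> y < n}" and ?y = "e n"
  have inj: "inj \<Gamma>" using assms(1) by (rule bij_is_inj)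
  have fin: "finite ?X" by (rule finite_below[OF inj])
  have e: "\<Gamma> ?y = n" using assms(1) by (simp add: e_def bij_is_surj surj_f_inv_f)
  then have X: "{y. \<Gamma> y < Suc n} = insert ?y ?X" "?y \<notin> ?X"
    using inj by (auto simp: less_Suc_eq dest: injD)
  define a where "a = w (insert ?y ?X) (\<sigma>(?y := True)) / w ?X \<sigma>"
  note a = single_site_prob[OF fin X(2), of \<sigma>, folded a_def]
  let ?m = "\<lambda>X \<sigma>. uniform_measure P (cylinder X \<sigma>)"
  have meas: "measure (?m ?X \<sigma>) A = a * measure (?m (insert ?y ?X) (\<sigma>(?y := True))) A
      + (1 - a) * measure (?m (insert ?y ?X) (\<sigma>(?y := False))) A" if A: "A \<in> events" for A
  proof -
    let ?C = "\<lambda>s. cylinder (insert ?y ?X) (\<sigma>(?y := s))"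
    have "cylinder ?X \<sigma> \<inter> A = (?C True \<inter> A) \<union> (?C False \<inter> A)"
      using cylinder_split(1)[OF X(2), of \<sigma>] by blast
    moreover have "(?C True \<inter> A) \<inter> (?C False \<inter> A) = {}"
      using cylinder_split(2)[OF X(2), of \<sigma>] by blast
    ultimately have "prob (cylinder ?X \<sigma> \<inter> A) = prob (?C True \<inter> A) + prob (?C False \<inter> A)"
      using A fin by (simp only:) (intro finite_measure_Union sets.Int cylinder_sets, auto)
    moreover have pos: "0 < w ?X \<sigma>" "0 < w (insert ?y ?X) (\<sigma>(?y := s))" for s
      using fin by (auto intro: w_pos)
    have "prob (?C s \<inter> A) / w ?X \<sigma> = (if s then a else 1 - a) * measure (?m (insert ?y ?X) (\<sigma>(?y := s))) A" for s
    proof -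
      define b where "b = (if s then a else 1 - a)"
      have "w (insert ?y ?X) (\<sigma>(?y := s)) = b * w ?X \<sigma>" unfolding b_def by (rule a(3))
      moreover from this have "b \<noteq> 0" using pos(2)[of s] by auto
      ultimately show ?thesis
        unfolding b_def[symmetric] using A fin pos(1)
        by (simp add: measure_uniform_cylinder)
    qed
    from this[of True] this[of False] show ?thesis
      using A fin calculation by (simp add: measure_uniform_cylinder add_divide_distrib)
  qed
  have "cexp \<Gamma> n \<sigma> f = a * cexp \<Gamma> (Suc n) (\<sigma>(?y := True)) f + (1 - a) * cexp \<Gamma> (Suc n) (\<sigma>(?y := False)) f"
    if f: "depends_on Y f" for f
  proof -
    have int: "integral\<^sup>L (?m Z \<zeta>) f = (\<Sum>u\<in>configs Y (\<lambda>_. False). f u * measure (?m Z \<zeta>) (cylinder Y u))"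
      if "finite Z" for Z \<zeta>
      using that by (intro local_integral prob_space_uniform_cylinder assms(2) f) (simp_all add: sets_P)
    show ?thesis
      unfolding cexp_def X int[OF fin] int[OF finite.insertI[OF fin]] sum_distrib_left
        sum.distrib[symmetric] meas[OF cylinder_sets[OF assms(2)]]
      by (intro sum.cong refl) (simp add: algebra_simps)
  qed
  then show thesis using that a(1,2) by blast
qed

text \<open>The conditional measure is concentrated on the cylinder, where \<open>f\<close> is
  constant; this starts the backward induction below.\<close>

lemma cexp_determined:
  assumes "inj \<Gamma>" "depends_on {y. \<Gamma> y < n} f"
  shows "cexp \<Gamma> n \<sigma> f = f \<sigma>"
proof -
  let ?X = "{y. \<Gamma> y < n}"
  have fin: "finite ?X" by (rule finite_below[OF assms(1)])
  interpret M: prob_space "uniform_measure P (cylinder ?X \<sigma>)"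
    by (rule prob_space_uniform_cylinder[OF fin])
  have "AE \<omega> in uniform_measure P (cylinder ?X \<sigma>). \<omega> \<in> cylinder ?X \<sigma>"
    using fin w_pos[OF fin, of \<sigma>] by (intro AE_uniform_measureI cylinder_sets) auto
  then have "AE \<omega> in uniform_measure P (cylinder ?X \<sigma>). f \<omega> = f \<sigma>"
    by (rule eventually_mono) (use assms(2) in \<open>auto simp: cylinder_def intro: depends_onD\<close>)
  then have "cexp \<Gamma> n \<sigma> f = (\<integral>\<omega>. f \<sigma> \<partial>uniform_measure P (cylinder ?X \<sigma>))"
    unfolding cexp_def
    using borel_measurable_integrable[OF local_integral(1)[OF M.prob_space_axioms _ fin assms(2)]]
    by (intro integral_cong_AE) (auto simp: sets_P)
  also have "\<dots> = f \<sigma>" using M.prob_space by simp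
  finally show ?thesis .
qed

text \<open>Backward induction along the enumeration: given the first \<open>n\<close> spins, the
  next conditional expectation of \<open>g\<close> takes two values at distance at most
  \<open>c n\<close>, and Hoeffding's lemma charges a factor
  \<open>exp (l\<^sup>2 * (c n)\<^sup>2 / 8)\<close> for the step.\<close>

lemma exponential_moment:
  assumes "bij \<Gamma>" "depends_on {y. \<Gamma> y < N} g" "0 \<le> l"
    and c: "\<And>k \<sigma>. \<bar>cexp \<Gamma> (Suc k) (\<sigma>(inv \<Gamma> k := True)) g - cexp \<Gamma> (Suc k) (\<sigma>(inv \<Gamma> k := False)) g\<bar> \<le> c k"
  shows "n \<le> N \<Longrightarrow> cexp \<Gamma> n \<sigma> (\<lambda>\<omega>. exp (l * g \<omega>))
    \<le> exp (l * cexp \<Gamma> n \<sigma> g + l\<^sup>2 * (\<Sum>k\<in>{n..<N}. (c k)\<^sup>2) / 8)"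
proof (induction "N - n" arbitrary: n \<sigma>)
  case 0
  then have "n = N" by simp
  moreover have "depends_on {y. \<Gamma> y < N} (\<lambda>\<omega>. exp (l * g \<omega>))"
    using assms(2) by (rule depends_on_compose)
  ultimately show ?case
    using assms(2) bij_is_inj[OF assms(1)] by (simp add: cexp_determined)
next
  case (Suc m)
  have fin: "finite {y. \<Gamma> y < N}" using assms(1) by (intro finite_below bij_is_inj)
  have dep: "depends_on {y. \<Gamma> y < N} (\<lambda>\<omega>. exp (l * g \<omega>))"
    using assms(2) by (rule depends_on_compose)
  let ?\<sigma> = "\<lambda>s. \<sigma>(inv \<Gamma> n := s)"
  obtain a where a: "0 \<le> a" "a \<le> 1" and step: "\<And>f. depends_on {y. \<Gamma> y < N} f \<Longrightarrow> cexp \<Gamma> n \<sigma> f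
      = a * cexp \<Gamma> (Suc n) (?\<sigma> True) f + (1 - a) * cexp \<Gamma> (Suc n) (?\<sigma> False) f"
    using cexp_step[OF assms(1) fin, of n \<sigma>] by blast
  let ?E = "\<lambda>s. cexp \<Gamma> (Suc n) (?\<sigma> s) g"
  let ?V = "\<Sum>k\<in>{Suc n..<N}. (c k)\<^sup>2"
  have IH: "cexp \<Gamma> (Suc n) (?\<sigma> s) (\<lambda>\<omega>. exp (l * g \<omega>)) \<le> exp (l * ?E s + l\<^sup>2 * ?V / 8)" for s
    using Suc by (intro Suc.hyps(1)) auto
  have V: "(\<Sum>k\<in>{n..<N}. (c k)\<^sup>2) = (c n)\<^sup>2 + ?V"
    using Suc.hyps(2) by (intro sum.atLeast_Suc_lessThan) simp
  have sq: "(?E True - ?E False)\<^sup>2 \<le> (c n)\<^sup>2"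
    using c[of n \<sigma>] by (meson abs_ge_zero abs_le_square_iff order_trans abs_ge_self)
  have "cexp \<Gamma> n \<sigma> (\<lambda>\<omega>. exp (l * g \<omega>))
      \<le> a * exp (l * ?E True + l\<^sup>2 * ?V / 8) + (1 - a) * exp (l * ?E False + l\<^sup>2 * ?V / 8)"
    unfolding step[OF dep] using a IH by (intro add_mono mult_left_mono) auto
  also have "\<dots> = (a * exp (l * ?E True) + (1 - a) * exp (l * ?E False)) * exp (l\<^sup>2 * ?V / 8)"
    by (simp add: exp_add algebra_simps)
  also have "\<dots> \<le> exp (l * (a * ?E True + (1 - a) * ?E False) + l\<^sup>2 * (?E True - ?E False)\<^sup>2 / 8) * exp (l\<^sup>2 * ?V / 8)"
    using a assms(3) by (intro mult_right_mono two_point_hoeffding) auto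
  also have "\<dots> = exp (l * cexp \<Gamma> n \<sigma> g + (l\<^sup>2 * (?E True - ?E False)\<^sup>2 / 8 + l\<^sup>2 * ?V / 8))"
    unfolding step[OF assms(2)] by (simp add: exp_add[symmetric] add.assoc)
  also have "\<dots> \<le> exp (l * cexp \<Gamma> n \<sigma> g + (l\<^sup>2 * (c n)\<^sup>2 / 8 + l\<^sup>2 * ?V / 8))"
    using sq by (simp add: mult_left_mono)
  also have "\<dots> = exp (l * cexp \<Gamma> n \<sigma> g + l\<^sup>2 * (\<Sum>k\<in>{n..<N}. (c k)\<^sup>2) / 8)"
    unfolding V by (simp add: algebra_simps)
  finally show ?case .
qed

lemma one_sided_concentration:
  assumes "bij \<Gamma>" "depends_on {y. \<Gamma> y < N} g" "0 < t"
    and c: "\<And>k \<sigma>. \<bar>cexp \<Gamma> (Suc k) (\<sigma>(inv \<Gamma> k := True)) g - cexp \<Gamma> (Suc k) (\<sigma>(inv \<Gamma> k := False)) g\<bar> \<le> c k"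
    and V: "(\<Sum>k\<in>{0..<N}. (c k)\<^sup>2) \<le> V" "0 < V"
  shows "prob {\<omega>. t \<le> g \<omega> - integral\<^sup>L P g} \<le> exp (- (2 * t\<^sup>2) / V)"
proof -
  \<comment> \<open>The minimiser of \<open>l\<^sup>2 * V / 8 - l * t\<close>; the minimum is
    \<open>- (2 * t\<^sup>2) / V\<close>.\<close>
  define l where "l = 4 * t / V"
  have l: "0 < l" using assms by (simp add: l_def)
  have fin: "finite {y. \<Gamma> y < N}" using assms(1) by (intro finite_below bij_is_inj)
  let ?h = "\<lambda>\<omega>. exp (l * g \<omega>)"
  have dep: "depends_on {y. \<Gamma> y < N} ?h" using assms(2) by (rule depends_on_compose)
  have int: "integrable P ?h" by (rule local_integral(1)[OF prob_space_axioms sets_P fin dep])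
  let ?b = "exp (l * (integral\<^sup>L P g + t))"
  have "prob {\<omega>. t \<le> g \<omega> - integral\<^sup>L P g} = prob {\<omega> \<in> space P. ?b \<le> ?h \<omega>}"
    using l by (intro arg_cong[where f = prob]) auto
  also have "\<dots> \<le> integral\<^sup>L P ?h / ?b"
    using int by (intro integral_Markov_inequality_measure[where A = "{}"]) auto
  also have "integral\<^sup>L P ?h \<le> exp (l * integral\<^sup>L P g + l\<^sup>2 * (\<Sum>k\<in>{0..<N}. (c k)\<^sup>2) / 8)"
    using exponential_moment[OF assms(1,2) _ c, of l 0] l by (simp add: cexp_0)
  also have "\<dots> \<le> exp (l * integral\<^sup>L P g + l\<^sup>2 * V / 8)"
    using V by (simp add: mult_left_mono)
  also have "\<dots> / ?b = exp (l\<^sup>2 * V / 8 - l * t)"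
    by (simp add: exp_diff[symmetric] algebra_simps)
  also have "l\<^sup>2 * V / 8 - l * t = - (2 * t\<^sup>2) / V"
    using V by (simp add: l_def power2_eq_square field_simps)
  finally show ?thesis by (simp add: divide_right_mono)
qed

lemma concentration:
  assumes "bij \<Gamma>" "depends_on {y. \<Gamma> y < N} g" "0 < t"
    and c: "\<And>k \<sigma>. \<bar>cexp \<Gamma> (Suc k) (\<sigma>(inv \<Gamma> k := True)) g - cexp \<Gamma> (Suc k) (\<sigma>(inv \<Gamma> k := False)) g\<bar> \<le> c k"
    and V: "(\<Sum>k\<in>{0..<N}. (c k)\<^sup>2) \<le> V" "0 < V"
  shows "prob {\<omega>. t \<le> \<bar>g \<omega> - integral\<^sup>L P g\<bar>} \<le> 2 * exp (- (2 * t\<^sup>2) / V)"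
proof -
  have fin: "finite {y. \<Gamma> y < N}" using assms(1) by (intro finite_below bij_is_inj)
  have int: "integrable P g" by (rule local_integral(1)[OF prob_space_axioms sets_P fin assms(2)])
  have [measurable]: "g \<in> borel_measurable P" using int by (rule borel_measurable_integrable)
  have sets: "{\<omega>. t \<le> g \<omega> - integral\<^sup>L P g} \<in> events" "{\<omega>. t \<le> - g \<omega> - integral\<^sup>L P (\<lambda>\<omega>. - g \<omega>)} \<in> events"
  proof -
    have "{\<omega> \<in> space P. t \<le> g \<omega> - integral\<^sup>L P g} \<in> events" "{\<omega> \<in> space P. t \<le> - g \<omega> - integral\<^sup>L P (\<lambda>\<omega>. - g \<omega>)} \<in> events"
      by measurable
    then show "{\<omega>. t \<le> g \<omega> - integral\<^sup>L P g} \<in> events" "{\<omega>. t \<le> - g \<omega> - integral\<^sup>L P (\<lambda>\<omega>. - g \<omega>)} \<in> events"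
      by simp_all
  qed
  have c': "\<bar>cexp \<Gamma> (Suc k) (\<sigma>(inv \<Gamma> k := True)) (\<lambda>\<omega>. - g \<omega>) - cexp \<Gamma> (Suc k) (\<sigma>(inv \<Gamma> k := False)) (\<lambda>\<omega>. - g \<omega>)\<bar> \<le> c k" for k \<sigma>
    using c[of k \<sigma>] by (simp add: cexp_def)
  have "{\<omega>. t \<le> \<bar>g \<omega> - integral\<^sup>L P g\<bar>}
      = {\<omega>. t \<le> g \<omega> - integral\<^sup>L P g} \<union> {\<omega>. t \<le> - g \<omega> - integral\<^sup>L P (\<lambda>\<omega>. - g \<omega>)}"
    by (auto simp: abs_if split: if_splits)
  then have "prob {\<omega>. t \<le> \<bar>g \<omega> - integral\<^sup>L P g\<bar>}
      \<le> prob {\<omega>. t \<le> g \<omega> - integral\<^sup>L P g} + prob {\<omega>. t \<le> - g \<omega> - integral\<^sup>L P (\<lambda>\<omega>. - g \<omega>)}"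
    using measure_Un_le[OF sets] by simp
  also have "\<dots> \<le> exp (- (2 * t\<^sup>2) / V) + exp (- (2 * t\<^sup>2) / V)"
    using one_sided_concentration[OF assms(1,2,3) c V]
      one_sided_concentration[OF assms(1) depends_on_compose[OF assms(2), of uminus] assms(3) c' V]
    by simp
  finally show ?thesis by simp
qed

end

section \<open>Oscillations of local functions under a coupling\<close>

lemma bdd_oscillation:
  fixes g :: "'d::finite config \<Rightarrow> real"
  assumes "finite Y" "depends_on Y g"
  shows "bdd_above (range (\<lambda>\<sigma>. \<bar>g (\<sigma>(x := \<not> \<sigma> x)) - g \<sigma>\<bar>))"
proof -
  let ?Z = "g ` configs Y (\<lambda>_. False)"
  have fin: "finite ?Z" using assms(1) by (intro finite_imageI finite_configs)
  have g: "g \<sigma> \<in> ?Z" for \<sigma>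
    using assms(2)
    by (intro image_eqI[of _ _ "override_on (\<lambda>_. False) \<sigma> Y"] depends_onD)
       (auto simp: configs_def)
  have "range (\<lambda>\<sigma>. \<bar>g (\<sigma>(x := \<not> \<sigma> x)) - g \<sigma>\<bar>) \<subseteq> (\<lambda>(a, b). \<bar>a - b\<bar>) ` (?Z \<times> ?Z)"
    using g by (auto intro!: image_eqI[of _ _ "(g _, g _)"])
  then show ?thesis
    using fin by (intro bdd_above_mono[OF bdd_above_finite]) auto
qed

lemma oscillation_upper:
  assumes "finite Y" "depends_on Y g"
  shows "\<bar>g (\<sigma>(x := \<not> \<sigma> x)) - g \<sigma>\<bar> \<le> oscillation g x"
  unfolding oscillation_def by (rule cSUP_upper[OF UNIV_I bdd_oscillation[OF assms]])

lemma oscillation_nonneg: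
  assumes "finite Y" "depends_on Y g" shows "0 \<le> oscillation g x"
  using oscillation_upper[OF assms, of "\<lambda>_. True" x] by linarith

lemma oscillation_outside:
  assumes "depends_on Y g" "x \<notin> Y" shows "oscillation g x = 0"
proof -
  have "g (\<sigma>(x := \<not> \<sigma> x)) = g \<sigma>" for \<sigma>
    using assms by (intro depends_onD[OF assms(1)]) auto
  then show ?thesis by (simp add: oscillation_def)
qed

text \<open>The spins of \<open>Y\<close> are switched from \<omega> to \<omega>' one at a time; a
  switch costs nothing where the two agree.\<close>

lemma telescoping_oscillation:
  assumes Y: "finite Y" "depends_on Y g"
  shows "\<bar>g \<omega> - g \<omega>'\<bar> \<le> (\<Sum>y\<in>Y. of_bool (\<omega> y \<noteq> \<omega>' y) * oscillation g y)"
proof -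
  have "\<bar>g \<omega> - g (override_on \<omega> \<omega>' F)\<bar> \<le> (\<Sum>y\<in>F. of_bool (\<omega> y \<noteq> \<omega>' y) * oscillation g y)"
    if "finite F" for F
    using that
  proof (induction F rule: finite_induct)
    case (insert y F)
    let ?\<tau> = "override_on \<omega> \<omega>' F"
    have "\<bar>g ?\<tau> - g (override_on \<omega> \<omega>' (insert y F))\<bar> \<le> of_bool (\<omega> y \<noteq> \<omega>' y) * oscillation g y"
    proof (cases "\<omega> y = \<omega>' y")
      case True
      then have "override_on \<omega> \<omega>' (insert y F) = ?\<tau>" by (auto simp: override_on_def fun_eq_iff)
      then show ?thesis using True by simp
    next
      case False
      then have "override_on \<omega> \<omega>' (insert y F) = ?\<tau>(y := \<not> ?\<tau> y)"
        using insert.hyps by (auto simp: override_on_def fun_eq_iff)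
      then show ?thesis
        using False oscillation_upper[OF Y, of ?\<tau> y] by (simp add: abs_minus_commute)
    qed
    then show ?case
      using insert.IH unfolding sum.insert[OF insert.hyps(1,2)] by linarith
  qed simp
  moreover have "g (override_on \<omega> \<omega>' Y) = g \<omega>'"
    using Y(2) by (intro depends_onD[OF Y(2)]) auto
  ultimately show ?thesis using Y(1) by metis
qed

text \<open>Both integrals are written over the coupling, where the telescoping bound holds
  pointwise.\<close>

lemma coupling_integral_difference:
  fixes g :: "'d::finite config \<Rightarrow> real"
  assumes Q: "coupling \<mu> \<nu> Q" and prob: "prob_space \<mu>" "prob_space \<nu>"
    and sets: "sets \<mu> = sets spin_space" "sets \<nu> = sets spin_space"
    and Y: "finite Y" "depends_on Y g"
  shows "\<bar>integral\<^sup>L \<mu> g - integral\<^sup>L \<nu> g\<bar>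
    \<le> (\<Sum>y\<in>Y. measure Q {(\<omega>1, \<omega>2). \<omega>1 y \<noteq> \<omega>2 y} * oscillation g y)"
proof -
  interpret Q: prob_space Q using Q prob(1) by (rule coupling_prob_space)
  have setsQ: "sets Q = sets (\<mu> \<Otimes>\<^sub>M \<nu>)" and fst: "distr Q \<mu> fst = \<mu>" and snd: "distr Q \<nu> snd = \<nu>"
    using Q by (auto simp: coupling_def)
  have meas: "fst \<in> measurable Q \<mu>" "snd \<in> measurable Q \<nu>"
    unfolding measurable_cong_sets[OF setsQ refl] by simp_all
  have pairs: "sets Q = sets (spin_space \<Otimes>\<^sub>M spin_space)"
    unfolding setsQ using sets by (intro sets_pair_measure_cong)
  have spaceQ: "space Q = UNIV"
    using sets_eq_imp_space_eq[OF pairs] by (simp add: space_pair_measure)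
  have dis: "{(\<omega>1, \<omega>2). \<omega>1 y \<noteq> \<omega>2 y} \<in> Q.events" for y
    unfolding pairs by (rule disagreement_in_sets)
  have g1: "integrable \<mu> g" and g2: "integrable \<nu> g"
    using local_integral(1) prob sets Y by blast+
  have i1: "integrable Q (\<lambda>\<omega>. g (fst \<omega>))" "integral\<^sup>L \<mu> g = (\<integral>\<omega>. g (fst \<omega>) \<partial>Q)"
    using integrable_distr[OF meas(1), of g] integral_distr[OF meas(1), of g] g1 borel_measurable_integrable
    by (auto simp: fst)
  have i2: "integrable Q (\<lambda>\<omega>. g (snd \<omega>))" "integral\<^sup>L \<nu> g = (\<integral>\<omega>. g (snd \<omega>) \<partial>Q)"
    using integrable_distr[OF meas(2), of g] integral_distr[OF meas(2), of g] g2 borel_measurable_integrable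
    by (auto simp: snd)
  let ?D = "\<lambda>y. {(\<omega>1, \<omega>2). \<omega>1 y \<noteq> \<omega>2 y} :: ('d config \<times> 'd config) set"
  have int: "integrable Q (\<lambda>\<omega>. indicator (?D y) \<omega> * oscillation g y)" for y
    using dis by (intro integrable_mult_left) (simp add: less_top[symmetric])
  have "\<bar>integral\<^sup>L \<mu> g - integral\<^sup>L \<nu> g\<bar> = \<bar>\<integral>\<omega>. g (fst \<omega>) - g (snd \<omega>) \<partial>Q\<bar>"
    using i1 i2 by simp
  also have "\<dots> \<le> (\<integral>\<omega>. \<bar>g (fst \<omega>) - g (snd \<omega>)\<bar> \<partial>Q)"
    by (rule integral_abs_bound)
  also have "\<dots> \<le> (\<integral>\<omega>. (\<Sum>y\<in>Y. indicator (?D y) \<omega> * oscillation g y) \<partial>Q)"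
  proof (rule integral_mono)
    show "integrable Q (\<lambda>\<omega>. \<bar>g (fst \<omega>) - g (snd \<omega>)\<bar>)" using i1 i2 by auto
    show "integrable Q (\<lambda>\<omega>. \<Sum>y\<in>Y. indicator (?D y) \<omega> * oscillation g y)"
      by (intro Bochner_Integration.integrable_sum int)
    fix \<omega>
    show "\<bar>g (fst \<omega>) - g (snd \<omega>)\<bar> \<le> (\<Sum>y\<in>Y. indicator (?D y) \<omega> * oscillation g y)"
      using telescoping_oscillation[OF Y, of "fst \<omega>" "snd \<omega>"]
      by (simp add: indicator_def of_bool_def case_prod_unfold)
  qed
  also have "\<dots> = (\<Sum>y\<in>Y. \<integral>\<omega>. indicator (?D y) \<omega> * oscillation g y \<partial>Q)"
    by (intro Bochner_Integration.integral_sum int)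
  also have "\<dots> = (\<Sum>y\<in>Y. measure Q (?D y) * oscillation g y)"
    using spaceQ by simp
  finally show ?thesis .
qed

section \<open>Exponential sums over the lattice and the Schur test\<close>

lemma sum_geometric_int_le:
  fixes a :: real assumes "0 \<le> a" "a < 1"
  shows "(\<Sum>j\<in>{x - int m..x + int m}. a ^ nat \<bar>x - j\<bar>) \<le> 2 / (1 - a)"
proof -
  have geo: "(\<Sum>i\<le>m. a ^ i) \<le> 1 / (1 - a)"
    using assms sum_le_suminf[OF summable_geometric, of a "{..m}"] by (simp add: suminf_geometric)
  let ?U = "\<lambda>i. x + int i" and ?V = "\<lambda>i. x - int i"
  have sub: "{x - int m..x + int m} \<subseteq> ?U ` {..m} \<union> ?V ` {..m}"
  proof
    fix j assume j: "j \<in> {x - int m..x + int m}"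
    show "j \<in> ?U ` {..m} \<union> ?V ` {..m}"
    proof (cases "x \<le> j")
      case True
      then have "j = ?U (nat (j - x))" "nat (j - x) \<le> m" using j by auto
      then show ?thesis by blast
    next
      case False
      then have "j = ?V (nat (x - j))" "nat (x - j) \<le> m" using j by auto
      then show ?thesis by blast
    qed
  qed
  have "(\<Sum>j\<in>{x - int m..x + int m}. a ^ nat \<bar>x - j\<bar>)
      \<le> (\<Sum>j\<in>?U ` {..m} \<union> ?V ` {..m}. a ^ nat \<bar>x - j\<bar>)"
    using assms sub by (intro sum_mono2) auto
  also have "\<dots> \<le> (\<Sum>j\<in>?U ` {..m}. a ^ nat \<bar>x - j\<bar>) + (\<Sum>j\<in>?V ` {..m}. a ^ nat \<bar>x - j\<bar>)"
    using assms by (subst sum_Un) (auto intro!: sum_nonneg)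
  also have "\<dots> = (\<Sum>i\<le>m. a ^ i) + (\<Sum>i\<le>m. a ^ i)"
    by (subst (1 2) sum.reindex) (auto simp: inj_on_def)
  also have "\<dots> \<le> 2 / (1 - a)" using geo by simp
  finally show ?thesis .
qed

text \<open>The l1 distance is at most \<open>n\<close> times the Euclidean one, so the exponential
  is dominated by a product over coordinates and its sum by a power of a two-sided geometric
  series.\<close>

lemma sum_exp_sdist_bounded:
  assumes "0 < C"
  shows "\<exists>M>0. \<forall>F (x :: 'd::finite site). finite F \<longrightarrow> (\<Sum>y\<in>F. exp (- C * sdist x y)) \<le> M"
proof -
  define n where "n = real CARD('d)"
  define a where "a = exp (- (C / n))"
  have n: "0 < n" by (simp add: n_def)
  have a: "0 < a" "a < 1" using assms n by (auto simp: a_def)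
  have "(\<Sum>y\<in>F. exp (- C * sdist x y)) \<le> (2 / (1 - a)) ^ CARD('d)"
    if "finite F" for F and x :: "'d site"
  proof -
    define m where "m = nat (\<Sum>y\<in>F. \<Sum>i\<in>UNIV. \<bar>x $ i - y $ i\<bar>)"
    let ?B = "\<lambda>i. {x $ i - int m..x $ i + int m}"
    let ?h = "\<lambda>g :: 'd \<Rightarrow> int. \<Prod>i\<in>UNIV. a ^ nat \<bar>x $ i - g i\<bar>"
    have le_h: "exp (- C * sdist x y) \<le> ?h (vec_nth y)" for y
    proof -
      have "(\<Sum>i\<in>UNIV. real (nat \<bar>x $ i - y $ i\<bar>)) \<le> n * sdist x y"
        using sum_bounded_above[of UNIV "\<lambda>i. real (nat \<bar>x $ i - y $ i\<bar>)" "sdist x y"]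
          sdist_component_le[of x _ y] by (simp add: n_def)
      then have "C / n * (\<Sum>i\<in>UNIV. real (nat \<bar>x $ i - y $ i\<bar>)) \<le> C / n * (n * sdist x y)"
        using assms n by (intro mult_left_mono) auto
      then have "- C * sdist x y \<le> (\<Sum>i\<in>UNIV. real (nat \<bar>x $ i - y $ i\<bar>) * - (C / n))"
        using n by (simp add: sum_distrib_left sum_negf mult.commute)
      then have "exp (- C * sdist x y) \<le> exp (\<Sum>i\<in>UNIV. real (nat \<bar>x $ i - y $ i\<bar>) * - (C / n))"
        by simp
      also have "\<dots> = ?h (vec_nth y)"
        unfolding a_def by (simp add: exp_sum exp_of_nat_mult[symmetric])
      finally show ?thesis .
    qed
    have inj: "inj_on vec_nth F" by (auto intro!: inj_onI simp: vec_nth_inject)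
    have sub: "vec_nth ` F \<subseteq> Pi\<^sub>E UNIV ?B"
    proof (intro image_subsetI)
      fix y assume y: "y \<in> F"
      have "\<bar>x $ i - y $ i\<bar> \<le> int m" for i
      proof -
        have "\<bar>x $ i - y $ i\<bar> \<le> (\<Sum>i\<in>UNIV. \<bar>x $ i - y $ i\<bar>)"
          by (intro member_le_sum) auto
        also have "\<dots> \<le> (\<Sum>y\<in>F. \<Sum>i\<in>UNIV. \<bar>x $ i - y $ i\<bar>)"
          using that y by (intro member_le_sum[of y F "\<lambda>y. \<Sum>i\<in>UNIV. \<bar>x $ i - y $ i\<bar>"]) (auto intro: sum_nonneg)
        finally show ?thesis
          using sum_nonneg[of F "\<lambda>y. \<Sum>i\<in>UNIV. \<bar>x $ i - y $ i\<bar>"] by (simp add: m_def sum_nonneg)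
      qed
      then have "x $ i - int m \<le> y $ i \<and> y $ i \<le> x $ i + int m" for i
        by (smt (verit))
      then show "vec_nth y \<in> Pi\<^sub>E UNIV ?B" by auto
    qed
    have "(\<Sum>y\<in>F. exp (- C * sdist x y)) \<le> (\<Sum>y\<in>F. ?h (vec_nth y))"
      by (intro sum_mono le_h)
    also have "\<dots> = (\<Sum>g\<in>vec_nth ` F. ?h g)"
      by (simp add: sum.reindex[OF inj])
    also have "\<dots> \<le> (\<Sum>g\<in>Pi\<^sub>E UNIV ?B. ?h g)"
      using sub a by (intro sum_mono2 finite_PiE) (auto intro: prod_nonneg)
    also have "\<dots> = (\<Prod>i\<in>UNIV. \<Sum>j\<in>?B i. a ^ nat \<bar>x $ i - j\<bar>)"
      by (subst prod_sum_PiE) auto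
    also have "\<dots> \<le> (\<Prod>i\<in>(UNIV :: 'd set). 2 / (1 - a))"
      using a by (intro prod_mono conjI sum_nonneg sum_geometric_int_le) auto
    also have "\<dots> = (2 / (1 - a)) ^ CARD('d)" by simp
    finally show ?thesis .
  qed
  moreover have "0 < (2 / (1 - a)) ^ CARD('d)" using a by simp
  ultimately show ?thesis by blast
qed

text \<open>Cauchy-Schwarz after splitting \<open>d x y\<close> into two square roots. Row sums
  enter for each fixed \<open>x\<close>, column sums after the order of summation is
  exchanged.\<close>

lemma schur_test:
  fixes d :: "'a \<Rightarrow> 'b \<Rightarrow> real"
  assumes "\<And>x y. 0 \<le> d x y" "0 \<le> M"
    and row: "\<And>x. x \<in> X \<Longrightarrow> (\<Sum>y\<in>Y. d x y) \<le> M" and col: "\<And>y. y \<in> Y \<Longrightarrow> (\<Sum>x\<in>X. d x y) \<le> M"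
  shows "(\<Sum>x\<in>X. (\<Sum>y\<in>Y. d x y * v y)\<^sup>2) \<le> M\<^sup>2 * (\<Sum>y\<in>Y. (v y)\<^sup>2)"
proof -
  have "(\<Sum>x\<in>X. (\<Sum>y\<in>Y. d x y * v y)\<^sup>2) \<le> (\<Sum>x\<in>X. M * (\<Sum>y\<in>Y. d x y * (v y)\<^sup>2))"
  proof (rule sum_mono)
    fix x assume x: "x \<in> X"
    have "(\<Sum>y\<in>Y. d x y * v y)\<^sup>2 = (\<Sum>y\<in>Y. sqrt (d x y) * (sqrt (d x y) * v y))\<^sup>2"
      using assms(1) by (simp add: mult.assoc[symmetric])
    also have "\<dots> \<le> (\<Sum>y\<in>Y. (sqrt (d x y))\<^sup>2) * (\<Sum>y\<in>Y. (sqrt (d x y) * v y)\<^sup>2)"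
      by (rule Cauchy_Schwarz_ineq_sum)
    also have "\<dots> = (\<Sum>y\<in>Y. d x y) * (\<Sum>y\<in>Y. d x y * (v y)\<^sup>2)"
      using assms(1) by (simp add: power_mult_distrib)
    also have "\<dots> \<le> M * (\<Sum>y\<in>Y. d x y * (v y)\<^sup>2)"
      using assms(1) row[OF x] by (intro mult_right_mono sum_nonneg) auto
    finally show "(\<Sum>y\<in>Y. d x y * v y)\<^sup>2 \<le> M * (\<Sum>y\<in>Y. d x y * (v y)\<^sup>2)" .
  qed
  also have "\<dots> = M * (\<Sum>y\<in>Y. (\<Sum>x\<in>X. d x y) * (v y)\<^sup>2)"
    unfolding sum_distrib_left[symmetric] sum_distrib_right by (subst sum.swap) simp
  also have "\<dots> \<le> M * (\<Sum>y\<in>Y. M * (v y)\<^sup>2)"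
    using assms(2) col by (intro mult_left_mono sum_mono mult_right_mono) auto
  also have "\<dots> = M\<^sup>2 * (\<Sum>y\<in>Y. (v y)\<^sup>2)"
    by (simp add: sum_distrib_left power2_eq_square mult.assoc)
  finally show ?thesis .
qed

text \<open>One half of the equivalence of norms: decay in Euclidean distance becomes decay in
  \<open>nrm\<close>, with the rate divided by \<open>K\<close>.\<close>

lemma lattice_norm_le:
  fixes nrm :: "'d::finite site \<Rightarrow> real"
  assumes "lattice_norm nrm"
  shows "\<exists>K>0. \<forall>x y. nrm (x - y) \<le> K * sdist x y"
proof -
  from assms obtain N :: "real ^ 'd \<Rightarrow> real" where
    zero: "\<And>v. N v = 0 \<longleftrightarrow> v = 0" and scale: "\<And>a v. N (a *\<^sub>R v) = \<bar>a\<bar> * N v"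
    and triangle: "\<And>v w. N (v + w) \<le> N v + N w" and nrm: "\<And>x. nrm x = N (to_real x)"
    by (auto simp: lattice_norm_def)
  have nonneg: "0 \<le> N v" for v
    using triangle[of v "(-1) *\<^sub>R v"] scale[of "-1" v] zero[of 0] by simp
  let ?K = "1 + (\<Sum>i\<in>UNIV. N (axis i 1))"
  have N_sum: "N (\<Sum>i\<in>I. f i) \<le> (\<Sum>i\<in>I. N (f i))" if "finite I" for I :: "'d set" and f
    using that
  proof (induction I rule: finite_induct)
    case empty
    then show ?case using zero[of 0] by simp
  next
    case (insert i I)
    then show ?case using triangle[of "f i" "\<Sum>i\<in>I. f i"] by simp
  qed
  have "N v \<le> ?K * norm v" for v
  proof -
    have "v = (\<Sum>i\<in>UNIV. (v $ i) *\<^sub>R axis i 1)"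
      using basis_expansion[of v] by (simp add: scalar_mult_eq_scaleR)
    then have "N v \<le> (\<Sum>i\<in>UNIV. \<bar>v $ i\<bar> * N (axis i 1))"
      using N_sum[of UNIV "\<lambda>i. (v $ i) *\<^sub>R axis i 1"] by (simp add: scale)
    also have "\<dots> \<le> (\<Sum>i\<in>UNIV. norm v * N (axis i 1))"
      using nonneg by (intro sum_mono mult_right_mono component_le_norm_cart)
    also have "\<dots> \<le> ?K * norm v"
      by (simp add: sum_distrib_left[symmetric] algebra_simps)
    finally show ?thesis .
  qed
  then have "nrm (x - y) \<le> ?K * sdist x y" for x y
    by (simp add: nrm to_real_diff dist_norm)
  moreover have "0 < ?K" using nonneg by (intro add_pos_nonneg sum_nonneg) auto
  ultimately show ?thesis by blast
qed

context gibbs_field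
begin

text \<open>The martingale difference at the site \<open>inv \<Gamma> k\<close> is at most
  \<open>c k\<close>, an entry of the matrix of exponential bounds applied to the oscillations. That
  matrix is symmetric, so the single constant \<open>M\<close> bounds both row and column sums in
  the Schur test.\<close>

lemma coupling_concentration:
  fixes \<Gamma> :: "'d site \<Rightarrow> nat"
  assumes \<Gamma>: "bij \<Gamma>" and Q: "\<And>x \<sigma>. maximal_coupling \<Gamma> P \<sigma> x (Q x \<sigma>)"
    and D: "\<And>x y \<sigma>. coupling_matrix Q \<sigma> x y \<le> exp (- C * sdist x y)"
    and M: "0 < M" "\<And>F (x :: 'd site). finite F \<Longrightarrow> (\<Sum>y\<in>F. exp (- C * sdist x y)) \<le> M"
    and "finite Y" "depends_on Y g" "0 < t" and V: "0 < (\<Sum>y\<in>Y. (oscillation g y)\<^sup>2)"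
  shows "prob {\<omega>. t \<le> \<bar>g \<omega> - integral\<^sup>L P g\<bar>}
    \<le> 2 * exp (- (2 * t\<^sup>2) / (M\<^sup>2 * (\<Sum>y\<in>Y. (oscillation g y)\<^sup>2)))"
proof -
  have inj: "inj \<Gamma>" using \<Gamma> by (rule bij_is_inj)
  have e: "\<Gamma> (inv \<Gamma> k) = k" "inv \<Gamma> (\<Gamma> y) = y" for k y
    using \<Gamma> by (simp_all add: bij_is_inj bij_is_surj surj_f_inv_f)
  from eventually_window[OF inj assms(6)] obtain N where N: "Y \<subseteq> {y. \<Gamma> y < N}"
    by (auto simp: eventually_sequentially)
  have dep: "depends_on {y. \<Gamma> y < N} g" using assms(7) N by (rule depends_on_mono)
  define c where "c = (\<lambda>k. \<Sum>y\<in>Y. exp (- C * sdist (inv \<Gamma> k) y) * oscillation g y)"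
  have c: "\<bar>cexp \<Gamma> (Suc k) (\<sigma>(inv \<Gamma> k := True)) g - cexp \<Gamma> (Suc k) (\<sigma>(inv \<Gamma> k := False)) g\<bar> \<le> c k" for k \<sigma>
  proof -
    define x where "x = inv \<Gamma> k"
    have k: "k = \<Gamma> x" by (simp add: x_def e)
    let ?m = "\<lambda>s. cond_measure \<Gamma> P \<sigma> x s"
    have m: "?m s = uniform_measure P (cylinder {y. \<Gamma> y < Suc (\<Gamma> x)} (\<sigma>(x := s)))" for s
      using inj by (rule cond_measure_eq)
    have "coupling (?m True) (?m False) (Q x \<sigma>)"
      using Q[of \<sigma> x] by (simp add: maximal_coupling_def Let_def)
    then have "\<bar>integral\<^sup>L (?m True) g - integral\<^sup>L (?m False) g\<bar>
        \<le> (\<Sum>y\<in>Y. measure (Q x \<sigma>) {(\<omega>1, \<omega>2). \<omega>1 y \<noteq> \<omega>2 y} * oscillation g y)"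
      using assms(6,7) finite_below[OF inj, of "Suc (\<Gamma> x)"] unfolding m
      by (intro coupling_integral_difference prob_space_uniform_cylinder) (simp_all add: sets_P)
    also have "\<dots> \<le> (\<Sum>y\<in>Y. exp (- C * sdist x y) * oscillation g y)"
      using D[of \<sigma> x] oscillation_nonneg[OF assms(6,7)]
      by (intro sum_mono mult_right_mono) (auto simp: coupling_matrix_def)
    finally show ?thesis
      unfolding cexp_def c_def k e m .
  qed
  have "(\<Sum>k\<in>{0..<N}. (c k)\<^sup>2) \<le> M\<^sup>2 * (\<Sum>y\<in>Y. (oscillation g y)\<^sup>2)"
    unfolding c_def
  proof (rule schur_test)
    fix y
    have "(\<Sum>k\<in>{0..<N}. exp (- C * sdist (inv \<Gamma> k) y)) = (\<Sum>x\<in>inv \<Gamma> ` {0..<N}. exp (- C * sdist y x))"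
      using e(1) by (subst sum.reindex) (auto simp: dist_commute intro!: inj_on_inverseI[of _ \<Gamma>])
    also have "\<dots> \<le> M" by (rule M) simp
    finally show "(\<Sum>k\<in>{0..<N}. exp (- C * sdist (inv \<Gamma> k) y)) \<le> M" .
  qed (use M assms(6) in auto)
  then show ?thesis
    using M(1) V by (intro concentration[OF \<Gamma> dep assms(8) c]) auto
qed

end

section \<open>Choice of the constants and conclusion\<close>

theorem theorem8:
  fixes U :: "'d::finite site set \<Rightarrow> 'd config \<Rightarrow> real"
    and P :: "'d config measure"
    and \<Gamma> :: "'d site \<Rightarrow> nat"
    and nrm :: "'d site \<Rightarrow> real"
  assumes "lattice_norm nrm"
    and "spiraling \<Gamma>"
    and "nearest_neighbor U"
    and "gibbs_measure U P"
    and "(SUP y. site_influence U y) < critical_threshold TYPE('d)"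
  shows "\<exists>C>0. \<exists>Q.
    (\<forall>x \<sigma>. maximal_coupling \<Gamma> P \<sigma> x (Q x \<sigma>)) \<and>
    (\<forall>x y \<sigma>. coupling_matrix Q \<sigma> x y \<le> exp (- C * nrm (x - y))) \<and>
    (\<forall>g t. local_function g \<longrightarrow> t > 0 \<longrightarrow>
       measure P {\<omega>. \<bar>g \<omega> - integral\<^sup>L P g\<bar> \<ge> t} \<le>
         (if \<forall>x. oscillation g x = 0 then 0
          else 2 * exp (- (2 * t\<^sup>2) /
                 (1 / (1 - exp (- 2 * C)) * (\<Sum>\<^sub>\<infinity>x. (oscillation g x)\<^sup>2)))))"
proof -
  interpret prob_space P using assms(4) by (simp add: gibbs_measure_def)
  interpret gibbs_field P U
    using assms(3,4) by unfold_locales (auto simp: gibbs_measure_def)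
  have \<Gamma>: "bij \<Gamma>" using assms(2) by (simp add: spiraling_def)

  define q where "q = (SUP y. site_influence U y)"
  have bdd: "bdd_above (range (site_influence U))"
    using site_influence_bounds(2)[OF nn] by (intro bdd_aboveI[of _ 2]) auto
  have osc: "\<bar>gibbs_spec U {y} (\<lambda>_. True) \<sigma> - gibbs_spec U {y} (\<lambda>_. True) \<sigma>'\<bar> \<le> q" for y \<sigma> \<sigma>'
  proof -
    have "2 * \<bar>gibbs_spec U {y} (\<lambda>_. True) \<sigma> - gibbs_spec U {y} (\<lambda>_. True) \<sigma>'\<bar> \<le> q"
      unfolding q_def by (rule cSUP_upper2[OF bdd UNIV_I site_influence_bounds(1)[OF nn]])
    moreover have "2 * a \<le> q \<Longrightarrow> 0 \<le> a \<Longrightarrow> a \<le> q" for a :: real by simp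
    ultimately show ?thesis using abs_ge_zero by blast
  qed
  have q: "0 \<le> q" "q < critical_threshold TYPE('d)"
    using osc[of 0 "\<lambda>_. True" "\<lambda>_. True"] assms(5) by (simp_all add: q_def)
  then have q1: "q < 1" using critical_threshold_le_1[where 'd = 'd] by simp
  obtain \<phi> L where \<phi>: "0 \<le> \<phi>" "\<phi> < 1" and L: "0 < L"
    and conn: "\<And>(V :: 'd site set) A y k. finite V \<Longrightarrow> (\<forall>a\<in>A. real k * L < sdist y a)
      \<Longrightarrow> conn_prob adj q (V - {y}) {y} A \<le> \<phi> ^ k"
    using conn_prob_exponential_decay[of q, where 'd = 'd] q q1 by auto
  have decay: "infl_prob adj q V A y \<le> q * \<phi> ^ k"
    if "finite V" "\<forall>a\<in>A. real k * L < sdist y a" for V A and y :: "'d site" and k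
  proof -
    have "0 \<le> real k * L" using L by simp
    then have "y \<notin> A" using that(2) by force
    then have "infl_prob adj q V A y \<le> q * conn_prob adj q (V - {y}) {y} A"
      using q q1 that(1) by (intro infl_prob_le[OF adj_sym]) auto
    also have "\<dots> \<le> q * \<phi> ^ k" using q conn[OF that] by (intro mult_left_mono)
    finally show ?thesis .
  qed

  define good where "good = (\<lambda>x \<sigma> Q. maximal_coupling \<Gamma> P \<sigma> x Q \<and>
      (\<forall>y k. real k * L < sdist y x \<longrightarrow> measure Q {(\<omega>1, \<omega>2). \<omega>1 y \<noteq> \<omega>2 y} \<le> q * \<phi> ^ k))"
  have "\<exists>Q. good x \<sigma> Q" for x \<sigma>
    unfolding good_def using q1 by (intro exists_maximal_coupling \<Gamma> osc \<phi> L decay) auto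
  then obtain Q where good: "\<And>x \<sigma>. good x \<sigma> (Q x \<sigma>)" by metis
  have Q: "maximal_coupling \<Gamma> P \<sigma> x (Q x \<sigma>)" for x \<sigma>
    using good[of x \<sigma>] unfolding good_def by blast
  have Q_decay: "measure (Q x \<sigma>) {(\<omega>1, \<omega>2). \<omega>1 y \<noteq> \<omega>2 y} \<le> q * \<phi> ^ k"
    if "real k * L < sdist y x" for k y x \<sigma>
    using good[of x \<sigma>] that unfolding good_def by blast
  have Q_prob: "prob_space (Q x \<sigma>)" for x \<sigma>
  proof (rule coupling_prob_space)
    show "coupling (cond_measure \<Gamma> P \<sigma> x True) (cond_measure \<Gamma> P \<sigma> x False) (Q x \<sigma>)"
      using Q[of \<sigma> x] by (simp add: maximal_coupling_def Let_def)
    show "prob_space (cond_measure \<Gamma> P \<sigma> x True)"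
      unfolding cond_measure_eq[OF bij_is_inj[OF \<Gamma>]]
      by (intro prob_space_uniform_cylinder finite_below bij_is_inj \<Gamma>)
  qed

  \<comment> \<open>The value 1 / 2 keeps \<open>r\<close> positive when \<open>q\<close> and \<phi>
    are both 0.\<close>
  define r where "r = max (max q \<phi>) (1 / 2)"
  have r: "0 < r" "r < 1" "q \<le> r" "\<phi> \<le> r" using q1 \<phi> by (auto simp: r_def)
  \<comment> \<open>Half of the rate \<open>- ln r / L\<close>: beyond distance \<open>2 * L\<close>
    rounding costs at most half of the exponent, and up to that distance the bound \<open>q\<close>
    suffices.\<close>
  define C\<^sub>0 where "C\<^sub>0 = - ln r / (2 * L)"
  have C0: "0 < C\<^sub>0" using r L by (simp add: C\<^sub>0_def divide_neg_pos)
  have r_powr: "exp (- C\<^sub>0 * s) = r powr (s / (2 * L))" for s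
    using r by (simp add: C\<^sub>0_def powr_def)
  have D: "coupling_matrix Q \<sigma> x y \<le> exp (- C\<^sub>0 * sdist x y)" for \<sigma> x y
  proof -
    define s where "s = sdist x y"
    let ?D = "measure (Q x \<sigma>) {(\<omega>1, \<omega>2). \<omega>1 y \<noteq> \<omega>2 y}"
    have "?D \<le> r powr (s / (2 * L))"
    proof (cases "x = y")
      case True
      then show ?thesis using prob_space.prob_le_1[OF Q_prob] r by (simp add: s_def)
    next
      case False
      then have s: "1 \<le> s" "s = sdist y x" using sdist_ge_1 by (auto simp: s_def dist_commute)
      show ?thesis
      proof (cases "s \<le> 2 * L")
        case True
        have "?D \<le> q" using Q_decay[of 0 y x \<sigma>] s False by auto
        also have "\<dots> \<le> r powr 1" using r by simp
        also have "\<dots> \<le> r powr (s / (2 * L))" using r True L by (intro powr_mono') (auto simp: divide_le_eq)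
        finally show ?thesis .
      next
        case False
        \<comment> \<open>The largest integer strictly below \<open>s / L\<close>, as the decay
          estimate needs a strict inequality.\<close>
        define k where "k = nat (\<lceil>s / L\<rceil> - 1)"
        have sL: "2 < s / L" using False L by (simp add: field_simps)
        have "real k = of_int \<lceil>s / L\<rceil> - 1" using sL by (simp add: k_def)
        then have k: "real k < s / L" "s / L - 1 \<le> real k" by linarith+
        have "?D \<le> q * \<phi> ^ k" using Q_decay[of k y x \<sigma>] k(1) L s by (simp add: field_simps)
        also have "\<dots> \<le> 1 * r ^ k" using q q1 \<phi> r by (intro mult_mono power_mono) auto
        also have "\<dots> = r powr real k" using r by (simp add: powr_realpow)
        also have "\<dots> \<le> r powr (s / (2 * L))"
        proof (intro powr_mono')
          have "s / (2 * L) = (s / L) / 2" by simp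
          then show "s / (2 * L) \<le> real k" using k(2) sL by linarith
        qed (use r in auto)
        finally show ?thesis .
      qed
    qed
    then show ?thesis unfolding coupling_matrix_def r_powr s_def[symmetric] .
  qed

  obtain M where M: "0 < M" "\<And>F (x :: 'd site). finite F \<Longrightarrow> (\<Sum>y\<in>F. exp (- C\<^sub>0 * sdist x y)) \<le> M"
    using sum_exp_sdist_bounded[OF C0, where 'd = 'd] by blast
  obtain K where K: "0 < K" "\<And>x y. nrm (x - y) \<le> K * sdist x y"
    using lattice_norm_le[OF assms(1)] by blast
  \<comment> \<open>The first term adapts the rate to \<open>nrm\<close>. The second, through
    \<open>1 - exp (- 2 * C) \<le> 2 * C\<close>, makes \<open>1 / (1 - exp (- 2 * C))\<close> at
    least the Schur constant \<open>M\<^sup>2\<close>.\<close>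
  define C where "C = min (C\<^sub>0 / K) (1 / (2 * M\<^sup>2))"
  have C: "0 < C" using C0 K M by (simp add: C_def)
  have "coupling_matrix Q \<sigma> x y \<le> exp (- C * nrm (x - y))" for \<sigma> x y
  proof -
    have "C * nrm (x - y) \<le> C * (K * sdist x y)"
      using C K by (intro mult_left_mono) auto
    also have "\<dots> \<le> C\<^sub>0 / K * (K * sdist x y)"
      using K by (intro mult_right_mono) (auto simp: C_def)
    also have "\<dots> = C\<^sub>0 * sdist x y" using K by simp
    finally have "exp (- C\<^sub>0 * sdist x y) \<le> exp (- C * nrm (x - y))" by simp
    with D[of \<sigma> x y] show ?thesis by linarith
  qed
  moreover have "measure P {\<omega>. \<bar>g \<omega> - integral\<^sup>L P g\<bar> \<ge> t} \<le>
         (if \<forall>x. oscillation g x = 0 then 0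
          else 2 * exp (- (2 * t\<^sup>2) /
                 (1 / (1 - exp (- 2 * C)) * (\<Sum>\<^sub>\<infinity>x. (oscillation g x)\<^sup>2))))"
    if g: "local_function g" and t: "0 < t" for g t
  proof -
    from g obtain Y where Y: "finite Y" "depends_on Y g"
      by (auto simp: local_function_def depends_on_def)
    show ?thesis
    proof (cases "\<forall>x. oscillation g x = 0")
      case True
      then have const: "g \<omega> = g \<omega>'" for \<omega> \<omega>'
        using telescoping_oscillation[OF Y, of \<omega> \<omega>'] by simp
      have "integral\<^sup>L P g = g \<omega>" for \<omega>
      proof -
        have "integral\<^sup>L P g = (\<integral>_. g \<omega> \<partial>P)"
          by (intro Bochner_Integration.integral_cong refl const)
        then show ?thesis using prob_space by simp
      qed
      then show ?thesis using True t by simp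
    next
      case False
      define W where "W = (\<Sum>y\<in>Y. (oscillation g y)\<^sup>2)"
      obtain y where y: "oscillation g y \<noteq> 0" "y \<in> Y"
        using False oscillation_outside[OF Y(2)] by blast
      then have W: "0 < W" unfolding W_def using Y(1) by (intro sum_pos2[of _ y]) auto
      have sum: "(\<Sum>\<^sub>\<infinity>x. (oscillation g x)\<^sup>2) = W"
        unfolding W_def infsum_finite[OF Y(1), symmetric]
        using oscillation_outside[OF Y(2)] by (intro infsum_cong_neutral) auto
      have "1 - exp (- 2 * C) \<le> 2 * C" using exp_ge_add_one_self[of "- 2 * C"] by simp
      also have "\<dots> \<le> 1 / M\<^sup>2" using M by (simp add: C_def min_def field_simps)
      finally have "M\<^sup>2 \<le> 1 / (1 - exp (- 2 * C))"
        using C M by (simp add: field_simps)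
      then have "M\<^sup>2 * W \<le> 1 / (1 - exp (- 2 * C)) * W" using W by (intro mult_right_mono) auto
      moreover have "0 < M\<^sup>2 * W" using M W by simp
      moreover have "- (2 * t\<^sup>2) / a \<le> - (2 * t\<^sup>2) / b" if "a \<le> b" "0 < a" for a b
        unfolding minus_divide_left[symmetric] neg_le_iff_le
        using that by (intro divide_left_mono mult_pos_pos) auto
      ultimately have "- (2 * t\<^sup>2) / (M\<^sup>2 * W) \<le> - (2 * t\<^sup>2) / (1 / (1 - exp (- 2 * C)) * W)"
        by blast
      moreover have "measure P {\<omega>. t \<le> \<bar>g \<omega> - integral\<^sup>L P g\<bar>} \<le> 2 * exp (- (2 * t\<^sup>2) / (M\<^sup>2 * W))"
        unfolding W_def using W
        by (intro coupling_concentration[OF \<Gamma> Q D M Y t]) (simp_all add: W_def)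
      ultimately have "measure P {\<omega>. t \<le> \<bar>g \<omega> - integral\<^sup>L P g\<bar>}
          \<le> 2 * exp (- (2 * t\<^sup>2) / (1 / (1 - exp (- 2 * C)) * W))"
        by (meson exp_le_cancel_iff mult_left_mono order_trans zero_le_numeral)
      then show ?thesis unfolding sum if_not_P[OF False] .
    qed
  qed
  ultimately show ?thesis using C Q by blast
qed

end
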